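(* The 1-dimensional connected geodesic submanifolds of $S^2\times S^2$ are the submanifolds $\{(\exp(r_1t)x,\exp(r_2t)y)\colon t\in\mathbb{R}\}$, where $r_i\in\mathfrak{o}(3)$ and $x,y\in S^2$. The 2-dimensional connected geodesic submanifolds of $S^2\times S^2$ are of the following types: 1. $\{(x,Rx)\colon x\in S^2\}\simeq S^2$, where $R\in O(3)$ is fixed. 2. $\{(x,y)\colon x\in S^2\}\simeq S^2$, where $y\in S^2$ is fixed, or $\{(x,y)\colon y\in S^2\}\simeq S^2$, where $x\in S^2$ is fixed. 3. $\{(\exp(r_1t_1)x,\exp(r_2t_2)y)\colon t_1,t_2\in\mathbb{R}\}\simeq S^1\times S^1$, where $r_i\in\mathfrak{o}(3)$ and $x,y\in S^2$ are fixed. The 3-dimensional connected geodesic submanifolds of $S^2\times S^2$ are precisely the submanifolds $\{(x,\exp(rt)y)\colon x\in S^2,\ t\in\mathbb{R}\}\simeq S^2\times S^1$, for some fixed $y\in S^2$ and $r\in\mathfrak{o}(3)$.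
   Context: $S^2$ is the unit sphere in $\mathbb{R}^3$ and $S^2\times S^2$ is the product symmetric space. $\mathfrak{o}(3)$ is the Lie algebra of skew-symmetric real $3\times3$ matrices, $O(3)$ the group of orthogonal $3\times 3$ matrices, and $\exp$ the matrix exponential. "Geodesic submanifold" means totally geodesic submanifold: a submanifold $N$ such that for all points $p\in N$ and tangent vectors $v\in T_pN$, the geodesic of the ambient space through $p$ with initial velocity $v$ is contained in $N$ for sufficiently small time.
   Formalization: The lists classify complete (immersed) connected geodesic submanifolds, others lying in a complete one of equal dimension; each exp(rt)x must be a great circle or, where dimension permits, a point; and {(exp(rt)x,y): y in S^2, t real} is added in dimension 3. *)

theory Defs
  imports "HOL-Analysis.Analysis"
begin

section \<open>Smooth maps\<close>

fun Ck_on :: "nat \<Rightarrow> 'a::real_normed_vector set \<Rightarrow> ('a \<Rightarrow> 'b::real_normed_vector) \<Rightarrow> bool" where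
  "Ck_on 0 W f \<longleftrightarrow> continuous_on W f"
| "Ck_on (Suc n) W f \<longleftrightarrow>
     (\<forall>x\<in>W. f differentiable (at x)) \<and>
     (\<forall>v. Ck_on n W (\<lambda>x. frechet_derivative f (at x) v))"

(* C^infinity; used for open W and finite-dimensional domain only. *)
definition smooth_on :: "'a::real_normed_vector set \<Rightarrow> ('a \<Rightarrow> 'b::real_normed_vector) \<Rightarrow> bool" where
  "smooth_on W f \<longleftrightarrow> (\<forall>n. Ck_on n W f)"

(* Smoothness of a map on an arbitrary subset A of a Euclidean space:
   locally the restriction of a smooth map of the surrounding space. *)
definition smooth_map_on :: "'a::real_normed_vector set \<Rightarrow> ('a \<Rightarrow> 'b::real_normed_vector) \<Rightarrow> bool" where
  "smooth_map_on A f \<longleftrightarrow>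
     (\<forall>p\<in>A. \<exists>W F. open W \<and> p \<in> W \<and> smooth_on W F \<and> (\<forall>x\<in>A \<inter> W. F x = f x))"

definition diffeomorphic :: "'a::real_normed_vector set \<Rightarrow> 'b::real_normed_vector set \<Rightarrow> bool" where
  "diffeomorphic A B \<longleftrightarrow>
     (\<exists>f g. homeomorphism A B f g \<and> smooth_map_on A f \<and> smooth_map_on B g)"


section \<open>Submanifolds of a Euclidean space\<close>

(* The local slice condition: near each of its points, U is carried by a diffeomorphism
   between open sets of the surrounding space to an open piece of a k-dimensional
   linear subspace. *)
definition embedded_submanifold :: "nat \<Rightarrow> 'a::euclidean_space set \<Rightarrow> bool" where
  "embedded_submanifold k U \<longleftrightarrow>
     (\<forall>p\<in>U. \<exists>W W' \<Phi> \<Psi> S.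
        open W \<and> p \<in> W \<and> open W' \<and>
        homeomorphism W W' \<Phi> \<Psi> \<and> smooth_on W \<Phi> \<and> smooth_on W' \<Psi> \<and>
        subspace S \<and> dim S = k \<and> \<Phi> ` (U \<inter> W) = W' \<inter> (S :: 'a set))"

(* An (injectively) immersed submanifold is a subset together with its own manifold topology,
   which may be finer than the subspace topology (as for a dense geodesic of a flat torus).
   It is represented by that topology X, the underlying set being topspace X.  An immersion is
   locally an embedding, and the smooth structure of an immersed submanifold is determined by
   its topology, so it is enough to ask that X is locally an embedded submanifold.
   The Hausdorff property is automatic, X being finer than the subspace topology. *)
definition immersed_submanifold :: "nat \<Rightarrow> 'a::euclidean_space topology \<Rightarrow> bool" where
  "immersed_submanifold k X \<longleftrightarrow>
     second_countable X \<and>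
     (\<forall>p\<in>topspace X. \<exists>U. openin X U \<and> p \<in> U \<and>
          subtopology X U = top_of_set U \<and> embedded_submanifold k U)"

(* Velocities at p of smooth curves in the submanifold. *)
definition tangent_space :: "'a::euclidean_space topology \<Rightarrow> 'a \<Rightarrow> 'a set" where
  "tangent_space X p =
     {v. \<exists>\<epsilon>>0. \<exists>c. smooth_on {-\<epsilon><..<\<epsilon>::real} c \<and>
          continuous_map (top_of_set {-\<epsilon><..<\<epsilon>}) X c \<and>
          c 0 = p \<and> (c has_vector_derivative v) (at 0)}"


section \<open>Geodesics and geodesic submanifolds\<close>

(* Geodesics of an embedded submanifold M with the Riemannian metric induced by the
   surrounding Euclidean space: the Levi-Civita connection of M is the tangential part of the
   Euclidean derivative, so the equation says that the acceleration is normal to M. *)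
definition geodesic_on :: "'a::euclidean_space set \<Rightarrow> real set \<Rightarrow> (real \<Rightarrow> 'a) \<Rightarrow> bool" where
  "geodesic_on M I c \<longleftrightarrow>
     smooth_on I c \<and> c ` I \<subseteq> M \<and>
     (\<forall>t\<in>I. \<forall>w\<in>tangent_space (top_of_set M) (c t).
        vector_derivative (\<lambda>s. vector_derivative c (at s)) (at t) \<bullet> w = 0)"

(* A curve lies in the immersed submanifold X if it is a continuous curve in X;
   for an embedded submanifold this just says that its image is contained in the set.
   The geodesic of M with given initial point and velocity is unique. *)
definition geodesic_submanifold :: "'a::euclidean_space set \<Rightarrow> nat \<Rightarrow> 'a topology \<Rightarrow> bool" where
  "geodesic_submanifold M k X \<longleftrightarrow>
     immersed_submanifold k X \<and> topspace X \<subseteq> M \<and>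
     (\<forall>p\<in>topspace X. \<forall>v\<in>tangent_space X p.
        \<exists>\<epsilon>>0. \<exists>c. geodesic_on M {-\<epsilon><..<\<epsilon>} c \<and>
           c 0 = p \<and> (c has_vector_derivative v) (at 0) \<and>
           continuous_map (top_of_set {-\<epsilon><..<\<epsilon>}) X c)"

definition geodesically_complete :: "'a::euclidean_space set \<Rightarrow> 'a topology \<Rightarrow> bool" where
  "geodesically_complete M X \<longleftrightarrow>
     (\<forall>p\<in>topspace X. \<forall>v\<in>tangent_space X p.
        \<exists>c. geodesic_on M UNIV c \<and>
           c 0 = p \<and> (c has_vector_derivative v) (at 0) \<and>
           continuous_map euclideanreal X c)"

definition connected_geodesic_submanifold :: "'a::euclidean_space set \<Rightarrow> nat \<Rightarrow> 'a set \<Rightarrow> bool" where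
  "connected_geodesic_submanifold M k N \<longleftrightarrow>
     (\<exists>X. topspace X = N \<and> N \<noteq> {} \<and> connected_space X \<and> geodesic_submanifold M k X)"

definition complete_connected_geodesic_submanifold ::
    "'a::euclidean_space set \<Rightarrow> nat \<Rightarrow> 'a set \<Rightarrow> bool" where
  "complete_connected_geodesic_submanifold M k N \<longleftrightarrow>
     (\<exists>X. topspace X = N \<and> N \<noteq> {} \<and> connected_space X \<and> geodesic_submanifold M k X \<and>
          geodesically_complete M X)"


section \<open>The product of two spheres\<close>

abbreviation S1 :: "(real ^ 2) set" where "S1 \<equiv> sphere 0 1"

abbreviation S2 :: "(real ^ 3) set" where "S2 \<equiv> sphere 0 1"

(* The inner product of real^3 \<times> real^3 is the sum of those of the factors, so the induced
   metric on this set is the product of the two round metrics. *)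
abbreviation S2xS2 :: "((real ^ 3) \<times> (real ^ 3)) set" where "S2xS2 \<equiv> S2 \<times> S2"

definition o3 :: "(real ^ 3 ^ 3) set" where
  "o3 = {r. transpose r = - r}"

definition O3 :: "(real ^ 3 ^ 3) set" where
  "O3 = {R. orthogonal_matrix R}"

(* The powers are those of the matrix product; the operation (^) on real^3^3 is componentwise. *)
definition mexp :: "real ^ 'n ^ 'n \<Rightarrow> real ^ 'n ^ 'n" where
  "mexp A = (\<Sum>n. (1 / fact n) *\<^sub>R ((\<lambda>B. A ** B) ^^ n) (mat 1))"

(* The orbit of x under the rotations mexp (t *\<^sub>R r) is a circle whose acceleration at x is
   r *v (r *v x).  It is normal to the sphere iff the orbit is a geodesic: a great circle
   (r \<noteq> 0 with axis orthogonal to x), or the constant curve at x (r *v x = 0).  Otherwise the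
   orbit is a smaller circle, which is not a geodesic. *)
definition geodesic_generator :: "real ^ 3 ^ 3 \<Rightarrow> real ^ 3 \<Rightarrow> bool" where
  "geodesic_generator r x \<longleftrightarrow> r \<in> o3 \<and> r *v (r *v x) \<in> span {x}"

end

theory Submission
  imports Defs "HOL-Real_Asymp.Real_Asymp"
begin

text \<open>
  The geodesics of the product are explicit: with \<open>gexp x v = cos \<bar>v\<bar> x + (sin \<bar>v\<bar> / \<bar>v\<bar>) v\<close> and
  its pairing \<open>pexp\<close>, every geodesic starting at \<open>p\<close> with velocity \<open>v\<close> is \<open>t \<mapsto> pexp p (t v)\<close>
  (\<open>geodesic_on_eq_pexp\<close>).  The orbits of the one-parameter groups in the theorem are such curves, or
  products of two of them (\<open>geodesic_generator_orbit\<close>).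

  Let \<open>X\<close> be a geodesic submanifold, \<open>p\<close> one of its points and \<open>V\<close> its tangent space at \<open>p\<close>.  The
  geodesics of \<open>X\<close> that start near \<open>p\<close> exist for a time independent of their direction
  (\<open>uniform_radius\<close>), so near \<open>p\<close> the submanifold is the image under \<open>pexp p\<close> of a ball in \<open>V\<close>
  (\<open>local_exp_image\<close>), and the differential of \<open>pexp\<close> carries tangent spaces to tangent spaces
  (\<open>tangent_transport\<close>).  The reflection of both spheres in a point of \<open>X\<close> reverses geodesics, hence
  it also carries tangent spaces to tangent spaces; comparing it with the differential of \<open>pexp\<close> to
  second order shows that \<open>V\<close> is invariant under the curvature (\<open>tangent_space_jacobi\<close>), that is,
  \<open>(\<bar>v\<^sub>1\<bar>\<^sup>2 w\<^sub>1 - (v\<^sub>1 \<bullet> w\<^sub>1) v\<^sub>1, \<bar>v\<^sub>2\<bar>\<^sup>2 w\<^sub>2 - (v\<^sub>2 \<bullet> w\<^sub>2) v\<^sub>2)\<close> is in \<open>V\<close> for all \<open>v\<close> and \<open>w\<close> in \<open>V\<close>.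

  This condition is linear algebra.  If \<open>V\<close> contains a nonzero vector \<open>(u, 0)\<close> and its first
  components are not all multiples of \<open>u\<close>, it contains the tangent space of the first sphere; a plane
  that contains no nonzero vector of either factor is the graph of an isometry.  This leaves the short list \<open>geodesic_tangent\<close>.  For
  each \<open>V\<close> in it, the full image \<open>pexp p ` V\<close> is one of the sets in the theorem, and it is the same for
  all base points in it (\<open>geodesic_tangent_shift\<close>).  So the image of the tangent space is a locally
  constant function on \<open>X\<close>; if \<open>X\<close> is connected it lies in one of these sets, and if it is also
  complete it is all of it.

  Conversely, spheres, great circles and points are embedded, with an inversion of the Euclidean space
  as a slice chart, and so are products and graphs.  A single geodesic can be dense in a torus; it is
  immersed with the quotient topology of the real line.
\<close>

section \<open>Calculus of smooth maps\<close>

lemma Ck_on_cong: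
  fixes f g :: "'a::real_normed_vector \<Rightarrow> 'b::real_normed_vector"
  assumes "open W" "\<And>x. x \<in> W \<Longrightarrow> f x = g x"
  shows "Ck_on n W f \<longleftrightarrow> Ck_on n W g"
  using assms(2)
proof (induction n arbitrary: f g)
  case 0
  then show ?case by (simp cong: continuous_on_cong_simp)
next
  case (Suc n)
  have *: "Ck_on (Suc n) W g" if fg: "\<And>x. x \<in> W \<Longrightarrow> f x = g x" and f: "Ck_on (Suc n) W f"
    for f g :: "'a \<Rightarrow> 'b"
  proof -
    have diff: "\<And>x. x \<in> W \<Longrightarrow> f differentiable (at x)"
      using f by simp
    have "g differentiable (at x)" if x: "x \<in> W" for x
    proof -
      obtain D where "(f has_derivative D) (at x)"
        using diff[OF x] by (auto simp: differentiable_def)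
      then have "(g has_derivative D) (at x)"
        by (rule has_derivative_transform_within_open[OF _ assms(1) x]) (rule fg)
      then show ?thesis by (auto simp: differentiable_def)
    qed
    moreover have eq: "frechet_derivative f (at x) = frechet_derivative g (at x)" if "x \<in> W" for x
      using frechet_derivative_transform_within_open[OF diff[OF that] assms(1) that fg] by simp
    have "Ck_on n W (\<lambda>x. frechet_derivative f (at x) v)
        \<longleftrightarrow> Ck_on n W (\<lambda>x. frechet_derivative g (at x) v)" for v
      by (rule Suc.IH) (simp add: eq)
    ultimately show ?thesis using f by simp
  qed
  show ?case
    by (rule iffI) (erule *[rotated], simp add: Suc.prems)+
qed

lemma Ck_on_subset: "Ck_on n W f \<Longrightarrow> V \<subseteq> W \<Longrightarrow> Ck_on n V f"
proof (induction n arbitrary: f)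
  case 0
  then show ?case by (auto intro: continuous_on_subset)
next
  case (Suc n)
  then show ?case by (simp add: subset_iff)
qed

lemma Ck_on_SucI:
  assumes "open W" "\<And>x. x \<in> W \<Longrightarrow> (f has_derivative f' x) (at x)"
    and "\<And>v. Ck_on n W (\<lambda>x. f' x v)"
  shows "Ck_on (Suc n) W f"
proof -
  have "f' x = frechet_derivative f (at x)" if "x \<in> W" for x
    using frechet_derivative_at[OF assms(2)[OF that]] .
  then have "Ck_on n W (\<lambda>x. frechet_derivative f (at x) v)" for v
    using assms(3)[of v] Ck_on_cong[OF assms(1), of "\<lambda>x. f' x v"] by simp
  then show ?thesis using assms(2) by (auto simp: differentiable_def)
qed

lemma Ck_on_SucD: "Ck_on (Suc n) W f \<Longrightarrow> Ck_on n W f"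
proof (induction n arbitrary: f)
  case 0
  then show ?case
    by (simp add: differentiable_imp_continuous_on differentiable_on_def differentiable_at_withinI)
next
  case (Suc n)
  have "\<forall>x\<in>W. f differentiable (at x)"
    and "\<forall>v. Ck_on (Suc n) W (\<lambda>x. frechet_derivative f (at x) v)"
    using iffD1[OF Ck_on.simps(2) Suc.prems] by blast+
  then show ?case using Suc.IH by (intro iffD2[OF Ck_on.simps(2)]) auto
qed

lemma Ck_on_has_derivative:
  assumes "Ck_on (Suc n) W f" "x \<in> W"
  shows "(f has_derivative frechet_derivative f (at x)) (at x)"
  using assms frechet_derivative_works by auto

lemma Ck_on_const: "open W \<Longrightarrow> Ck_on n W (\<lambda>_. c)"
proof (induction n arbitrary: c)
  case (Suc n)
  show ?case by (rule Ck_on_SucI[OF Suc.prems, where f' = "\<lambda>_ _. 0"]) (auto intro: Suc)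
qed simp

lemma Ck_on_linear:
  assumes "bounded_linear L" "open W"
  shows "Ck_on n W L"
proof (cases n)
  case 0
  then show ?thesis using assms by (simp add: linear_continuous_on)
next
  case (Suc m)
  show ?thesis unfolding Suc
    by (rule Ck_on_SucI[OF assms(2), where f' = "\<lambda>_. L"])
      (auto intro: bounded_linear_imp_has_derivative[OF assms(1)] Ck_on_const[OF assms(2)])
qed

lemma Ck_on_linear_compose:
  assumes L: "bounded_linear L" and W: "open W"
  shows "Ck_on n W f \<Longrightarrow> Ck_on n W (\<lambda>x. L (f x))"
proof (induction n arbitrary: f)
  case 0
  then show ?case by (simp add: bounded_linear.continuous_on[OF L])
next
  case (Suc n)
  show ?case
  proof (rule Ck_on_SucI[OF W, where f' = "\<lambda>x v. L (frechet_derivative f (at x) v)"])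
    fix x assume "x \<in> W"
    then show "((\<lambda>x. L (f x)) has_derivative (\<lambda>v. L (frechet_derivative f (at x) v))) (at x)"
      by (intro bounded_linear.has_derivative[OF L] Ck_on_has_derivative[OF Suc.prems])
  qed (use Suc in simp)
qed

lemma Ck_on_add:
  assumes W: "open W"
  shows "Ck_on n W f \<Longrightarrow> Ck_on n W g \<Longrightarrow> Ck_on n W (\<lambda>x. f x + g x)"
proof (induction n arbitrary: f g)
  case 0
  then show ?case by (simp add: continuous_on_add)
next
  case (Suc n)
  show ?case
    by (rule Ck_on_SucI[OF W, where f' = "\<lambda>x v. frechet_derivative f (at x) v + frechet_derivative g (at x) v"])
      (use Suc in \<open>auto intro!: has_derivative_add Ck_on_has_derivative[OF Suc.prems(1)]
         Ck_on_has_derivative[OF Suc.prems(2)]\<close>)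
qed

lemma Ck_on_sum:
  assumes "open W" "\<And>i. i \<in> I \<Longrightarrow> Ck_on n W (f i)"
  shows "Ck_on n W (\<lambda>x. \<Sum>i\<in>I. f i x)"
  using assms(2)
proof (induction I rule: infinite_finite_induct)
  case (insert i I)
  then show ?case by (simp add: Ck_on_add assms(1))
qed (auto simp: Ck_on_const assms(1))

lemma Ck_on_bilinear:
  assumes B: "bounded_bilinear B" and W: "open W"
  shows "Ck_on n W f \<Longrightarrow> Ck_on n W g \<Longrightarrow> Ck_on n W (\<lambda>x. B (f x) (g x))"
proof (induction n arbitrary: f g)
  case 0
  then show ?case by (simp add: bounded_bilinear.continuous_on[OF B])
next
  case (Suc n)
  show ?case
  proof (rule Ck_on_SucI[OF W, where f' = "\<lambda>x v. B (f x) (frechet_derivative g (at x) v)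
       + B (frechet_derivative f (at x) v) (g x)"])
    fix x assume x: "x \<in> W"
    show "((\<lambda>x. B (f x) (g x)) has_derivative (\<lambda>v. B (f x) (frechet_derivative g (at x) v)
       + B (frechet_derivative f (at x) v) (g x))) (at x)"
      by (rule bounded_bilinear.FDERIV[OF B Ck_on_has_derivative[OF Suc.prems(1) x]
            Ck_on_has_derivative[OF Suc.prems(2) x]])
  next
    fix v
    have "Ck_on n W (\<lambda>x. frechet_derivative f (at x) v)" "Ck_on n W (\<lambda>x. frechet_derivative g (at x) v)"
      using Suc.prems by simp_all
    then show "Ck_on n W (\<lambda>x. B (f x) (frechet_derivative g (at x) v)
       + B (frechet_derivative f (at x) v) (g x))"
      by (intro Ck_on_add[OF W] Suc.IH Ck_on_SucD[OF Suc.prems(1)] Ck_on_SucD[OF Suc.prems(2)])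
  qed
qed

text \<open>The derivative \<open>Dg (f x) (Df x v)\<close> is expanded in the basis of the intermediate space,
  so that it becomes a sum of products of maps to which the induction hypothesis applies.\<close>

lemma Ck_on_compose:
  fixes f :: "'a::real_normed_vector \<Rightarrow> 'b::euclidean_space"
  assumes W: "open W" and V: "open V" and fWV: "\<And>x. x \<in> W \<Longrightarrow> f x \<in> V"
  shows "Ck_on n V g \<Longrightarrow> Ck_on n W f \<Longrightarrow> Ck_on n W (\<lambda>x. g (f x))"
proof (induction n arbitrary: g)
  case 0
  then show ?case using fWV by (auto intro: continuous_on_compose2)
next
  case (Suc n)
  let ?f' = "\<lambda>x. frechet_derivative f (at x)" and ?g' = "\<lambda>x. frechet_derivative g (at x)"
  have f': "(f has_derivative ?f' x) (at x)" if "x \<in> W" for x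
    using Ck_on_has_derivative[OF Suc.prems(2) that] .
  have g': "(g has_derivative ?g' (f x)) (at (f x))" if "x \<in> W" for x
    using Ck_on_has_derivative[OF Suc.prems(1) fWV[OF that]] .
  show ?case
  proof (rule Ck_on_SucI[OF W, where f' = "\<lambda>x v. \<Sum>b\<in>Basis. (?f' x v \<bullet> b) *\<^sub>R ?g' (f x) b"])
    fix x assume x: "x \<in> W"
    have lin: "linear (?g' (f x))"
      using g'[OF x] by (simp add: has_derivative_linear)
    have "(\<Sum>b\<in>Basis. (w \<bullet> b) *\<^sub>R ?g' (f x) b) = ?g' (f x) w" for w
    proof -
      have "?g' (f x) w = ?g' (f x) (\<Sum>b\<in>Basis. (w \<bullet> b) *\<^sub>R b)"
        by (simp add: euclidean_representation)
      then show ?thesis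
        by (simp add: linear_sum[OF lin] linear_scale[OF lin])
    qed
    then show "((\<lambda>x. g (f x)) has_derivative (\<lambda>v. \<Sum>b\<in>Basis. (?f' x v \<bullet> b) *\<^sub>R ?g' (f x) b)) (at x)"
      using has_derivative_compose[OF f'[OF x] g'[OF x]] by simp
  next
    fix v
    have f: "Ck_on n W (\<lambda>x. ?f' x v)" "Ck_on n W f"
      using Suc.prems(2) Ck_on_SucD[OF Suc.prems(2)] by auto
    have "Ck_on n W (\<lambda>x. ?g' (f x) b)" for b
      using Suc.prems(1) f(2) by (intro Suc.IH) auto
    moreover have "Ck_on n W (\<lambda>x. ?f' x v \<bullet> b)" for b
      by (rule Ck_on_linear_compose[OF bounded_linear_inner_left W f(1)])
    ultimately show "Ck_on n W (\<lambda>x. \<Sum>b\<in>Basis. (?f' x v \<bullet> b) *\<^sub>R ?g' (f x) b)"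
      by (intro Ck_on_sum[OF W] Ck_on_bilinear[OF bounded_bilinear_scaleR W])
  qed
qed

lemma Ck_on_SucI_real:
  fixes f :: "real \<Rightarrow> 'b::real_normed_vector"
  assumes "open W" "\<And>x. x \<in> W \<Longrightarrow> (f has_vector_derivative f' x) (at x)" "Ck_on n W f'"
  shows "Ck_on (Suc n) W f"
proof (rule Ck_on_SucI[OF assms(1), where f' = "\<lambda>x v. v *\<^sub>R f' x"])
  show "\<And>v. Ck_on n W (\<lambda>x. v *\<^sub>R f' x)"
    by (rule Ck_on_linear_compose[OF bounded_linear_scaleR_right assms(1,3)])
qed (use assms(2) in \<open>simp add: has_vector_derivative_def\<close>)

lemma smooth_on_subset: "smooth_on W f \<Longrightarrow> V \<subseteq> W \<Longrightarrow> smooth_on V f"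
  unfolding smooth_on_def by (intro allI) (drule spec, erule Ck_on_subset)

lemma smooth_on_cong:
  "open W \<Longrightarrow> (\<And>x. x \<in> W \<Longrightarrow> f x = g x) \<Longrightarrow> smooth_on W f \<longleftrightarrow> smooth_on W g"
  unfolding smooth_on_def using Ck_on_cong[of W f g] by simp

lemma smooth_on_const: "open W \<Longrightarrow> smooth_on W (\<lambda>_. c)"
  unfolding smooth_on_def by (simp add: Ck_on_const)

lemma smooth_on_linear: "bounded_linear L \<Longrightarrow> open W \<Longrightarrow> smooth_on W L"
  unfolding smooth_on_def by (simp add: Ck_on_linear)

lemma smooth_on_linear_compose:
  "bounded_linear L \<Longrightarrow> open W \<Longrightarrow> smooth_on W f \<Longrightarrow> smooth_on W (\<lambda>x. L (f x))"
  unfolding smooth_on_def by (simp add: Ck_on_linear_compose)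

lemma smooth_on_add:
  "open W \<Longrightarrow> smooth_on W f \<Longrightarrow> smooth_on W g \<Longrightarrow> smooth_on W (\<lambda>x. f x + g x)"
  unfolding smooth_on_def by (simp add: Ck_on_add)

lemma smooth_on_diff:
  "open W \<Longrightarrow> smooth_on W f \<Longrightarrow> smooth_on W g \<Longrightarrow> smooth_on W (\<lambda>x. f x - g x)"
  using smooth_on_add[of W f "\<lambda>x. - g x"]
    smooth_on_linear_compose[OF bounded_linear_minus[OF bounded_linear_ident], of W g] by simp

lemma smooth_on_scaleR:
  "open W \<Longrightarrow> smooth_on W f \<Longrightarrow> smooth_on W g \<Longrightarrow> smooth_on W (\<lambda>x. f x *\<^sub>R g x)"
  unfolding smooth_on_def by (simp add: Ck_on_bilinear[OF bounded_bilinear_scaleR])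

lemma smooth_on_inner:
  "open W \<Longrightarrow> smooth_on W f \<Longrightarrow> smooth_on W g \<Longrightarrow> smooth_on W (\<lambda>x. f x \<bullet> g x)"
  unfolding smooth_on_def by (simp add: Ck_on_bilinear[OF bounded_bilinear_inner])

lemma smooth_on_mult:
  fixes f g :: "_ \<Rightarrow> real"
  shows "open W \<Longrightarrow> smooth_on W f \<Longrightarrow> smooth_on W g \<Longrightarrow> smooth_on W (\<lambda>x. f x * g x)"
  unfolding smooth_on_def by (simp add: Ck_on_bilinear[OF bounded_bilinear_mult])

lemma smooth_on_Pair:
  assumes W: "open W" and "smooth_on W f" "smooth_on W g"
  shows "smooth_on W (\<lambda>x. (f x, g x))"
proof -
  have "bounded_linear (\<lambda>a. (a, 0))" "bounded_linear (\<lambda>b. (0, b))"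
    by (auto intro!: bounded_linear_intros)
  then have "smooth_on W (\<lambda>x. (f x, 0) + (0, g x))"
    using assms by (intro smooth_on_add[OF W]) (auto intro: smooth_on_linear_compose)
  then show ?thesis by simp
qed

lemma smooth_on_compose:
  fixes f :: "'a::real_normed_vector \<Rightarrow> 'b::euclidean_space"
  shows "open W \<Longrightarrow> open V \<Longrightarrow> (\<And>x. x \<in> W \<Longrightarrow> f x \<in> V) \<Longrightarrow> smooth_on V g \<Longrightarrow> smooth_on W f
    \<Longrightarrow> smooth_on W (\<lambda>x. g (f x))"
  unfolding smooth_on_def by (rule allI, rule Ck_on_compose[of W V f]) auto

lemma smooth_on_ident: "open W \<Longrightarrow> smooth_on W (\<lambda>x. x)"
  using smooth_on_linear[OF bounded_linear_ident] .

text \<open>The derivative of \<open>inverse\<close> is a product of copies of \<open>inverse\<close>, so smoothness follows by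
  induction on the order; likewise for cosine and sine together below.\<close>

lemma smooth_on_inverse: "smooth_on (- {0}) (inverse :: real \<Rightarrow> real)"
proof -
  have "Ck_on n (- {0}) (inverse :: real \<Rightarrow> real)" for n
  proof (induction n)
    case 0
    then show ?case by (auto intro!: continuous_intros)
  next
    case (Suc n)
    show ?case
    proof (rule Ck_on_SucI_real)
      fix x :: real assume "x \<in> - {0}"
      then show "(inverse has_vector_derivative - (inverse x * inverse x)) (at x)"
        using DERIV_inverse[of x] by (simp add: has_real_derivative_iff_has_vector_derivative power2_eq_square)
    next
      show "Ck_on n (- {0}) (\<lambda>x::real. - (inverse x * inverse x))"
        by (intro Ck_on_linear_compose[OF bounded_linear_minus[OF bounded_linear_ident]]
            Ck_on_bilinear[OF bounded_bilinear_mult] Suc) auto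
    qed auto
  qed
  then show ?thesis by (simp add: smooth_on_def)
qed

lemma smooth_on_inverse_compose:
  fixes f :: "'a::real_normed_vector \<Rightarrow> real"
  assumes "open W" "smooth_on W f" "\<And>x. x \<in> W \<Longrightarrow> f x \<noteq> 0"
  shows "smooth_on W (\<lambda>x. inverse (f x))"
  using assms by (intro smooth_on_compose[OF _ _ _ smooth_on_inverse]) auto

lemma smooth_on_arctan: "smooth_on UNIV (arctan :: real \<Rightarrow> real)"
proof -
  have "smooth_on UNIV (\<lambda>x::real. inverse (1 + x * x))"
    by (intro smooth_on_inverse_compose smooth_on_add smooth_on_mult smooth_on_const smooth_on_ident)
      (auto simp: add_nonneg_eq_0_iff)
  then have *: "Ck_on n UNIV (\<lambda>x::real. inverse (1 + x * x))" for n
    by (simp add: smooth_on_def)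
  have "Ck_on (Suc n) UNIV (arctan :: real \<Rightarrow> real)" for n
    using DERIV_arctan
    by (intro Ck_on_SucI_real[OF _ _ *])
      (auto simp: has_real_derivative_iff_has_vector_derivative power2_eq_square)
  then show ?thesis by (simp add: smooth_on_def Ck_on_SucD del: Ck_on.simps)
qed

lemma smooth_on_cos_sin: "smooth_on UNIV (cos :: real \<Rightarrow> real)" "smooth_on UNIV (sin :: real \<Rightarrow> real)"
proof -
  have "Ck_on n UNIV (cos :: real \<Rightarrow> real) \<and> Ck_on n UNIV (sin :: real \<Rightarrow> real)" for n
  proof (induction n)
    case 0
    then show ?case by (auto intro!: continuous_intros)
  next
    case (Suc n)
    have "Ck_on n UNIV (\<lambda>x::real. - sin x)"
      using Suc by (intro Ck_on_linear_compose[OF bounded_linear_minus[OF bounded_linear_ident]]) auto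
    then show ?case
      using Suc Ck_on_SucI_real[of UNIV cos "\<lambda>x. - sin x" n] Ck_on_SucI_real[of UNIV sin cos n]
      by (simp add: has_real_derivative_iff_has_vector_derivative[symmetric] DERIV_cos DERIV_sin
          del: Ck_on.simps)
  qed
  then show "smooth_on UNIV (cos :: real \<Rightarrow> real)" "smooth_on UNIV (sin :: real \<Rightarrow> real)"
    by (auto simp: smooth_on_def)
qed

lemma smooth_on_continuous: "smooth_on W f \<Longrightarrow> continuous_on W f"
  unfolding smooth_on_def by (drule spec[of _ 0]) simp

lemma smooth_on_has_derivative:
  "smooth_on W f \<Longrightarrow> x \<in> W \<Longrightarrow> (f has_derivative frechet_derivative f (at x)) (at x)"
  unfolding smooth_on_def by (rule Ck_on_has_derivative[of 0]) (erule spec)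

lemma smooth_on_frechet_derivative:
  "smooth_on W f \<Longrightarrow> smooth_on W (\<lambda>x. frechet_derivative f (at x) v)"
  unfolding smooth_on_def by (intro allI) (drule_tac x = "Suc n" in spec, simp)

lemma smooth_on_vector_derivative:
  fixes c :: "real \<Rightarrow> 'b::real_normed_vector"
  assumes "smooth_on W c" "open W"
  shows "t \<in> W \<Longrightarrow> (c has_vector_derivative vector_derivative c (at t)) (at t)"
    and "smooth_on W (\<lambda>s. vector_derivative c (at s))"
proof -
  have *: "(c has_vector_derivative frechet_derivative c (at t) 1) (at t)" if "t \<in> W" for t
  proof -
    have d: "(c has_derivative frechet_derivative c (at t)) (at t)"
      by (rule smooth_on_has_derivative[OF assms(1) that])
    have "frechet_derivative c (at t) = (\<lambda>x. x *\<^sub>R frechet_derivative c (at t) 1)"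
      using has_derivative_linear[OF d] by (metis linear_scale mult.right_neutral real_scaleR_def)
    then show ?thesis using d unfolding has_vector_derivative_def by simp
  qed
  have eq: "vector_derivative c (at t) = frechet_derivative c (at t) 1" if "t \<in> W" for t
    by (rule vector_derivative_at[OF *[OF that]])
  show "t \<in> W \<Longrightarrow> (c has_vector_derivative vector_derivative c (at t)) (at t)"
    using * eq by simp
  show "smooth_on W (\<lambda>s. vector_derivative c (at s))"
    using smooth_on_frechet_derivative[OF assms(1), of 1] by (subst smooth_on_cong[OF assms(2) eq])
qed

section \<open>Geodesics of the sphere\<close>

text \<open>The exponential map of the unit sphere at \<open>x\<close>, and its differential.  Division by zero makes
  \<open>gexp x 0 = x\<close>.  In \<open>dgexp x v w\<close> the part of \<open>w\<close> along \<open>v\<close> is carried along the great circle,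
  the part orthogonal to \<open>v\<close> is multiplied by \<open>sin \<bar>v\<bar> / \<bar>v\<bar>\<close>.\<close>

definition gexp :: "'a::real_inner \<Rightarrow> 'a \<Rightarrow> 'a" where
  "gexp x v = cos (norm v) *\<^sub>R x + (sin (norm v) / norm v) *\<^sub>R v"

definition dgexp :: "'a::real_inner \<Rightarrow> 'a \<Rightarrow> 'a \<Rightarrow> 'a" where
  "dgexp x v w = (if v = 0 then w else
     (v \<bullet> w / norm v) *\<^sub>R ((cos (norm v) / norm v) *\<^sub>R v - sin (norm v) *\<^sub>R x)
     + (sin (norm v) / norm v) *\<^sub>R (w - (v \<bullet> w / (norm v)\<^sup>2) *\<^sub>R v))"

definition gvel :: "'a::real_inner \<Rightarrow> 'a \<Rightarrow> real \<Rightarrow> 'a" where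
  "gvel x v t = cos (norm v * t) *\<^sub>R v - (norm v * sin (norm v * t)) *\<^sub>R x"

lemma gexp_0 [simp]: "gexp x 0 = x"
  by (simp add: gexp_def)

lemma gvel_0 [simp]: "gvel x v 0 = v"
  by (simp add: gvel_def)

lemma gexp_line: "gexp x (t *\<^sub>R v) = cos (norm v * t) *\<^sub>R x + (sin (norm v * t) / norm v) *\<^sub>R v"
  by (cases "t > 0"; cases "t = 0"; cases "v = 0") (auto simp: gexp_def abs_if mult.commute)

lemma gexp_line_deriv:
  "((\<lambda>t. gexp x (t *\<^sub>R v)) has_vector_derivative gvel x v t) (at t)"
proof (cases "v = 0")
  case True
  then show ?thesis by (simp add: gvel_def)
next
  case False
  then show ?thesis
    unfolding gexp_line gvel_def
    by (auto intro!: derivative_eq_intros simp: has_vector_derivative_def fun_eq_iff algebra_simps)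
qed

lemma gvel_deriv:
  "(gvel x v has_vector_derivative - (norm v)\<^sup>2 *\<^sub>R gexp x (t *\<^sub>R v)) (at t)"
proof (cases "v = 0")
  case True
  then show ?thesis by (simp add: gvel_def[abs_def])
next
  case False
  then show ?thesis
    unfolding gexp_line gvel_def[abs_def]
    by (auto intro!: derivative_eq_intros
        simp: has_vector_derivative_def fun_eq_iff algebra_simps power2_eq_square)
qed

lemma gexp_smooth: "smooth_on UNIV (\<lambda>t. gexp x (t *\<^sub>R v))"
proof -
  have lin: "smooth_on UNIV (\<lambda>t. norm v * t)"
    using smooth_on_linear[OF bounded_linear_mult_right open_UNIV] .
  have "smooth_on UNIV (\<lambda>t. cos (norm v * t))" "smooth_on UNIV (\<lambda>t. sin (norm v * t))"
    using smooth_on_compose[OF _ _ _ smooth_on_cos_sin(1) lin]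
        smooth_on_compose[OF _ _ _ smooth_on_cos_sin(2) lin] by auto
  then have "smooth_on UNIV (\<lambda>t. cos (norm v * t) *\<^sub>R x + (sin (norm v * t) * inverse (norm v)) *\<^sub>R v)"
    by (intro smooth_on_add smooth_on_scaleR smooth_on_mult smooth_on_const open_UNIV)
  then show ?thesis by (simp add: gexp_line divide_inverse)
qed

context
  fixes x v :: "'a::real_inner"
  assumes x: "norm x = 1" and xv: "x \<bullet> v = 0"
begin

private lemma xx: "x \<bullet> x = 1" and vx: "v \<bullet> x = 0" and vv: "v \<bullet> v = norm v * norm v"
  using x xv by (auto simp: inner_commute power2_norm_eq_inner[symmetric]) (simp add: power2_eq_square)

lemma norm_gexp: "norm (gexp x v) = 1"
proof (cases "v = 0")
  case True
  then show ?thesis by (simp add: x)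
next
  case False
  have "gexp x v \<bullet> gexp x v = (cos (norm v))\<^sup>2 + (sin (norm v))\<^sup>2 * ((v \<bullet> v) / (norm v)\<^sup>2)"
    by (simp add: gexp_def inner_add_left inner_add_right xx xv vx power2_eq_square)
  also have "\<dots> = 1"
    using False by (simp add: power2_norm_eq_inner)
  finally show ?thesis by (simp add: norm_eq_1)
qed

lemma inner_gexp: "x \<bullet> gexp x v = cos (norm v)"
  by (simp add: gexp_def inner_add_right xx xv)

lemma norm_gvel: "norm (gvel x v t) = norm v"
proof -
  have "(norm (gvel x v t))\<^sup>2 = (cos (norm v * t))\<^sup>2 * (v \<bullet> v) + (norm v)\<^sup>2 * (sin (norm v * t))\<^sup>2"
    unfolding power2_norm_eq_inner[of "gvel x v t"]
    by (simp add: gvel_def inner_diff_left inner_diff_right xx xv vx power2_eq_square)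
  also have "\<dots> = (norm v)\<^sup>2 * ((cos (norm v * t))\<^sup>2 + (sin (norm v * t))\<^sup>2)"
    by (simp only: vv power2_eq_square ring_distribs mult_ac)
  also have "\<dots> = (norm v)\<^sup>2" by (simp only: sin_cos_squared_add2 mult_1_right)
  finally show ?thesis by simp
qed

lemma inner_gexp_gvel: "gexp x (t *\<^sub>R v) \<bullet> gvel x v t = 0"
  unfolding gexp_line gvel_def
  by (cases "v = 0") (simp_all add: inner_diff_left inner_diff_right inner_add_left inner_add_right
      xx xv vx vv algebra_simps)

lemma gexp_shift: "gexp (gexp x (t *\<^sub>R v)) (s *\<^sub>R gvel x v t) = gexp x ((t + s) *\<^sub>R v)"
proof (cases "v = 0")
  case False
  have "gexp (gexp x (t *\<^sub>R v)) (s *\<^sub>R gvel x v t)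
      = (cos (norm v * s) * cos (norm v * t) - sin (norm v * s) * sin (norm v * t)) *\<^sub>R x
       + ((cos (norm v * s) * sin (norm v * t) + sin (norm v * s) * cos (norm v * t)) / norm v) *\<^sub>R v"
    using False unfolding gexp_line[of _ s] norm_gvel
    by (simp add: gexp_line gvel_def algebra_simps add_divide_distrib)
  also have "\<dots> = cos (norm v * t + norm v * s) *\<^sub>R x + (sin (norm v * t + norm v * s) / norm v) *\<^sub>R v"
    by (simp add: cos_add sin_add algebra_simps)
  finally show ?thesis by (simp add: gexp_line ring_distribs)
qed (simp add: gvel_def)

end

lemma gexp_inj:
  assumes x: "norm x = 1" "x \<bullet> v = 0" "x \<bullet> w = 0" and "norm v < pi" "norm w < pi"
    and eq: "gexp x v = gexp x w"
  shows "v = w"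
proof -
  have c: "cos (norm v) = cos (norm w)"
    using eq inner_gexp[OF x(1,2)] inner_gexp[OF x(1,3)] by simp
  have n: "norm v = norm w"
    by (rule cos_inj_pi[OF _ _ _ _ c]) (use assms(4,5) in auto)
  show ?thesis
  proof (cases "v = 0")
    case True
    then show ?thesis using n by simp
  next
    case False
    then have "sin (norm v) / norm v \<noteq> 0"
      using sin_gt_zero[of "norm v"] assms(4) by auto
    then show ?thesis
      using eq n by (simp add: gexp_def)
  qed
qed

lemma gexp_continuous:
  fixes x :: "'a::real_inner"
  shows "continuous_on UNIV (gexp x)"
proof -
  have "isCont (gexp x) v" for v
  proof (cases "v = 0")
    case False
    then show ?thesis unfolding gexp_def by (intro continuous_intros) auto
  next
    case True
    have "((\<lambda>v::'a. (sin (norm v) / norm v) *\<^sub>R v) \<longlongrightarrow> 0) (at 0)"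
    proof (rule Lim_null_comparison)
      have "\<bar>sin (norm v) / norm v\<bar> \<le> 1" for v :: 'a
        using abs_sin_x_le_abs_x[of "norm v"] by (auto simp: divide_simps)
      then show "\<forall>\<^sub>F v in at 0. norm ((sin (norm v) / norm v) *\<^sub>R v) \<le> norm (v :: 'a)"
        by (intro always_eventually allI) (simp only: norm_scaleR mult_left_le_one_le norm_ge_zero abs_ge_zero)
      show "((\<lambda>v :: 'a. norm v) \<longlongrightarrow> 0) (at 0)"
        using tendsto_norm_zero[OF tendsto_ident_at[of 0 UNIV]] by simp
    qed
    moreover have "((\<lambda>v::'a. cos (norm v) *\<^sub>R x) \<longlongrightarrow> cos (norm (0::'a)) *\<^sub>R x) (at 0)"
      by (intro tendsto_intros)
    ultimately have "((\<lambda>v. gexp x v) \<longlongrightarrow> cos (norm (0::'a)) *\<^sub>R x + 0) (at 0)"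
      unfolding gexp_def by (intro tendsto_add)
    then show ?thesis unfolding True by (simp add: isCont_def)
  qed
  then show ?thesis by (simp add: continuous_at_imp_continuous_on)
qed

lemma dgexp_deriv:
  "((\<lambda>s. gexp x (v + s *\<^sub>R w)) has_vector_derivative dgexp x v w) (at 0)"
proof (cases "v = 0")
  case True
  then show ?thesis using gexp_line_deriv[of x w 0] by (simp add: dgexp_def)
next
  case False
  have n: "((\<lambda>s. norm (v + s *\<^sub>R w)) has_real_derivative v \<bullet> w / norm v) (at 0)"
  proof -
    have "((\<lambda>s. v + s *\<^sub>R w) has_derivative (\<lambda>s. s *\<^sub>R w)) (at 0)"
      by (auto intro!: derivative_eq_intros)
    moreover have "(norm has_derivative (\<lambda>h. h \<bullet> sgn v)) (at (v + 0 *\<^sub>R w))"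
      using has_derivative_norm[of v] False by simp
    ultimately have "((\<lambda>s. norm (v + s *\<^sub>R w)) has_derivative (\<lambda>s. (s *\<^sub>R w) \<bullet> sgn v)) (at 0)"
      by (rule has_derivative_compose)
    then show ?thesis
      unfolding has_field_derivative_def
      by (rule has_derivative_eq_rhs)
        (auto simp: sgn_div_norm divide_inverse inner_commute algebra_simps)
  qed
  have ne: "norm (v + 0 *\<^sub>R w) \<noteq> 0" using False by simp
  have c: "((\<lambda>s. cos (norm (v + s *\<^sub>R w))) has_real_derivative - sin (norm v) * (v \<bullet> w / norm v)) (at 0)"
    using DERIV_chain2[OF DERIV_cos n] by simp
  have s: "((\<lambda>s. sin (norm (v + s *\<^sub>R w)) / norm (v + s *\<^sub>R w)) has_real_derivative
      (cos (norm v) * (v \<bullet> w / norm v) * norm v - sin (norm v) * (v \<bullet> w / norm v)) / (norm v * norm v)) (at 0)"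
    using DERIV_divide[OF DERIV_chain2[OF DERIV_sin n] n ne] by simp
  have l: "((\<lambda>s. v + s *\<^sub>R w) has_vector_derivative w) (at 0)"
    by (auto intro!: derivative_eq_intros)
  have "((\<lambda>s. gexp x (v + s *\<^sub>R w)) has_vector_derivative
      (- sin (norm v) * (v \<bullet> w / norm v)) *\<^sub>R x
      + ((sin (norm v) / norm v) *\<^sub>R w
       + ((cos (norm v) * (v \<bullet> w / norm v) * norm v - sin (norm v) * (v \<bullet> w / norm v)) / (norm v * norm v)) *\<^sub>R v)) (at 0)"
    unfolding gexp_def
    using has_vector_derivative_add[OF
        has_vector_derivative_scaleR[OF c has_vector_derivative_const[of x]]
        has_vector_derivative_scaleR[OF s l]] by simp
  moreover have "(- sin (norm v) * (v \<bullet> w / norm v)) *\<^sub>R x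
      + ((sin (norm v) / norm v) *\<^sub>R w
       + ((cos (norm v) * (v \<bullet> w / norm v) * norm v - sin (norm v) * (v \<bullet> w / norm v)) / (norm v * norm v)) *\<^sub>R v)
      = dgexp x v w"
    using False
    by (simp add: dgexp_def algebra_simps diff_divide_distrib power2_eq_square)
  ultimately show ?thesis by simp
qed

lemma dgexp_linear: "linear (dgexp x v)"
proof (cases "v = 0")
  case False
  show ?thesis
    by (rule linearI)
      (use False in \<open>simp_all add: dgexp_def inner_add_right add_divide_distrib algebra_simps\<close>)
qed (simp add: dgexp_def[abs_def] linear_id[unfolded id_def])

lemma gvel_eq_dgexp: "gvel x v t = dgexp x (t *\<^sub>R v) v"
proof -
  have "((\<lambda>s. gexp x (t *\<^sub>R v + s *\<^sub>R v)) has_vector_derivative gvel x v t) (at 0)"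
  proof -
    have "((\<lambda>s. t + s) has_vector_derivative 1) (at 0)"
      by (auto intro!: derivative_eq_intros)
    from vector_diff_chain_at[OF this, of "\<lambda>t. gexp x (t *\<^sub>R v)" "gvel x v t"] gexp_line_deriv[of x v t]
    show ?thesis by (simp add: o_def scaleR_left_distrib)
  qed
  then show ?thesis
    using dgexp_deriv vector_derivative_unique_at by blast
qed

text \<open>The sine in both coefficients of \<open>dgexp\<close> vanishes first at \<open>pi\<close>, the distance to the antipode.\<close>

lemma dgexp_eq_0:
  assumes x: "norm x = 1" "x \<bullet> v = 0" "x \<bullet> w = 0" and "norm v < pi" and z: "dgexp x v w = 0"
  shows "w = 0"
proof (cases "v = 0")
  case True
  then show ?thesis using z by (simp add: dgexp_def)
next
  case False
  have sn: "sin (norm v) \<noteq> 0"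
    using False assms(4) sin_gt_zero[of "norm v"] by auto
  have "x \<bullet> dgexp x v w = - (v \<bullet> w / norm v) * sin (norm v)"
    using False x
    by (simp add: dgexp_def inner_add_right inner_diff_right dot_square_norm)
  then have "v \<bullet> w = 0" using sn z False by simp
  then have "dgexp x v w = (sin (norm v) / norm v) *\<^sub>R w"
    using False by (simp add: dgexp_def)
  then show ?thesis using z sn False by simp
qed

section \<open>Geodesics of a product of spheres\<close>

abbreviation prod_sphere :: "('a::real_inner \<times> 'b::real_inner) set" where
  "prod_sphere \<equiv> sphere 0 1 \<times> sphere 0 1"

definition sphere_tangent :: "'a::real_inner \<times> 'b::real_inner \<Rightarrow> ('a \<times> 'b) set" where
  "sphere_tangent p = {v. fst p \<bullet> fst v = 0 \<and> snd p \<bullet> snd v = 0}"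

definition pexp :: "'a::real_inner \<times> 'b::real_inner \<Rightarrow> 'a \<times> 'b \<Rightarrow> 'a \<times> 'b" where
  "pexp p v = (gexp (fst p) (fst v), gexp (snd p) (snd v))"

definition dpexp :: "'a::real_inner \<times> 'b::real_inner \<Rightarrow> 'a \<times> 'b \<Rightarrow> 'a \<times> 'b \<Rightarrow> 'a \<times> 'b" where
  "dpexp p v w = (dgexp (fst p) (fst v) (fst w), dgexp (snd p) (snd v) (snd w))"

lemma subspace_sphere_tangent: "subspace (sphere_tangent p)"
  by (auto simp: subspace_def sphere_tangent_def inner_add_right)

lemma pexp_0 [simp]: "pexp p 0 = p"
  by (simp add: pexp_def)

lemma has_vector_derivative_Pair_iff:
  "(f has_vector_derivative v) (at t) \<longleftrightarrow>
    ((\<lambda>t. fst (f t)) has_vector_derivative fst v) (at t) \<and>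
    ((\<lambda>t. snd (f t)) has_vector_derivative snd v) (at t)"
  using bounded_linear.has_vector_derivative[OF bounded_linear_fst, of f v "at t"]
    bounded_linear.has_vector_derivative[OF bounded_linear_snd, of f v "at t"]
    has_vector_derivative_Pair[of "\<lambda>t. fst (f t)" "fst v" t UNIV "\<lambda>t. snd (f t)" "snd v"]
  by auto

lemma pexp_line_deriv:
  "((\<lambda>t. pexp p (t *\<^sub>R v)) has_vector_derivative dpexp p (t *\<^sub>R v) v) (at t)"
  by (simp add: has_vector_derivative_Pair_iff pexp_def dpexp_def gexp_line_deriv flip: gvel_eq_dgexp)

lemma dpexp_deriv:
  "((\<lambda>s. pexp p (v + s *\<^sub>R w)) has_vector_derivative dpexp p v w) (at 0)"
  by (simp add: has_vector_derivative_Pair_iff pexp_def dpexp_def dgexp_deriv)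

lemma dpexp_0 [simp]: "dpexp p 0 w = w"
  by (simp add: dpexp_def dgexp_def)

lemma dpexp_linear: "linear (dpexp p v)"
  using dgexp_linear[of "fst p" "fst v"] dgexp_linear[of "snd p" "snd v"]
  by (auto simp: dpexp_def linear_iff)

lemma pexp_smooth: "smooth_on UNIV (\<lambda>t. pexp p (t *\<^sub>R v))"
  using smooth_on_Pair[OF open_UNIV gexp_smooth[of "fst p" "fst v"] gexp_smooth[of "snd p" "snd v"]]
  by (simp add: pexp_def)

lemma pexp_in_prod_sphere:
  "p \<in> prod_sphere \<Longrightarrow> v \<in> sphere_tangent p \<Longrightarrow> pexp p v \<in> prod_sphere"
  by (auto simp: pexp_def sphere_tangent_def norm_gexp)

lemma pexp_shift:
  "p \<in> prod_sphere \<Longrightarrow> v \<in> sphere_tangent p \<Longrightarrow>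
    pexp (pexp p (t *\<^sub>R v)) (s *\<^sub>R dpexp p (t *\<^sub>R v) v) = pexp p ((t + s) *\<^sub>R v)"
  by (auto simp: pexp_def dpexp_def sphere_tangent_def gexp_shift simp flip: gvel_eq_dgexp)

lemma derivative_of_constant:
  fixes f :: "real \<Rightarrow> 'a::real_normed_vector"
  assumes "open I" "t \<in> I" "\<And>s. s \<in> I \<Longrightarrow> f s = k" "(f has_vector_derivative d) (at t)"
  shows "d = 0"
proof -
  have "((\<lambda>_. k) has_vector_derivative d) (at t)"
    by (rule has_vector_derivative_transform_within_open[OF assms(4,1,2)]) (simp add: assms(3))
  then show ?thesis
    using vector_derivative_unique_at[OF _ has_vector_derivative_const[of k "at t"]] by blast
qed

lemma sphere_curve_velocity:
  fixes c :: "real \<Rightarrow> 'a::real_inner"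
  assumes "open I" "t \<in> I" "\<And>s. s \<in> I \<Longrightarrow> norm (c s) = 1" "(c has_vector_derivative v) (at t)"
  shows "c t \<bullet> v = 0"
proof -
  have "((\<lambda>s. c s \<bullet> c s) has_vector_derivative c t \<bullet> v + v \<bullet> c t) (at t)"
    by (rule bounded_bilinear.has_vector_derivative[OF bounded_bilinear_inner assms(4,4)])
  then have "c t \<bullet> v + v \<bullet> c t = 0"
    by (rule derivative_of_constant[OF assms(1,2), rotated]) (simp add: assms(3) dot_square_norm)
  then show ?thesis by (simp add: inner_commute)
qed

lemma zero_derivative_constant_on_interval:
  fixes f :: "real \<Rightarrow> 'a::real_normed_vector"
  assumes "\<And>t. t \<in> {-\<epsilon><..<\<epsilon>} \<Longrightarrow> (f has_vector_derivative 0) (at t)" "t \<in> {-\<epsilon><..<\<epsilon>}"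
  shows "f t = f 0"
proof -
  have "\<exists>k. \<forall>t\<in>{-\<epsilon><..<\<epsilon>}. f t = k"
    using assms(1) by (intro has_derivative_zero_constant)
      (auto simp: has_vector_derivative_def intro: has_derivative_at_withinI)
  moreover have "0 \<in> {-\<epsilon><..<\<epsilon>}" using assms(2) by auto
  ultimately show ?thesis using assms(2) by metis
qed

text \<open>A curve on the sphere whose acceleration is normal satisfies \<open>c'' = - \<bar>c'\<bar>\<^sup>2 c\<close>, and its speed
  \<open>\<omega>\<close> is constant.  Variation of constants solves this equation: \<open>cos (\<omega> t) c - (sin (\<omega> t) / \<omega>) c'\<close> and
  \<open>\<omega> sin (\<omega> t) c + cos (\<omega> t) c'\<close> have derivative zero.\<close>

lemma sphere_geodesic_eq_gexp:
  fixes c :: "real \<Rightarrow> 'a::real_inner"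
  assumes c: "\<And>t. t \<in> {-\<epsilon><..<\<epsilon>} \<Longrightarrow> (c has_vector_derivative c' t) (at t)"
    and c': "\<And>t. t \<in> {-\<epsilon><..<\<epsilon>} \<Longrightarrow> (c' has_vector_derivative (c'' t \<bullet> c t) *\<^sub>R c t) (at t)"
    and n: "\<And>t. t \<in> {-\<epsilon><..<\<epsilon>} \<Longrightarrow> norm (c t) = 1"
    and t: "t \<in> {-\<epsilon><..<\<epsilon>}"
  shows "c t = gexp (c 0) (t *\<^sub>R c' 0)"
proof -
  let ?I = "{-\<epsilon><..<\<epsilon>}"
  have orth: "c t \<bullet> c' t = 0" if "t \<in> ?I" for t
    using sphere_curve_velocity[OF _ that n c[OF that]] by simp
  have cc: "c t \<bullet> c t = 1" if "t \<in> ?I" for t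
    using n[OF that] by (simp add: dot_square_norm)
  have acc: "c'' t \<bullet> c t = - (c' t \<bullet> c' t)" if t: "t \<in> ?I" for t
  proof -
    have "((\<lambda>s. c s \<bullet> c' s) has_vector_derivative c t \<bullet> ((c'' t \<bullet> c t) *\<^sub>R c t) + c' t \<bullet> c' t) (at t)"
      by (rule bounded_bilinear.has_vector_derivative[OF bounded_bilinear_inner c[OF t] c'[OF t]])
    then have "c t \<bullet> ((c'' t \<bullet> c t) *\<^sub>R c t) + c' t \<bullet> c' t = 0"
      by (rule derivative_of_constant[of ?I, rotated 3]) (use t orth in auto)
    then show ?thesis using cc[OF t] by simp
  qed
  define \<omega> where "\<omega> = norm (c' 0)"
  have speed: "c' t \<bullet> c' t = \<omega>\<^sup>2" if t: "t \<in> ?I" for t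
  proof -
    have "((\<lambda>s. c' s \<bullet> c' s) has_vector_derivative 0) (at t)" if t: "t \<in> ?I" for t
      using bounded_bilinear.has_vector_derivative[OF bounded_bilinear_inner c'[OF t] c'[OF t]]
        orth[OF t] by (simp add: inner_commute)
    from zero_derivative_constant_on_interval[OF this t] show ?thesis
      by (simp add: \<omega>_def power2_norm_eq_inner)
  qed
  have c'2: "(c' has_vector_derivative - \<omega>\<^sup>2 *\<^sub>R c t) (at t)" if "t \<in> ?I" for t
    using c'[OF that] acc[OF that] speed[OF that] by simp
  show ?thesis
  proof (cases "\<omega> = 0")
    case True
    then have "(c has_vector_derivative 0) (at t)" if "t \<in> ?I" for t
      using c[OF that] speed[OF that] by simp
    from zero_derivative_constant_on_interval[OF this t] show ?thesis
      using True by (simp add: \<omega>_def)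
  next
    case False
    define A where "A = (\<lambda>t. cos (\<omega> * t) *\<^sub>R c t - (sin (\<omega> * t) / \<omega>) *\<^sub>R c' t)"
    define B where "B = (\<lambda>t. (\<omega> * sin (\<omega> * t)) *\<^sub>R c t + cos (\<omega> * t) *\<^sub>R c' t)"
    have d: "((\<lambda>t. cos (\<omega> * t)) has_real_derivative - \<omega> * sin (\<omega> * t)) (at t)"
      "((\<lambda>t. sin (\<omega> * t) / \<omega>) has_real_derivative cos (\<omega> * t)) (at t)"
      "((\<lambda>t. \<omega> * sin (\<omega> * t)) has_real_derivative \<omega>\<^sup>2 * cos (\<omega> * t)) (at t)" for t
      using False by (auto intro!: derivative_eq_intros simp: power2_eq_square)
    have "(A has_vector_derivative 0) (at t)" if t: "t \<in> ?I" for t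
      using has_vector_derivative_diff[OF has_vector_derivative_scaleR[OF d(1) c[OF t]]
          has_vector_derivative_scaleR[OF d(2) c'2[OF t]]] False
      by (simp add: A_def power2_eq_square algebra_simps)
    from zero_derivative_constant_on_interval[OF this t] have A: "A t = c 0"
      by (simp add: A_def)
    have "(B has_vector_derivative 0) (at t)" if t: "t \<in> ?I" for t
      using has_vector_derivative_add[OF has_vector_derivative_scaleR[OF d(3) c[OF t]]
          has_vector_derivative_scaleR[OF d(1) c'2[OF t]]] False
      by (simp add: B_def power2_eq_square algebra_simps)
    from zero_derivative_constant_on_interval[OF this t] have B: "B t = c' 0"
      by (simp add: B_def)
    have "cos (\<omega> * t) *\<^sub>R A t + (sin (\<omega> * t) / \<omega>) *\<^sub>R B t
        = (cos (\<omega> * t))\<^sup>2 *\<^sub>R c t + (sin (\<omega> * t))\<^sup>2 *\<^sub>R c t"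
      using False by (simp add: A_def B_def algebra_simps power2_eq_square)
    also have "\<dots> = c t" by (simp only: scaleR_left_distrib[symmetric] sin_cos_squared_add2 scaleR_one)
    finally show ?thesis by (simp add: A B gexp_line \<omega>_def)
  qed
qed

lemma tangent_space_subset_sphere_tangent:
  fixes p :: "'a::euclidean_space \<times> 'b::euclidean_space"
  assumes X: "topspace X \<subseteq> prod_sphere" and v: "v \<in> tangent_space X p"
  shows "v \<in> sphere_tangent p"
proof -
  obtain \<epsilon> c where \<epsilon>: "\<epsilon> > 0" and cont: "continuous_map (top_of_set {-\<epsilon><..<\<epsilon>}) X c"
    and 0: "c 0 = p" and v: "(c has_vector_derivative v) (at 0)"
    using v unfolding tangent_space_def by blast
  have "c ` {-\<epsilon><..<\<epsilon>} \<subseteq> prod_sphere"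
    using continuous_map_image_subset_topspace[OF cont] X by simp
  then have n: "norm (fst (c s)) = 1 \<and> norm (snd (c s)) = 1" if "s \<in> {-\<epsilon><..<\<epsilon>}" for s
    using that by (auto simp: image_subset_iff mem_Times_iff)
  show ?thesis
    using sphere_curve_velocity[of "{-\<epsilon><..<\<epsilon>}" 0 "\<lambda>s. fst (c s)" "fst v"]
      sphere_curve_velocity[of "{-\<epsilon><..<\<epsilon>}" 0 "\<lambda>s. snd (c s)" "snd v"] n v \<epsilon> 0
    by (auto simp: sphere_tangent_def has_vector_derivative_Pair_iff)
qed

lemma tangent_space_prod_sphere:
  fixes p :: "'a::euclidean_space \<times> 'b::euclidean_space"
  assumes p: "p \<in> prod_sphere"
  shows "tangent_space (top_of_set prod_sphere) p = sphere_tangent p"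
proof (intro equalityI subsetI)
  fix v assume "v \<in> tangent_space (top_of_set prod_sphere) p"
  then show "v \<in> sphere_tangent p" by (rule tangent_space_subset_sphere_tangent[rotated]) simp
next
  fix v assume v: "v \<in> sphere_tangent p"
  have "continuous_on {-1<..<1} (\<lambda>t. pexp p (t *\<^sub>R v))"
    by (rule smooth_on_continuous[OF smooth_on_subset[OF pexp_smooth]]) simp
  moreover have "(\<lambda>t. pexp p (t *\<^sub>R v)) ` {-1<..<1} \<subseteq> prod_sphere"
    using pexp_in_prod_sphere[OF p subspace_scale[OF subspace_sphere_tangent v]] by blast
  ultimately show "v \<in> tangent_space (top_of_set prod_sphere) p"
    unfolding tangent_space_def using pexp_line_deriv[of p v 0]
    by (auto intro!: exI[of _ 1] exI[of _ "\<lambda>t. pexp p (t *\<^sub>R v)"] smooth_on_subset[OF pexp_smooth])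
qed

lemma geodesic_on_pexp:
  fixes p :: "'a::euclidean_space \<times> 'b::euclidean_space"
  assumes p: "p \<in> prod_sphere" and v: "v \<in> sphere_tangent p" and I: "open I"
  shows "geodesic_on prod_sphere I (\<lambda>t. pexp p (t *\<^sub>R v))"
proof -
  let ?c = "\<lambda>t. pexp p (t *\<^sub>R v)"
  have in_sphere: "?c t \<in> prod_sphere" for t
    using pexp_in_prod_sphere[OF p subspace_scale[OF subspace_sphere_tangent v]] .
  define a where "a = (\<lambda>t. (- (norm (fst v))\<^sup>2 *\<^sub>R fst (?c t), - (norm (snd v))\<^sup>2 *\<^sub>R snd (?c t)))"
  have "((\<lambda>s. dpexp p (s *\<^sub>R v) v) has_vector_derivative a t) (at t)" for t
    using gvel_deriv[of "fst p" "fst v" t] gvel_deriv[of "snd p" "snd v" t]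
    by (simp add: has_vector_derivative_Pair_iff a_def pexp_def dpexp_def flip: gvel_eq_dgexp)
  moreover have "(\<lambda>s. vector_derivative ?c (at s)) = (\<lambda>s. dpexp p (s *\<^sub>R v) v)"
    using vector_derivative_at[OF pexp_line_deriv] by (intro ext)
  ultimately have "vector_derivative (\<lambda>s. vector_derivative ?c (at s)) (at t) = a t" for t
    by (simp add: vector_derivative_at)
  moreover have "a t \<bullet> w = 0" if "w \<in> sphere_tangent (?c t)" for t w
    using that by (cases w) (auto simp: a_def sphere_tangent_def)
  moreover have "smooth_on I ?c"
    by (rule smooth_on_subset[OF pexp_smooth]) simp
  ultimately show ?thesis
    unfolding geodesic_on_def tangent_space_prod_sphere[OF in_sphere]
    using in_sphere by (simp add: image_subset_iff del: mem_Times_iff split_paired_All)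
qed

text \<open>Turns the condition that the acceleration is normal to the sphere into an equation.\<close>

lemma parallel_if_orthogonal:
  assumes "norm x = 1" "\<And>w. x \<bullet> w = 0 \<Longrightarrow> a \<bullet> w = 0"
  shows "a = (a \<bullet> x) *\<^sub>R x"
proof -
  define w where "w = a - (a \<bullet> x) *\<^sub>R x"
  have xw: "x \<bullet> w = 0" using assms(1) by (simp add: w_def inner_diff_right inner_commute dot_square_norm)
  then have "w \<bullet> w = 0" using assms(2)[OF xw] by (simp add: w_def inner_diff_left)
  then show ?thesis by (simp add: w_def)
qed

lemma geodesic_on_eq_pexp:
  fixes p :: "'a::euclidean_space \<times> 'b::euclidean_space"
  assumes geo: "geodesic_on prod_sphere {-\<epsilon><..<\<epsilon>} c" and \<epsilon>: "\<epsilon> > 0"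
    and 0: "c 0 = p" and v: "(c has_vector_derivative v) (at 0)" and t: "t \<in> {-\<epsilon><..<\<epsilon>}"
  shows "c t = pexp p (t *\<^sub>R v)"
proof -
  let ?I = "{-\<epsilon><..<\<epsilon>}"
  have sm: "smooth_on ?I c" and im: "\<And>t. t \<in> ?I \<Longrightarrow> c t \<in> prod_sphere"
    using geo by (auto simp: geodesic_on_def)
  define c' where "c' = (\<lambda>t. vector_derivative c (at t))"
  define c'' where "c'' = (\<lambda>t. vector_derivative c' (at t))"
  have c: "(c has_vector_derivative c' t) (at t)" if "t \<in> ?I" for t
    unfolding c'_def using smooth_on_vector_derivative(1)[OF sm _ that] by simp
  have c': "(c' has_vector_derivative c'' t) (at t)" if "t \<in> ?I" for t
    unfolding c''_def using smooth_on_vector_derivative(1)[OF smooth_on_vector_derivative(2)[OF sm] _ that]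
    by (simp add: c'_def)
  have normal: "c'' t \<bullet> w = 0" if "t \<in> ?I" "w \<in> sphere_tangent (c t)" for t w
    using geo that tangent_space_prod_sphere[OF im[OF that(1)]]
    unfolding geodesic_on_def c''_def c'_def by blast
  have v0: "c' 0 = v"
    using v by (simp add: c'_def vector_derivative_at)
  have fst: "fst (c'' t) = (fst (c'' t) \<bullet> fst (c t)) *\<^sub>R fst (c t)" if t: "t \<in> ?I" for t
    using im[OF t] normal[OF t, of "(_, 0)"]
    by (intro parallel_if_orthogonal) (auto simp: sphere_tangent_def inner_prod_def)
  have snd: "snd (c'' t) = (snd (c'' t) \<bullet> snd (c t)) *\<^sub>R snd (c t)" if t: "t \<in> ?I" for t
    using im[OF t] normal[OF t, of "(0, _)"]
    by (intro parallel_if_orthogonal) (auto simp: sphere_tangent_def inner_prod_def)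
  have "fst (c t) = gexp (fst (c 0)) (t *\<^sub>R fst (c' 0))"
    by (rule sphere_geodesic_eq_gexp[of \<epsilon> "\<lambda>t. fst (c t)" "\<lambda>t. fst (c' t)" "\<lambda>t. fst (c'' t)", OF _ _ _ t])
      (use c c' fst im in \<open>auto simp: has_vector_derivative_Pair_iff mem_Times_iff simp flip: fst\<close>)
  moreover have "snd (c t) = gexp (snd (c 0)) (t *\<^sub>R snd (c' 0))"
    by (rule sphere_geodesic_eq_gexp[of \<epsilon> "\<lambda>t. snd (c t)" "\<lambda>t. snd (c' t)" "\<lambda>t. snd (c'' t)", OF _ _ _ t])
      (use c c' snd im in \<open>auto simp: has_vector_derivative_Pair_iff mem_Times_iff simp flip: snd\<close>)
  ultimately show ?thesis
    by (simp add: pexp_def 0 v0 prod_eq_iff)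
qed

section \<open>Tangent spaces of immersed submanifolds\<close>

text \<open>The topology of an immersed submanifold is finer than the subspace topology.\<close>

lemma openin_immersed:
  assumes "immersed_submanifold k X" "openin X U" "open O'"
  shows "openin X (U \<inter> O')"
proof (subst openin_subopen, intro ballI)
  fix p assume p: "p \<in> U \<inter> O'"
  then have "p \<in> topspace X" using openin_subset[OF assms(2)] by blast
  then obtain V where V: "openin X V" "p \<in> V" "subtopology X V = top_of_set V"
    using assms(1) unfolding immersed_submanifold_def by blast
  have "openin (top_of_set V) (V \<inter> O')" using assms(3) by (rule openin_open_Int)
  then have "openin X (V \<inter> O')"
    using V openin_open_subtopology by metis
  then show "\<exists>T. openin X T \<and> p \<in> T \<and> T \<subseteq> U \<inter> O'"
    using assms(2) V(2) p by (intro exI[of _ "U \<inter> (V \<inter> O')"]) auto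
qed

lemma derivative_in_subspace:
  fixes f :: "real \<Rightarrow> 'a::euclidean_space"
  assumes S: "subspace S" and f: "(f has_vector_derivative d) (at t)"
    and ev: "\<forall>\<^sub>F s in at t. f s \<in> S" and ft: "f t \<in> S"
  shows "d \<in> S"
proof -
  have "d \<in> closure S"
    unfolding closure_approachable
  proof (intro allI impI)
    fix e :: real assume e: "e > 0"
    obtain \<delta>1 where \<delta>1: "\<delta>1 > 0" "\<And>s. norm (s - t) < \<delta>1 \<Longrightarrow>
        norm (f s - f t - (s - t) *\<^sub>R d) \<le> e / 2 * norm (s - t)"
      using f e unfolding has_vector_derivative_def has_derivative_at_alt by (meson half_gt_zero)
    obtain \<delta>2 where \<delta>2: "\<delta>2 > 0" "\<And>s. s \<noteq> t \<Longrightarrow> dist s t < \<delta>2 \<Longrightarrow> f s \<in> S"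
      using ev unfolding eventually_at by blast
    define h where "h = min \<delta>1 \<delta>2 / 2"
    have h: "h > 0" "h < \<delta>1" "h < \<delta>2" using \<delta>1(1) \<delta>2(1) by (auto simp: h_def)
    define y where "y = (1 / h) *\<^sub>R (f (t + h) - f t)"
    have "y \<in> S"
      unfolding y_def using \<delta>2(2)[of "t + h"] h
      by (intro subspace_scale[OF S] subspace_diff[OF S] ft) (auto simp: dist_real_def)
    moreover have "y - d = (1 / h) *\<^sub>R (f (t + h) - f t - h *\<^sub>R d)"
      using h(1) by (simp add: y_def scaleR_diff_right)
    then have "norm (y - d) \<le> e / 2"
      using \<delta>1(2)[of "t + h"] h by (simp add: divide_simps mult.commute)
    ultimately show "\<exists>y\<in>S. dist y d < e"
      using e by (intro bexI[of _ y]) (auto simp: dist_norm)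
  qed
  then show ?thesis using closure_closed[OF closed_subspace[OF S]] by simp
qed

text \<open>A slice chart, cut down to an open set \<open>U\<close> of the submanifold that carries the subspace topology and
  is flattened to a piece of \<open>S\<close>.\<close>

locale slice_chart =
  fixes X :: "'a::euclidean_space topology" and U W W' :: "'a set" and \<Phi> \<Psi> :: "'a \<Rightarrow> 'a" and S :: "'a set"
  assumes openin_U: "openin X U" and U_W: "U \<subseteq> W" and open_W: "open W" and open_W': "open W'"
    and top_U: "subtopology X U = top_of_set U"
    and hom: "homeomorphism W W' \<Phi> \<Psi>" and smooth_\<Phi>: "smooth_on W \<Phi>" and smooth_\<Psi>: "smooth_on W' \<Psi>"
    and S: "subspace S" and image_U: "\<Phi> ` U = W' \<inter> S"
begin

abbreviation D where "D q \<equiv> frechet_derivative \<Phi> (at q)"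

lemma \<Psi>\<Phi>: "q \<in> W \<Longrightarrow> \<Psi> (\<Phi> q) = q" and \<Phi>\<Psi>: "z \<in> W' \<Longrightarrow> \<Phi> (\<Psi> z) = z"
  and \<Phi>_W: "q \<in> W \<Longrightarrow> \<Phi> q \<in> W'" and \<Psi>_W: "z \<in> W' \<Longrightarrow> \<Psi> z \<in> W"
  using hom by (auto simp: homeomorphism_def)

lemma U_iff: "q \<in> U \<longleftrightarrow> q \<in> W \<and> \<Phi> q \<in> S"
proof
  show "q \<in> U \<Longrightarrow> q \<in> W \<and> \<Phi> q \<in> S" using U_W image_U by blast
  assume q: "q \<in> W \<and> \<Phi> q \<in> S"
  then have "\<Phi> q \<in> \<Phi> ` U" using image_U \<Phi>_W by blast
  then obtain u where "u \<in> U" "\<Phi> q = \<Phi> u" by blast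
  then show "q \<in> U" using q \<Psi>\<Phi> U_W by (metis subsetD)
qed

lemma \<Psi>_U: "z \<in> W' \<Longrightarrow> z \<in> S \<Longrightarrow> \<Psi> z \<in> U"
  by (simp add: U_iff \<Phi>\<Psi> \<Psi>_W)

lemma D_deriv: "q \<in> W \<Longrightarrow> (\<Phi> has_derivative D q) (at q)"
  by (rule smooth_on_has_derivative[OF smooth_\<Phi>])

lemma D_linear: "q \<in> W \<Longrightarrow> linear (D q)"
  using D_deriv has_derivative_linear by blast

lemma D_inverse:
  assumes q: "q \<in> W"
  obtains E where "(\<Psi> has_derivative E) (at (\<Phi> q))" "\<And>w. E (D q w) = w" "\<And>w. D q (E w) = w"
proof -
  obtain E where E: "(\<Psi> has_derivative E) (at (\<Phi> q))"
    using smooth_on_has_derivative[OF smooth_\<Psi> \<Phi>_W[OF q]] by blast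
  have "((\<lambda>x. \<Psi> (\<Phi> x)) has_derivative (\<lambda>w. E (D q w))) (at q)"
    by (rule has_derivative_compose[OF D_deriv[OF q] E])
  then have "((\<lambda>x. x) has_derivative (\<lambda>w. E (D q w))) (at q)"
    by (rule has_derivative_transform_within_open[OF _ open_W q]) (simp add: \<Psi>\<Phi>)
  then have 1: "(\<lambda>w. E (D q w)) = (\<lambda>w. w)"
    using has_derivative_unique has_derivative_ident by blast
  have "(\<Phi> has_derivative D q) (at (\<Psi> (\<Phi> q)))"
    using D_deriv[OF q] by (simp add: \<Psi>\<Phi>[OF q])
  then have "((\<lambda>x. \<Phi> (\<Psi> x)) has_derivative (\<lambda>w. D q (E w))) (at (\<Phi> q))"
    by (rule has_derivative_compose[OF E])
  then have "((\<lambda>x. x) has_derivative (\<lambda>w. D q (E w))) (at (\<Phi> q))"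
    by (rule has_derivative_transform_within_open[OF _ open_W' \<Phi>_W[OF q]]) (simp add: \<Phi>\<Psi>)
  then have 2: "(\<lambda>w. D q (E w)) = (\<lambda>w. w)"
    using has_derivative_unique has_derivative_ident by blast
  show ?thesis by (rule that[OF E]) (use 1 2 in \<open>simp_all add: fun_eq_iff\<close>)
qed

text \<open>Differentiability at the one point \<open>t\<close> is enough here, so that the lemma applies to the variations
  \<open>s \<mapsto> pexp q (v + s w)\<close>, for which only the derivative at \<open>0\<close> is computed.\<close>

lemma curve_derivative:
  assumes q: "c t \<in> U" and ev: "\<forall>\<^sub>F s in at t. c s \<in> U" and v: "(c has_vector_derivative v) (at t)"
  shows "D (c t) v \<in> S"
proof (rule derivative_in_subspace[OF S])
  have qW: "c t \<in> W" using q U_W by blast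
  have "((\<lambda>s. \<Phi> (c s)) has_derivative (\<lambda>h. D (c t) (h *\<^sub>R v))) (at t)"
    by (rule has_derivative_compose[OF v[unfolded has_vector_derivative_def] D_deriv[OF qW]])
  then show "((\<lambda>s. \<Phi> (c s)) has_vector_derivative D (c t) v) (at t)"
    using linear_scale[OF D_linear[OF qW]] by (simp add: has_vector_derivative_def)
  show "\<forall>\<^sub>F s in at t. \<Phi> (c s) \<in> S" using ev by (rule eventually_mono) (simp add: U_iff)
  show "\<Phi> (c t) \<in> S" using q by (simp add: U_iff)
qed

lemma continuous_curve_stays:
  assumes c: "continuous_map (top_of_set {-\<epsilon><..<\<epsilon>::real}) X c" and "\<epsilon> > 0" and 0: "c 0 \<in> U"
  obtains \<eta> where "0 < \<eta>" "\<eta> \<le> \<epsilon>" "\<And>t. \<bar>t\<bar> < \<eta> \<Longrightarrow> c t \<in> U"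
proof -
  have "openin (top_of_set {-\<epsilon><..<\<epsilon>}) {t \<in> {-\<epsilon><..<\<epsilon>}. c t \<in> U}"
    using openin_continuous_map_preimage[OF c openin_U] by simp
  then have "open {t \<in> {-\<epsilon><..<\<epsilon>}. c t \<in> U}"
    by (rule openin_open_trans) auto
  moreover have "0 \<in> {t \<in> {-\<epsilon><..<\<epsilon>}. c t \<in> U}" using 0 \<open>\<epsilon> > 0\<close> by auto
  ultimately obtain \<eta> where "\<eta> > 0" "ball 0 \<eta> \<subseteq> {t \<in> {-\<epsilon><..<\<epsilon>}. c t \<in> U}"
    using openE by blast
  then show ?thesis using \<open>\<epsilon> > 0\<close> by (intro that[of "min \<eta> \<epsilon>"]) (auto simp: subset_iff dist_norm)
qed

text \<open>A tangent vector is the velocity of a straight line in the chart.\<close>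

lemma tangent_space_iff:
  assumes q: "q \<in> U"
  shows "v \<in> tangent_space X q \<longleftrightarrow> D q v \<in> S"
proof
  assume "v \<in> tangent_space X q"
  then obtain \<epsilon> c where \<epsilon>: "\<epsilon> > 0" and c: "continuous_map (top_of_set {-\<epsilon><..<\<epsilon>}) X c"
    and 0: "c 0 = q" and v: "(c has_vector_derivative v) (at 0)"
    unfolding tangent_space_def by blast
  obtain \<eta> where \<eta>: "0 < \<eta>" "\<And>t. \<bar>t\<bar> < \<eta> \<Longrightarrow> c t \<in> U"
    using continuous_curve_stays[OF c \<epsilon>] 0 q by metis
  have "\<forall>\<^sub>F s in at 0. c s \<in> U"
    using \<eta> by (auto simp: eventually_at dist_norm intro!: exI[of _ \<eta>])
  then show "D q v \<in> S" using curve_derivative[of c 0 v] v 0 q by simp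
next
  assume s: "D q v \<in> S"
  have qW: "q \<in> W" using q U_W by blast
  obtain E where E: "(\<Psi> has_derivative E) (at (\<Phi> q))" "\<And>w. E (D q w) = w"
    using D_inverse[OF qW] by metis
  define l where "l = (\<lambda>t::real. \<Phi> q + t *\<^sub>R D q v)"
  have l: "smooth_on UNIV l"
    unfolding l_def by (intro smooth_on_add smooth_on_const smooth_on_scaleR smooth_on_ident) auto
  have "open (l -` W')"
    using continuous_open_preimage[OF smooth_on_continuous[OF l] open_UNIV open_W'] by simp
  moreover have "0 \<in> l -` W'" using \<Phi>_W[OF qW] by (simp add: l_def)
  ultimately obtain \<epsilon> where \<epsilon>: "\<epsilon> > 0" "ball 0 \<epsilon> \<subseteq> l -` W'" using openE by blast
  then have lW: "l t \<in> W'" if "t \<in> {-\<epsilon><..<\<epsilon>}" for t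
    using that by (auto simp: subset_iff dist_norm)
  have lS: "l t \<in> S" for t
    unfolding l_def using q s by (intro subspace_add[OF S] subspace_scale[OF S]) (auto simp: U_iff)
  define c where "c = (\<lambda>t. \<Psi> (l t))"
  have sm: "smooth_on {-\<epsilon><..<\<epsilon>} c"
    unfolding c_def
    by (rule smooth_on_compose[OF _ open_W' lW smooth_\<Psi> smooth_on_subset[OF l]]) auto
  have cU: "c t \<in> U" if "t \<in> {-\<epsilon><..<\<epsilon>}" for t
    unfolding c_def using \<Psi>_U lW[OF that] lS by blast
  have "continuous_map (top_of_set {-\<epsilon><..<\<epsilon>}) (subtopology X U) c"
    using smooth_on_continuous[OF sm] cU unfolding top_U by auto
  then have "continuous_map (top_of_set {-\<epsilon><..<\<epsilon>}) X c"
    by (simp add: continuous_map_in_subtopology)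
  moreover have "(c has_vector_derivative v) (at 0)"
  proof -
    have "(l has_derivative (\<lambda>h. h *\<^sub>R D q v)) (at 0)"
      unfolding l_def by (auto intro!: derivative_eq_intros)
    moreover have "(\<Psi> has_derivative E) (at (l 0))" using E(1) by (simp add: l_def)
    ultimately have "(c has_derivative (\<lambda>h. E (h *\<^sub>R D q v))) (at 0)"
      unfolding c_def by (rule has_derivative_compose)
    then show ?thesis
      using linear_scale[OF has_derivative_linear[OF E(1)]] E(2) by (simp add: has_vector_derivative_def)
  qed
  moreover have "c 0 = q" by (simp add: c_def l_def \<Psi>\<Phi>[OF qW])
  ultimately show "v \<in> tangent_space X q"
    unfolding tangent_space_def using \<epsilon>(1) sm by blast
qed

lemma tangent_space_subspace: "q \<in> U \<Longrightarrow> subspace (tangent_space X q)"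
  and tangent_space_dim: "q \<in> U \<Longrightarrow> dim (tangent_space X q) = dim S"
proof -
  assume q: "q \<in> U"
  then have qW: "q \<in> W" using U_W by blast
  obtain E where E: "(\<Psi> has_derivative E) (at (\<Phi> q))" "\<And>w. E (D q w) = w" "\<And>w. D q (E w) = w"
    using D_inverse[OF qW] by metis
  have lin: "linear E" using E(1) has_derivative_linear by blast
  have eq: "tangent_space X q = E ` S"
  proof (intro equalityI subsetI)
    fix v assume "v \<in> tangent_space X q"
    then show "v \<in> E ` S" using tangent_space_iff[OF q] E(2)[of v, symmetric] by blast
  qed (auto simp: tangent_space_iff[OF q] E(3))
  show "subspace (tangent_space X q)"
    unfolding eq by (rule linear_subspace_image[OF lin S])
  have "inj E" using E(3) by (metis injI)
  then show "dim (tangent_space X q) = dim S"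
    unfolding eq using dim_image_eq[OF lin] inj_on_subset by blast
qed

lemma tangent_of_curve:
  assumes "c t \<in> U" "\<forall>\<^sub>F s in at t. c s \<in> U" "(c has_vector_derivative v) (at t)"
  shows "v \<in> tangent_space X (c t)"
  using curve_derivative[OF assms] tangent_space_iff[OF assms(1)] by blast

end

lemma immersed_submanifold_chart:
  fixes X :: "'a::euclidean_space topology"
  assumes X: "immersed_submanifold k X" and p: "p \<in> topspace X"
  obtains U W W' \<Phi> \<Psi> S where "slice_chart X U W W' \<Phi> \<Psi> S" "p \<in> U" "dim S = k"
proof -
  obtain U where U: "openin X U" "p \<in> U" "subtopology X U = top_of_set U" "embedded_submanifold k U"
    using assms unfolding immersed_submanifold_def by blast
  then obtain W W' \<Phi> \<Psi> and S :: "'a set" where ch: "open W" "p \<in> W" "open W'"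
    "homeomorphism W W' \<Phi> \<Psi>" "smooth_on W \<Phi>" "smooth_on W' \<Psi>" "subspace S" "dim S = k"
    "\<Phi> ` (U \<inter> W) = W' \<inter> S"
    using bspec[OF U(4)[unfolded embedded_submanifold_def] U(2)] by (elim exE conjE) (rule that)
  have "subtopology X (U \<inter> W) = subtopology (subtopology X U) (U \<inter> W)"
    by (simp add: subtopology_subtopology Int_absorb1)
  then have "subtopology X (U \<inter> W) = top_of_set (U \<inter> W)"
    using U(3) by (simp add: subtopology_subtopology Int_absorb1)
  then have "slice_chart X (U \<inter> W) W W' \<Phi> \<Psi> S"
    using ch openin_immersed[OF X U(1)] by unfold_locales auto
  then show ?thesis using that U(2) ch(2,8) by blast
qed

section \<open>Local structure of geodesic submanifolds\<close>

lemma dist_gexp: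
  assumes "norm x = 1" "x \<bullet> v = 0"
  shows "norm (gexp x v - x) \<le> norm v"
proof -
  have "(norm (gexp x v - x))\<^sup>2 = (norm (gexp x v))\<^sup>2 + (norm x)\<^sup>2 - 2 * (x \<bullet> gexp x v)"
    by (simp add: power2_norm_eq_inner inner_diff_left inner_diff_right inner_commute)
  also have "\<dots> = 2 - 2 * cos (norm v)"
    using norm_gexp[OF assms] inner_gexp[OF assms] assms by simp
  also have "\<dots> = 4 * (sin (norm v / 2))\<^sup>2"
    using cos_double_sin[of "norm v / 2"] by simp
  also have "\<dots> \<le> 4 * (norm v / 2)\<^sup>2"
    using abs_sin_x_le_abs_x[of "norm v / 2"] by (intro mult_left_mono) (auto simp flip: abs_le_square_iff)
  also have "\<dots> = (norm v)\<^sup>2" by (simp add: power2_eq_square)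
  finally show ?thesis by simp
qed

lemma dist_pexp:
  assumes "p \<in> prod_sphere" "v \<in> sphere_tangent p"
  shows "dist (pexp p v) p \<le> norm v"
proof -
  have "(norm (pexp p v - p))\<^sup>2 \<le> (norm v)\<^sup>2"
    using dist_gexp[of "fst p" "fst v"] dist_gexp[of "snd p" "snd v"] assms
    by (simp add: norm_prod_def pexp_def sphere_tangent_def mem_Times_iff add_mono)
  then show ?thesis by (simp add: dist_norm power2_le_iff_abs_le)
qed

lemma pexp_inj:
  assumes "p \<in> prod_sphere" "v \<in> sphere_tangent p" "w \<in> sphere_tangent p"
    "norm v < pi" "norm w < pi" "pexp p v = pexp p w"
  shows "v = w"
proof -
  have "norm (fst v) < pi" "norm (fst w) < pi" "norm (snd v) < pi" "norm (snd w) < pi"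
    using assms(4,5) norm_fst_le[of "fst v" "snd v"] norm_snd_le[of "snd v" "fst v"]
      norm_fst_le[of "fst w" "snd w"] norm_snd_le[of "snd w" "fst w"] by auto
  then show ?thesis
    using assms gexp_inj[of "fst p" "fst v" "fst w"] gexp_inj[of "snd p" "snd v" "snd w"]
    by (simp add: pexp_def sphere_tangent_def mem_Times_iff prod_eq_iff)
qed

lemma dpexp_eq_0:
  assumes "p \<in> prod_sphere" "v \<in> sphere_tangent p" "w \<in> sphere_tangent p" "norm v < pi" "dpexp p v w = 0"
  shows "w = 0"
proof -
  have "norm (fst v) < pi" "norm (snd v) < pi"
    using assms(4) norm_fst_le[of "fst v" "snd v"] norm_snd_le[of "snd v" "fst v"] by auto
  then show ?thesis
    using assms dgexp_eq_0[of "fst p" "fst v" "fst w"] dgexp_eq_0[of "snd p" "snd v" "snd w"]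
    by (simp add: dpexp_def sphere_tangent_def mem_Times_iff prod_eq_iff zero_prod_def)
qed

lemma pexp_continuous: "continuous_on UNIV (pexp p)"
  unfolding pexp_def
  by (intro continuous_on_Pair continuous_on_compose2[OF gexp_continuous] continuous_intros) auto

lemma norm_dpexp_line:
  assumes "p \<in> prod_sphere" "v \<in> sphere_tangent p"
  shows "norm (dpexp p (t *\<^sub>R v) v) = norm v"
  using assms norm_gvel[of "fst p" "fst v" t] norm_gvel[of "snd p" "snd v" t]
  by (simp add: dpexp_def norm_prod_def sphere_tangent_def mem_Times_iff flip: gvel_eq_dgexp)

locale geodesic_chart = slice_chart X U W W' \<Phi> \<Psi> S
  for X :: "('a::euclidean_space \<times> 'b::euclidean_space) topology" and U W W' \<Phi> \<Psi> S +
  fixes k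
  assumes geo: "geodesic_submanifold prod_sphere k X" and dim_S: "dim S = k"
begin

lemma in_sphere: "q \<in> U \<Longrightarrow> q \<in> prod_sphere"
  using geo openin_subset[OF openin_U] unfolding geodesic_submanifold_def by blast

lemma tangent_in_sphere_tangent:
  "v \<in> tangent_space X q \<Longrightarrow> v \<in> sphere_tangent q"
  using geo unfolding geodesic_submanifold_def by (blast intro: tangent_space_subset_sphere_tangent)

lemma local_geodesic:
  assumes q: "q \<in> U" and v: "v \<in> tangent_space X q"
  obtains \<eta> where "\<eta> > 0" "\<And>t. \<bar>t\<bar> < \<eta> \<Longrightarrow> pexp q (t *\<^sub>R v) \<in> U"
proof -
  have "q \<in> topspace X" using q openin_subset[OF openin_U] by blast
  then obtain \<epsilon> c where \<epsilon>: "\<epsilon> > 0" and c: "geodesic_on prod_sphere {-\<epsilon><..<\<epsilon>} c" "c 0 = q"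
    "(c has_vector_derivative v) (at 0)" "continuous_map (top_of_set {-\<epsilon><..<\<epsilon>}) X c"
    using geo v unfolding geodesic_submanifold_def by blast
  obtain \<eta> where "\<eta> > 0" "\<eta> \<le> \<epsilon>" "\<And>t. \<bar>t\<bar> < \<eta> \<Longrightarrow> c t \<in> U"
    using continuous_curve_stays[OF c(4) \<epsilon>] c(2) q by metis
  moreover have "c t = pexp q (t *\<^sub>R v)" if "\<bar>t\<bar> < \<epsilon>" for t
    using that by (intro geodesic_on_eq_pexp[OF c(1) \<epsilon> c(2,3)]) auto
  ultimately show ?thesis by (intro that[of \<eta>]) fastforce+
qed

text \<open>The geodesics of the submanifold exist only for a short time, a priori depending on the
  initial velocity.  They cannot end inside a chart: the set of times at which a geodesic of the
  surrounding space lies in a compact piece of the chart, with velocity tangent to the submanifold,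
  is closed by compactness and open by local existence and uniqueness.  This gives a radius that
  works for all initial velocities near a point.\<close>

lemma uniform_radius:
  assumes p: "p \<in> U"
  obtains \<delta> where "0 < \<delta>" "\<delta> \<le> 1"
    "\<And>q v. q \<in> U \<Longrightarrow> dist q p < \<delta> \<Longrightarrow> v \<in> tangent_space X q \<Longrightarrow> norm v < \<delta> \<Longrightarrow> pexp q v \<in> U"
    "\<And>q v t. q \<in> U \<Longrightarrow> dist q p < \<delta> \<Longrightarrow> v \<in> tangent_space X q \<Longrightarrow> norm v < \<delta> \<Longrightarrow> \<bar>t\<bar> \<le> 1 \<Longrightarrow>
       dpexp q (t *\<^sub>R v) v \<in> tangent_space X (pexp q (t *\<^sub>R v))"
proof -
  have pW: "p \<in> W" using p U_W by blast
  obtain \<rho> where \<rho>: "\<rho> > 0" "cball (\<Phi> p) \<rho> \<subseteq> W'"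
    using open_W' \<Phi>_W[OF pW] open_contains_cball by blast
  (* a compact neighbourhood of p in the submanifold *)
  define K where "K = \<Psi> ` (cball (\<Phi> p) \<rho> \<inter> S)"
  have K_U: "K \<subseteq> U" unfolding K_def using \<Psi>_U \<rho>(2) by blast
  have "compact K"
    unfolding K_def using \<rho>(2) smooth_on_continuous[OF smooth_\<Psi>]
    by (intro compact_continuous_image compact_Int_closed closed_subspace[OF S] compact_cball)
      (auto intro: continuous_on_subset)
  then have "closed K" by (rule compact_imp_closed)
  have "open (W \<inter> \<Phi> -` ball (\<Phi> p) \<rho>)"
    by (rule continuous_open_preimage[OF smooth_on_continuous[OF smooth_\<Phi>] open_W open_ball])
  moreover have "p \<in> W \<inter> \<Phi> -` ball (\<Phi> p) \<rho>" using pW \<rho>(1) by simp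
  ultimately obtain r where r: "r > 0" "ball p r \<subseteq> W \<inter> \<Phi> -` ball (\<Phi> p) \<rho>"
    using openE by blast
  have near_K: "q \<in> K" if "q \<in> U" "dist q p < r" for q
  proof -
    have "\<Phi> q \<in> ball (\<Phi> p) \<rho>" using that(2) r(2) by (auto simp: dist_commute)
    then have "\<Phi> q \<in> cball (\<Phi> p) \<rho> \<inter> S" using that(1) by (auto simp: U_iff)
    then have "\<Psi> (\<Phi> q) \<in> K" unfolding K_def by blast
    then show ?thesis using \<Psi>\<Phi>[of q] that(1) U_W by (auto simp del: split_paired_All)
  qed
  (* The base point is at most r/2 away from p, and a geodesic of speed less than r/2 moves by less
     than r/2 in unit time: it stays within the distance r of p, where U is contained in K. *)
  define \<delta> where "\<delta> = min 1 (r / 2)"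
  have main: "pexp q (t *\<^sub>R v) \<in> U \<and> dpexp q (t *\<^sub>R v) v \<in> tangent_space X (pexp q (t *\<^sub>R v))"
    if q: "q \<in> U" and qp: "dist q p < \<delta>" and v: "v \<in> tangent_space X q" and nv: "norm v < \<delta>"
      and t: "\<bar>t\<bar> \<le> 1" for q v t
  proof -
    have qs: "q \<in> prod_sphere" and vs: "v \<in> sphere_tangent q"
      using in_sphere[OF q] tangent_in_sphere_tangent[OF v] by auto
    define c where "c = (\<lambda>t. pexp q (t *\<^sub>R v))"
    define c' where "c' = (\<lambda>t. dpexp q (t *\<^sub>R v) v)"
    have c: "(c has_vector_derivative c' t) (at t)" for t
      unfolding c_def c'_def by (rule pexp_line_deriv)
    have cont_c: "continuous_on UNIV c"
      unfolding c_def by (rule smooth_on_continuous[OF pexp_smooth])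
    have cont_c': "continuous_on UNIV c'"
    proof -
      have "c' = (\<lambda>t. vector_derivative c (at t))"
        using vector_derivative_at[OF c] by auto
      then show ?thesis
        using smooth_on_continuous[OF smooth_on_vector_derivative(2)[OF pexp_smooth open_UNIV]]
        unfolding c_def by simp
    qed
    have near: "dist (c t) p < r" if "t \<in> {-1..1}" for t
    proof -
      have "dist (c t) q \<le> norm (t *\<^sub>R v)"
        unfolding c_def by (rule dist_pexp[OF qs subspace_scale[OF subspace_sphere_tangent vs]])
      also have "\<dots> \<le> norm v" using that by (auto intro!: mult_left_le_one_le)
      finally show ?thesis
        using qp nv dist_triangle[of "c t" p q] by (simp add: \<delta>_def)
    qed
    define G0 where "G0 = {t \<in> {-1..1}. c t \<in> K}"
    define G where "G = {t \<in> G0. D (c t) (c' t) \<in> S}"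
    have "closedin (top_of_set {-1..1}) G"
    proof (rule closedin_trans)
      show "closedin (top_of_set {-1..1}) G0"
        using continuous_closedin_preimage[OF continuous_on_subset[OF cont_c] \<open>closed K\<close>, of "{-1..1}"]
        by (simp add: G0_def vimage_def Int_def)
      have G0_W: "c t \<in> W" if "t \<in> G0" for t using that K_U U_W by (auto simp: G0_def)
      have "D (c t) (c' t) = (\<Sum>b\<in>Basis. (c' t \<bullet> b) *\<^sub>R D (c t) b)" if "t \<in> G0" for t
      proof -
        have "D (c t) (c' t) = D (c t) (\<Sum>b\<in>Basis. (c' t \<bullet> b) *\<^sub>R b)"
          by (simp only: euclidean_representation)
        then show ?thesis
          using D_linear[OF G0_W[OF that]] by (simp add: linear_sum linear_scale)
      qed
      moreover have "continuous_on G0 (\<lambda>t. \<Sum>b\<in>Basis. (c' t \<bullet> b) *\<^sub>R D (c t) b)"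
      proof (intro continuous_intros)
        show "continuous_on G0 c'" using cont_c' continuous_on_subset by blast
        show "continuous_on G0 (\<lambda>t. D (c t) b)" for b
          by (rule continuous_on_compose2[OF smooth_on_continuous[OF smooth_on_frechet_derivative[OF smooth_\<Phi>]]
              continuous_on_subset[OF cont_c]]) (use G0_W in auto)
      qed
      ultimately have "continuous_on G0 (\<lambda>t. D (c t) (c' t))"
        by (simp cong: continuous_on_cong)
      then show "closedin (top_of_set G0) G"
        using continuous_closedin_preimage[OF _ closed_subspace[OF S], of G0]
        by (simp add: G_def vimage_def Int_def)
    qed
    moreover have "openin (top_of_set {-1..1}) G"
      unfolding openin_euclidean_subtopology_iff
    proof (intro conjI ballI)
      show "G \<subseteq> {-1..1}" by (auto simp: G_def G0_def)
      fix t assume t: "t \<in> G"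
      then have ctU: "c t \<in> U" using K_U by (auto simp: G_def G0_def)
      have "c' t \<in> tangent_space X (c t)"
        using t tangent_space_iff[OF ctU] by (simp add: G_def)
      then obtain \<eta> where \<eta>: "\<eta> > 0" "\<And>s. \<bar>s\<bar> < \<eta> \<Longrightarrow> pexp (c t) (s *\<^sub>R c' t) \<in> U"
        using local_geodesic[OF ctU] by blast
      have stay: "c s \<in> U" if "\<bar>s - t\<bar> < \<eta>" for s
        using \<eta>(2)[OF that] pexp_shift[OF qs vs, of t "s - t"] by (simp add: c_def c'_def)
      have "s \<in> G" if s: "s \<in> {-1..1}" "dist s t < \<eta>" for s
      proof -
        have sU: "c s \<in> U" using stay s(2) by (simp add: dist_real_def)
        have "\<forall>\<^sub>F u in at s. dist u t < \<eta>"
          using s(2) by (intro eventually_at_in_open'[of "ball t \<eta>" s, simplified, THEN eventually_mono])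
             (auto simp: dist_commute)
        then have "\<forall>\<^sub>F u in at s. c u \<in> U"
          by (rule eventually_mono) (simp add: stay dist_real_def)
        then have "D (c s) (c' s) \<in> S" by (rule curve_derivative[OF sU _ c])
        then show ?thesis using near_K[OF sU near[OF s(1)]] s(1) by (simp add: G_def G0_def)
      qed
      then show "\<exists>e>0. \<forall>s\<in>{-1..1}. dist s t < e \<longrightarrow> s \<in> G" using \<eta>(1) by blast
    qed
    moreover have "0 \<in> G"
      using near_K[OF q] qp v tangent_space_iff[OF q] r(1)
      by (simp add: G_def G0_def c_def c'_def \<delta>_def)
    moreover have "connected {-1..1::real}" by simp
    ultimately have "G = {-1..1}" unfolding connected_clopen by blast
    then have "t \<in> G" using t by auto
    then have "c t \<in> U" "D (c t) (c' t) \<in> S" using K_U by (auto simp: G_def G0_def)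
    then show ?thesis using tangent_space_iff by (simp add: c_def c'_def)
  qed
  show ?thesis
  proof (rule that[of \<delta>])
    show "0 < \<delta>" "\<delta> \<le> 1" using r(1) by (auto simp: \<delta>_def)
  qed (use main[where t = 1] main in auto)
qed

text \<open>Within the uniform radius \<open>s \<mapsto> pexp q (v + s w)\<close> is a curve in the submanifold, so the
  differential of \<open>pexp q\<close> maps tangent space into tangent space.  It is injective at vectors shorter
  than \<open>pi\<close>, and the dimensions agree.\<close>

lemma tangent_transport:
  assumes p: "p \<in> U"
  obtains \<delta> where "0 < \<delta>" "\<delta> \<le> 1"
    "\<And>q v. q \<in> U \<Longrightarrow> dist q p < \<delta> \<Longrightarrow> v \<in> tangent_space X q \<Longrightarrow> norm v < \<delta> \<Longrightarrow>
       pexp q v \<in> U \<and> tangent_space X (pexp q v) = dpexp q v ` tangent_space X q"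
proof -
  obtain \<delta> where \<delta>: "0 < \<delta>" "\<delta> \<le> 1"
    and stay: "\<And>q v. q \<in> U \<Longrightarrow> dist q p < \<delta> \<Longrightarrow> v \<in> tangent_space X q \<Longrightarrow> norm v < \<delta> \<Longrightarrow> pexp q v \<in> U"
    using uniform_radius[OF p] by metis
  have "pexp q v \<in> U \<and> tangent_space X (pexp q v) = dpexp q v ` tangent_space X q"
    if q: "q \<in> U" and d: "dist q p < \<delta>" and v: "v \<in> tangent_space X q" and n: "norm v < \<delta>" for q v
  proof -
    let ?T = "tangent_space X q"
    have inU: "pexp q v \<in> U" by (rule stay[OF q d v n])
    have sub: "subspace ?T" by (rule tangent_space_subspace[OF q])
    have im: "dpexp q v w \<in> tangent_space X (pexp q v)" if w: "w \<in> ?T" for w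
    proof -
      have "isCont (\<lambda>s. norm (v + s *\<^sub>R w)) 0" by (intro continuous_intros)
      then have "\<forall>\<^sub>F s in at 0. norm (v + s *\<^sub>R w) < \<delta>"
        using n unfolding isCont_def by (intro order_tendstoD(2)) auto
      then have "\<forall>\<^sub>F s in at 0. pexp q (v + s *\<^sub>R w) \<in> U"
        by (rule eventually_mono)
          (intro stay[OF q d] subspace_add[OF sub v] subspace_scale[OF sub w])
      then show ?thesis
        using tangent_of_curve[of "\<lambda>s. pexp q (v + s *\<^sub>R w)" 0, OF _ _ dpexp_deriv] inU by simp
    qed
    have inj: "inj_on (dpexp q v) ?T"
    proof (subst linear_inj_on_iff_eq_0[OF dpexp_linear])
      show "\<forall>w\<in>?T. dpexp q v w = 0 \<longrightarrow> w = 0"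
        using dpexp_eq_0[OF in_sphere[OF q] tangent_in_sphere_tangent[OF v] tangent_in_sphere_tangent]
          n \<delta>(2) pi_gt3 by force
    qed (rule sub)
    have "dpexp q v ` ?T = tangent_space X (pexp q v)"
    proof (rule subspace_dim_equal)
      show "subspace (dpexp q v ` ?T)" by (rule linear_subspace_image[OF dpexp_linear sub])
      show "subspace (tangent_space X (pexp q v))" by (rule tangent_space_subspace[OF inU])
      show "dpexp q v ` ?T \<subseteq> tangent_space X (pexp q v)" using im by blast
      have "dim (dpexp q v ` ?T) = dim ?T"
        using dim_image_eq[OF dpexp_linear, of q v ?T] inj sub by (simp add: span_eq_iff[THEN iffD2])
      then show "dim (tangent_space X (pexp q v)) \<le> dim (dpexp q v ` ?T)"
        by (simp add: tangent_space_dim q inU)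
    qed
    then show ?thesis using inU by simp
  qed
  then show ?thesis using that \<delta> by blast
qed

text \<open>Near a point the submanifold is swept out by its geodesics through that point, by invariance
  of domain.\<close>

lemma local_exp_image:
  assumes p: "p \<in> U" and e: "e > 0"
  obtains N where "openin X N" "p \<in> N" "N \<subseteq> pexp p ` (tangent_space X p \<inter> ball 0 e)"
proof -
  obtain \<delta> where \<delta>: "0 < \<delta>" "\<delta> \<le> 1"
    and tr: "\<And>q v. q \<in> U \<Longrightarrow> dist q p < \<delta> \<Longrightarrow> v \<in> tangent_space X q \<Longrightarrow> norm v < \<delta> \<Longrightarrow>
       pexp q v \<in> U \<and> tangent_space X (pexp q v) = dpexp q v ` tangent_space X q"
    using tangent_transport[OF p] by metis
  let ?T = "tangent_space X p"
  define B where "B = ?T \<inter> ball 0 (min \<delta> e)"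
  have BU: "pexp p v \<in> U" if "v \<in> B" for v
    using tr[OF p, of v] that \<delta>(1) by (auto simp: B_def)
  have "openin (top_of_set S) ((\<lambda>v. \<Phi> (pexp p v)) ` B)"
  proof (rule invariance_of_domain_subspaces)
    show "openin (top_of_set ?T) B" unfolding B_def by (rule openin_open_Int) simp
    show "subspace ?T" by (rule tangent_space_subspace[OF p])
    show "dim S \<le> dim ?T" by (simp add: tangent_space_dim[OF p])
    show "continuous_on B (\<lambda>v. \<Phi> (pexp p v))"
      by (rule continuous_on_compose2[OF smooth_on_continuous[OF smooth_\<Phi>]
            continuous_on_subset[OF pexp_continuous]]) (use BU U_W in auto)
    show "(\<lambda>v. \<Phi> (pexp p v)) \<in> B \<rightarrow> S" using BU U_iff by auto
    show "inj_on (\<lambda>v. \<Phi> (pexp p v)) B"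
    proof (rule inj_onI)
      fix v w assume vw: "v \<in> B" "w \<in> B" and eq: "\<Phi> (pexp p v) = \<Phi> (pexp p w)"
      then have "pexp p v = pexp p w" using BU U_W \<Psi>\<Phi> by (metis subsetD)
      then show "v = w"
        using vw \<delta>(2) pi_gt3 tangent_in_sphere_tangent
        by (elim pexp_inj[OF in_sphere[OF p], rotated -1]) (auto simp: B_def)
    qed
  qed (rule S)
  then obtain Q where Q: "open Q" "(\<lambda>v. \<Phi> (pexp p v)) ` B = S \<inter> Q"
    unfolding openin_open by blast
  define N where "N = U \<inter> (W \<inter> \<Phi> -` Q)"
  have "open (W \<inter> \<Phi> -` Q)"
    by (rule continuous_open_preimage[OF smooth_on_continuous[OF smooth_\<Phi>] open_W Q(1)])
  then have "openin X N"
    unfolding N_def using geo openin_U openin_immersed unfolding geodesic_submanifold_def by blast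
  moreover have "0 \<in> B"
    using subspace_0[OF tangent_space_subspace[OF p]] \<delta>(1) e by (simp add: B_def)
  then have "\<Phi> p \<in> Q" using Q(2) by force
  then have "p \<in> N" using p U_W by (auto simp: N_def)
  moreover have "N \<subseteq> pexp p ` (?T \<inter> ball 0 e)"
  proof
    fix q assume q: "q \<in> N"
    then have "\<Phi> q \<in> S \<inter> Q" by (auto simp: N_def U_iff)
    then obtain v where v: "v \<in> B" "\<Phi> q = \<Phi> (pexp p v)" using Q(2) by blast
    then have "q = pexp p v" using q BU[OF v(1)] U_W \<Psi>\<Phi> unfolding N_def by (metis IntD1 subsetD)
    then show "q \<in> pexp p ` (?T \<inter> ball 0 e)" using v(1) by (auto simp: B_def)
  qed
  ultimately show ?thesis using that by blast
qed

end

section \<open>The curvature condition on the tangent spaces\<close>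

text \<open>Up to sign, \<open>jacobi v w\<close> is the curvature operator \<open>R(v, w) v\<close> of the sphere.\<close>

definition jacobi :: "'a::real_inner \<Rightarrow> 'a \<Rightarrow> 'a" where
  "jacobi v w = (v \<bullet> v) *\<^sub>R w - (v \<bullet> w) *\<^sub>R v"

definition reflect_in :: "'a::real_inner \<Rightarrow> 'a \<Rightarrow> 'a" where
  "reflect_in m z = (2 * (m \<bullet> z)) *\<^sub>R m - z"

text \<open>The reflection in \<open>x\<close> sends \<open>gexp x v\<close> to \<open>gexp x (- v)\<close>; this is the derivative of that identity.\<close>

lemma reflect_dgexp:
  fixes x v w :: "'a::real_inner"
  assumes x: "norm x = 1" "x \<bullet> v = 0" "x \<bullet> w = 0"
  shows "reflect_in x (dgexp x v w) = - dgexp x (- v) w"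
  using x by (auto simp: reflect_in_def dgexp_def inner_diff_right inner_add_right dot_square_norm
      algebra_simps simp flip: scaleR_2)

text \<open>Reflecting in the midpoint takes the part of \<open>dgexp x (t v) w\<close> along the great circle back to its
  negative at \<open>x\<close>.  The part orthogonal to the great circle only changes its sign, but it was
  multiplied by \<open>sin (t \<bar>v\<bar>) / (t \<bar>v\<bar>)\<close>, and this defect is a multiple of \<open>jacobi v w\<close>.\<close>

lemma reflect_dgexp_midpoint:
  fixes x v w :: "'a::real_inner"
  assumes x: "norm x = 1" "x \<bullet> v = 0" "x \<bullet> w = 0" and t: "t > 0"
  shows "w + reflect_in (gexp x ((t / 2) *\<^sub>R v)) (dgexp x (t *\<^sub>R v) w)
    = t\<^sup>2 *\<^sub>R (((1 - sin (t * norm v) / (t * norm v)) / (t * norm v)\<^sup>2) *\<^sub>R jacobi v w)"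
proof (cases "v = 0")
  case True
  then show ?thesis using x
    by (simp add: reflect_in_def dgexp_def jacobi_def)
next
  case False
  define n where "n = norm v"
  have n: "n \<noteq> 0" "v \<bullet> v = n * n" using False by (auto simp: n_def dot_square_norm power2_eq_square)
  have xx: "x \<bullet> x = 1" "v \<bullet> x = 0" "w \<bullet> x = 0" using x by (auto simp: dot_square_norm inner_commute)
  define \<theta> where "\<theta> = t * n / 2"
  define k where "k = v \<bullet> w"
  define m where "m = cos \<theta> *\<^sub>R x + (sin \<theta> / n) *\<^sub>R v"
  have m: "gexp x ((t / 2) *\<^sub>R v) = m"
    by (simp add: gexp_line m_def \<theta>_def n_def mult.commute)
  define s where "s = sin (2 * \<theta>) / (2 * \<theta>)"
  have D: "dgexp x (t *\<^sub>R v) w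
      = (k / n) *\<^sub>R ((cos (2 * \<theta>) / n) *\<^sub>R v - sin (2 * \<theta>) *\<^sub>R x) + s *\<^sub>R (w - (k / n\<^sup>2) *\<^sub>R v)"
    using t False by (simp add: dgexp_def \<theta>_def s_def k_def power2_eq_square flip: n_def)
  have mD: "m \<bullet> dgexp x (t *\<^sub>R v) w = - (k / n) * sin \<theta>"
  proof -
    have "m \<bullet> dgexp x (t *\<^sub>R v) w = (k / n) * (sin \<theta> * cos (2 * \<theta>) - cos \<theta> * sin (2 * \<theta>))"
      unfolding D m_def using n
      by (simp add: inner_diff_left inner_diff_right inner_add_left inner_add_right xx x k_def
          power2_eq_square algebra_simps diff_divide_distrib)
    also have "\<dots> = (k / n) * sin (\<theta> - 2 * \<theta>)" by (simp only: sin_diff)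
    also have "\<dots> = - (k / n) * sin \<theta>" by simp
    finally show ?thesis .
  qed
  have "reflect_in m (dgexp x (t *\<^sub>R v) w) = - ((k / n\<^sup>2) *\<^sub>R v) - s *\<^sub>R (w - (k / n\<^sup>2) *\<^sub>R v)"
  proof -
    have "(2 * (m \<bullet> dgexp x (t *\<^sub>R v) w)) *\<^sub>R m
        = (k / n) *\<^sub>R ((- (2 * sin \<theta> * cos \<theta>)) *\<^sub>R x - (2 * (sin \<theta>)\<^sup>2 / n) *\<^sub>R v)"
      unfolding mD using n by (simp add: m_def algebra_simps power2_eq_square)
    also have "\<dots> = (k / n) *\<^sub>R ((- sin (2 * \<theta>)) *\<^sub>R x - ((1 - cos (2 * \<theta>)) / n) *\<^sub>R v)"
      by (simp add: sin_double cos_double_sin)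
    finally show ?thesis
      unfolding reflect_in_def D using n by (simp add: algebra_simps power2_eq_square diff_divide_distrib)
  qed
  then have "w + reflect_in m (dgexp x (t *\<^sub>R v) w) = (1 - s) *\<^sub>R (w - (k / n\<^sup>2) *\<^sub>R v)"
    by (simp only: scaleR_diff_left scaleR_one) simp
  also have "w - (k / n\<^sup>2) *\<^sub>R v = (1 / n\<^sup>2) *\<^sub>R jacobi v w"
    using n by (simp add: jacobi_def k_def algebra_simps power2_eq_square)
  finally show ?thesis
    using t n by (simp add: m s_def \<theta>_def power_mult_distrib flip: n_def)
qed

context geodesic_chart
begin

text \<open>The reflection in a point \<open>m\<close> of the submanifold reverses the geodesics through \<open>m\<close>.  Reflecting in
  the midpoint of a geodesic from \<open>p\<close> to \<open>q\<close> therefore carries the tangent space at \<open>q\<close> to that at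
  \<open>p\<close>.  Applied to \<open>q = pexp p (t v)\<close> and to the variation \<open>dpexp p (t v) w\<close>, this gives tangent
  vectors at \<open>p\<close> which differ from \<open>- w\<close> by \<open>t\<^sup>2/6\<close> times the curvature term, up to higher order
  in \<open>t\<close>.\<close>

lemma tangent_space_jacobi:
  assumes p: "p \<in> U" and v: "v \<in> tangent_space X p" and w: "w \<in> tangent_space X p"
  shows "(jacobi (fst v) (fst w), jacobi (snd v) (snd w)) \<in> tangent_space X p"
proof -
  let ?T = "tangent_space X p"
  have sub: "subspace ?T" by (rule tangent_space_subspace[OF p])
  have ps: "p \<in> prod_sphere" and vs: "v \<in> sphere_tangent p" and ws: "w \<in> sphere_tangent p"
    using in_sphere[OF p] tangent_in_sphere_tangent v w by auto
  obtain \<delta> where \<delta>: "0 < \<delta>" "\<delta> \<le> 1"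
    and tr: "\<And>q v. q \<in> U \<Longrightarrow> dist q p < \<delta> \<Longrightarrow> v \<in> tangent_space X q \<Longrightarrow> norm v < \<delta> \<Longrightarrow>
       pexp q v \<in> U \<and> tangent_space X (pexp q v) = dpexp q v ` tangent_space X q"
    using tangent_transport[OF p] by metis
  (* h tends to 1/6 at 0, the second coefficient of the series of sin s / s up to sign *)
  define h where "h = (\<lambda>s::real. (1 - sin s / s) / s\<^sup>2)"
  define y where "y = (\<lambda>t. (h (t * norm (fst v)) *\<^sub>R jacobi (fst v) (fst w),
    h (t * norm (snd v)) *\<^sub>R jacobi (snd v) (snd w)))"
  have y: "y t \<in> ?T" if t: "t > 0" and small: "t * norm v < \<delta>" for t
  proof -
    have tv: "s *\<^sub>R v \<in> ?T" for s by (rule subspace_scale[OF sub v])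
    have tvs: "s *\<^sub>R v \<in> sphere_tangent p" for s by (rule tangent_in_sphere_tangent[OF tv])
    have n2: "norm ((t / 2) *\<^sub>R v) < \<delta>" "norm (t *\<^sub>R v) < \<delta>"
      using t small \<delta>(1) by (auto simp: field_simps)
    define m where "m = pexp p ((t / 2) *\<^sub>R v)"
    define u where "u = (t / 2) *\<^sub>R dpexp p ((t / 2) *\<^sub>R v) v"
    define q where "q = pexp p (t *\<^sub>R v)"
    have mU: "m \<in> U" and Tm: "tangent_space X m = dpexp p ((t / 2) *\<^sub>R v) ` ?T"
      using tr[OF p _ tv n2(1)] \<delta>(1) by (auto simp: m_def)
    have Tq: "tangent_space X q = dpexp p (t *\<^sub>R v) ` ?T"
      using tr[OF p _ tv n2(2)] \<delta>(1) by (auto simp: q_def)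
    have mp: "dist m p < \<delta>"
      using dist_pexp[OF ps tvs] n2(1) unfolding m_def by (rule le_less_trans)
    have uT: "u \<in> tangent_space X m"
      unfolding u_def Tm using v subspace_scale[OF linear_subspace_image[OF dpexp_linear sub]] by blast
    have nu: "norm u < \<delta>"
      using norm_dpexp_line[OF ps vs, of "t / 2"] n2(1) by (simp add: u_def)
    have "pexp m u = q"
      using pexp_shift[OF ps vs, of "t / 2" "t / 2"] by (simp add: m_def u_def q_def)
    then have Tq': "tangent_space X q = dpexp m u ` tangent_space X m"
      using tr[OF mU mp uT nu] by simp
    have "pexp m (- u) = p"
      using pexp_shift[OF ps vs, of "t / 2" "- (t / 2)"] by (simp add: m_def u_def)
    then have Tp: "?T = dpexp m (- u) ` tangent_space X m"
      using tr[OF mU mp subspace_neg[OF tangent_space_subspace[OF mU] uT]] nu by simp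
    have ms: "m \<in> prod_sphere" and us: "u \<in> sphere_tangent m"
      using in_sphere[OF mU] tangent_in_sphere_tangent[OF uT] by auto
    obtain z where z: "z \<in> tangent_space X m" "dpexp p (t *\<^sub>R v) w = dpexp m u z"
      using Tq Tq' w by blast
    have zs: "z \<in> sphere_tangent m" by (rule tangent_in_sphere_tangent[OF z(1)])
    define r where "r = (reflect_in (fst m) (dgexp (fst p) (t *\<^sub>R fst v) (fst w)),
      reflect_in (snd m) (dgexp (snd p) (t *\<^sub>R snd v) (snd w)))"
    have "r = - dpexp m (- u) z"
      using z(2) ms us zs reflect_dgexp[of "fst m" "fst u" "fst z"] reflect_dgexp[of "snd m" "snd u" "snd z"]
      by (simp add: r_def dpexp_def sphere_tangent_def mem_Times_iff)
    moreover have "dpexp m (- u) z \<in> ?T" unfolding Tp using z(1) by blast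
    ultimately have "r \<in> ?T" using subspace_neg[OF sub] by simp
    then have "w + r \<in> ?T" by (rule subspace_add[OF sub w])
    also have "w + r = t\<^sup>2 *\<^sub>R y t"
      using ps vs ws reflect_dgexp_midpoint[OF _ _ _ t, of "fst p" "fst v" "fst w"]
        reflect_dgexp_midpoint[OF _ _ _ t, of "snd p" "snd v" "snd w"]
      by (simp add: r_def m_def pexp_def y_def h_def sphere_tangent_def mem_Times_iff prod_eq_iff)
    finally have "(1 / t\<^sup>2) *\<^sub>R (t\<^sup>2 *\<^sub>R y t) \<in> ?T" by (rule subspace_scale[OF sub])
    then show ?thesis using t by simp
  qed
  have h: "((\<lambda>t. h (t * norm a) *\<^sub>R jacobi a b) \<longlongrightarrow> (1 / 6) *\<^sub>R jacobi a b) (at_right 0)"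
    for a b :: "'z::real_inner"
  proof (cases "a = 0")
    case True
    then show ?thesis by (simp add: jacobi_def)
  next
    case False
    then have "norm a > 0" by simp
    then have "filterlim (\<lambda>t. t * norm a) (at_right 0) (at_right 0)"
      by real_asymp
    moreover have "(h \<longlongrightarrow> 1 / 6) (at_right 0)"
      unfolding h_def by real_asymp
    ultimately have "((\<lambda>t. h (t * norm a)) \<longlongrightarrow> 1 / 6) (at_right 0)"
      by (rule filterlim_compose[rotated])
    then show ?thesis by (intro tendsto_intros)
  qed
  have "(y \<longlongrightarrow> ((1 / 6) *\<^sub>R jacobi (fst v) (fst w), (1 / 6) *\<^sub>R jacobi (snd v) (snd w))) (at_right 0)"
    unfolding y_def by (intro tendsto_Pair h)
  moreover have "\<forall>\<^sub>F t in at_right 0. y t \<in> ?T"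
  proof -
    have "((\<lambda>t. t * norm v) \<longlongrightarrow> 0 * norm v) (at_right 0)"
      by (intro tendsto_intros)
    then have "\<forall>\<^sub>F t in at_right 0. t * norm v < \<delta>"
      using \<delta>(1) by (intro order_tendstoD(2)) auto
    moreover have "\<forall>\<^sub>F t in at_right (0::real). t > 0" by (simp add: eventually_at_right_less)
    ultimately show ?thesis by eventually_elim (rule y)
  qed
  ultimately have "((1 / 6) *\<^sub>R jacobi (fst v) (fst w), (1 / 6) *\<^sub>R jacobi (snd v) (snd w)) \<in> ?T"
    using Lim_in_closed_set[OF closed_subspace[OF sub] _ trivial_limit_at_right_real] by blast
  then show ?thesis using subspace_scale[OF sub, of _ 6] by fastforce
qed

end

section \<open>Subspaces satisfying the curvature condition\<close>

lemma subset_of_two_independent: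
  fixes A P :: "'a::euclidean_space set"
  assumes "subspace A" "subspace P" "dim P = 2" "a \<in> A" "b \<in> A" "a \<in> P" "b \<in> P" "a \<noteq> 0" "b \<notin> span {a}"
  shows "P \<subseteq> A"
proof -
  have "dim (span {b, a}) = 2"
    using assms(8,9) by (simp add: dim_insert)
  moreover have "span {b, a} \<subseteq> P"
    using assms by (intro span_minimal) auto
  ultimately have "span {b, a} = P"
    using assms(2,3) by (intro subspace_dim_equal) auto
  moreover have "span {b, a} \<subseteq> A"
    using assms by (intro span_minimal) auto
  ultimately show ?thesis by simp
qed

lemma jacobi_notin_span:
  assumes "u \<noteq> 0" "v \<notin> span {u}"
  shows "jacobi u v \<notin> span {u}"
proof
  assume "jacobi u v \<in> span {u}"
  then have "jacobi u v + (u \<bullet> v) *\<^sub>R u \<in> span {u}"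
    by (rule span_add[OF _ span_scale[OF span_base]]) simp
  then have "(u \<bullet> u) *\<^sub>R v \<in> span {u}" by (simp add: jacobi_def)
  then show False
    using assms span_scale[of "(u \<bullet> u) *\<^sub>R v" "{u}" "1 / (u \<bullet> u)"] by simp
qed

lemma jacobi_0 [simp]: "jacobi 0 v = 0"
  by (simp add: jacobi_def)

lemma dim_fst_image:
  fixes V :: "('a::euclidean_space \<times> 'b::euclidean_space) set"
  assumes "subspace V" "\<And>w. (0, w) \<in> V \<Longrightarrow> w = 0"
  shows "dim (fst ` V) = dim V" "inj_on fst V"
proof -
  show inj: "inj_on fst V"
    using assms by (subst linear_inj_on_iff_eq_0) (auto simp: linear_fst zero_prod_def)
  show "dim (fst ` V) = dim V"
    using dim_image_eq[OF linear_fst, of V] inj assms(1) by (simp add: span_eq_iff[THEN iffD2])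
qed

lemma dim_snd_image:
  fixes V :: "('a::euclidean_space \<times> 'b::euclidean_space) set"
  assumes "subspace V" "\<And>u. (u, 0) \<in> V \<Longrightarrow> u = 0"
  shows "dim (snd ` V) = dim V"
proof -
  have inj: "inj_on snd V"
    using assms by (subst linear_inj_on_iff_eq_0) (auto simp: linear_snd zero_prod_def)
  show "dim (snd ` V) = dim V"
    using dim_image_eq[OF linear_snd, of V] inj assms(1) by (simp add: span_eq_iff[THEN iffD2])
qed

text \<open>The possible tangent spaces: a line, a product of subspaces of the two factors, or the graph
  of an isometry.  The zero space is written \<open>span {0}\<close>, so that all the factors are lines
  \<open>span {u}\<close> or hyperplanes.\<close>

inductive geodesic_tangent :: "(real^3) \<times> (real^3) \<Rightarrow> nat \<Rightarrow> ((real^3) \<times> (real^3)) set \<Rightarrow> bool" for p where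
  line: "v \<in> sphere_tangent p \<Longrightarrow> v \<noteq> 0 \<Longrightarrow> geodesic_tangent p 1 (span {v})"
| graph: "R \<in> O3 \<Longrightarrow> snd p = R *v fst p \<Longrightarrow>
    geodesic_tangent p 2 ((\<lambda>u. (u, R *v u)) ` {u. fst p \<bullet> u = 0})"
| first: "geodesic_tangent p 2 ({u. fst p \<bullet> u = 0} \<times> span {0})"
| second: "geodesic_tangent p 2 (span {0} \<times> {w. snd p \<bullet> w = 0})"
| torus: "fst p \<bullet> u = 0 \<Longrightarrow> snd p \<bullet> w = 0 \<Longrightarrow> u \<noteq> 0 \<Longrightarrow> w \<noteq> 0 \<Longrightarrow>
    geodesic_tangent p 2 (span {u} \<times> span {w})"
| first_circle: "snd p \<bullet> w = 0 \<Longrightarrow> w \<noteq> 0 \<Longrightarrow>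
    geodesic_tangent p 3 ({u. fst p \<bullet> u = 0} \<times> span {w})"
| second_circle: "fst p \<bullet> u = 0 \<Longrightarrow> u \<noteq> 0 \<Longrightarrow>
    geodesic_tangent p 3 (span {u} \<times> {w. snd p \<bullet> w = 0})"

lemma subspace_hyperplane_dim:
  fixes x :: "real^3"
  assumes "norm x = 1"
  shows "subspace {u. x \<bullet> u = 0}" "dim {u. x \<bullet> u = 0} = 2"
proof -
  show "subspace {u. x \<bullet> u = 0}" by (rule subspace_hyperplane)
  have "x \<noteq> 0" using assms by auto
  then show "dim {u. x \<bullet> u = 0} = 2" by (simp add: dim_hyperplane)
qed

locale curvature_invariant =
  fixes p :: "(real^3) \<times> (real^3)" and V :: "((real^3) \<times> (real^3)) set"
  assumes p: "p \<in> prod_sphere" and V: "subspace V" and V_tangent: "V \<subseteq> sphere_tangent p"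
    and jac: "\<And>v w. v \<in> V \<Longrightarrow> w \<in> V \<Longrightarrow> (jacobi (fst v) (fst w), jacobi (snd v) (snd w)) \<in> V"
begin

abbreviation "P \<equiv> {u. fst p \<bullet> u = 0}"
abbreviation "Q \<equiv> {w. snd p \<bullet> w = 0}"
abbreviation "K1 \<equiv> {u. (u, 0) \<in> V}"
abbreviation "K2 \<equiv> {w. (0, w) \<in> V}"

lemma P: "subspace P" "dim P = 2" and Q: "subspace Q" "dim Q = 2"
  using p subspace_hyperplane_dim[of "fst p"] subspace_hyperplane_dim[of "snd p"] by auto

lemma in_PQ: "(u, w) \<in> V \<Longrightarrow> u \<in> P \<and> w \<in> Q"
  using V_tangent by (auto simp: sphere_tangent_def)

lemma add_V: "(u, w) \<in> V \<Longrightarrow> (u', w') \<in> V \<Longrightarrow> (u + u', w + w') \<in> V"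
  and diff_V: "(u, w) \<in> V \<Longrightarrow> (u', w') \<in> V \<Longrightarrow> (u - u', w - w') \<in> V"
  and scale_V: "(u, w) \<in> V \<Longrightarrow> (c *\<^sub>R u, c *\<^sub>R w) \<in> V"
  using subspace_add[OF V, of "(u, w)" "(u', w')"] subspace_diff[OF V, of "(u, w)" "(u', w')"]
    subspace_scale[OF V, of "(u, w)" c] by auto

lemma K1: "subspace K1" and K2: "subspace K2"
  using subspace_0[OF V] add_V[of _ 0 _ 0] scale_V[of _ 0] add_V[of 0 _ 0 _] scale_V[of 0 _]
  by (auto simp: subspace_def zero_prod_def)

text \<open>If the first factor contains a direction of \<open>V\<close> and \<open>V\<close> has further first components, then
  the curvature of the first factor rotates that direction and leaves the second factor alone.\<close>

lemma P_subset_K1: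
  assumes "u \<in> K1" "u \<noteq> 0" "(v, w) \<in> V" "v \<notin> span {u}"
  shows "P \<subseteq> K1"
proof (rule subset_of_two_independent[OF K1 P assms(1)])
  show "jacobi u v \<in> K1" using jac[of "(u, 0)" "(v, w)"] assms by simp
  then show "jacobi u v \<in> P" using in_PQ by blast
  show "u \<in> P" using assms(1) in_PQ by blast
qed (use assms jacobi_notin_span in auto)

lemma Q_subset_K2:
  assumes "w \<in> K2" "w \<noteq> 0" "(u, v) \<in> V" "v \<notin> span {w}"
  shows "Q \<subseteq> K2"
proof (rule subset_of_two_independent[OF K2 Q assms(1)])
  show "jacobi w v \<in> K2" using jac[of "(0, w)" "(u, v)"] assms by simp
  then show "jacobi w v \<in> Q" using in_PQ by blast
  show "w \<in> Q" using assms(1) in_PQ by blast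
qed (use assms jacobi_notin_span in auto)

lemma V_eq_K1_times:
  assumes "P \<subseteq> K1" shows "V = P \<times> K2"
proof (intro equalityI subsetI)
  fix v assume "v \<in> V"
  then show "v \<in> P \<times> K2"
    using in_PQ[of "fst v" "snd v"] assms diff_V[of "fst v" "snd v" "fst v" 0]
    by (auto simp: mem_Times_iff)
next
  fix v assume "v \<in> P \<times> K2"
  then show "v \<in> V" using assms add_V[of "fst v" 0 0 "snd v"] by (auto simp: mem_Times_iff)
qed

lemma V_eq_times_K2:
  assumes "Q \<subseteq> K2" shows "V = K1 \<times> Q"
proof (intro equalityI subsetI)
  fix v assume "v \<in> V"
  then show "v \<in> K1 \<times> Q"
    using in_PQ[of "fst v" "snd v"] assms diff_V[of "fst v" "snd v" 0 "snd v"]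
    by (auto simp: mem_Times_iff)
next
  fix v assume "v \<in> K1 \<times> Q"
  then show "v \<in> V" using assms add_V[of "fst v" 0 0 "snd v"] by (auto simp: mem_Times_iff)
qed

lemma dim_1_span:
  fixes A :: "'z::euclidean_space set"
  assumes "subspace A" "dim A = 1"
  obtains a where "a \<in> A" "a \<noteq> 0" "A = span {a}"
proof -
  have "\<not> A \<subseteq> {0}" using assms(2) dim_eq_0[of A] by simp
  then obtain a where a: "a \<in> A" "a \<noteq> 0" by blast
  have "span {a} = A"
    using a assms span_minimal[of "{a}" A] by (intro subspace_dim_equal) auto
  then show ?thesis using that a by blast
qed

lemma geodesic_tangent_dim_1:
  assumes "dim V = 1" shows "geodesic_tangent p 1 V"
proof -
  obtain v where "v \<in> V" "v \<noteq> 0" "V = span {v}" by (rule dim_1_span[OF V assms])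
  then show ?thesis using V_tangent geodesic_tangent.line[of v p] by blast
qed

lemma geodesic_tangent_dim_3:
  assumes d: "dim V = 3" shows "geodesic_tangent p 3 V"
proof -
  have "fst ` V \<subseteq> P" "snd ` V \<subseteq> Q" using in_PQ by auto
  then have le: "dim (fst ` V) \<le> 2" "dim (snd ` V) \<le> 2"
    using dim_subset[of "fst ` V" P] dim_subset[of "snd ` V" Q] P Q by auto
  obtain u where u: "u \<in> K1" "u \<noteq> 0"
    using dim_snd_image[OF V] le(2) d by fastforce
  obtain w where w: "w \<in> K2" "w \<noteq> 0"
    using dim_fst_image(1)[OF V] le(1) d by fastforce
  have "\<not> V \<subseteq> span {u} \<times> span {w}"
    using dim_subset[of V "span {u} \<times> span {w}"] d u w by (auto simp: dim_Times)
  then obtain v1 v2 where v: "(v1, v2) \<in> V" "v1 \<notin> span {u} \<or> v2 \<notin> span {w}"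
    by (auto simp: subset_iff)
  from v(2) show ?thesis
  proof
    assume "v1 \<notin> span {u}"
    then have eq: "V = P \<times> K2" using P_subset_K1[OF u v(1)] V_eq_K1_times by blast
    then have "dim K2 = 1" using d dim_Times[OF P(1) K2] P(2) by simp
    then obtain a where a: "a \<in> K2" "a \<noteq> 0" "K2 = span {a}" by (rule dim_1_span[OF K2])
    then have "a \<in> Q" using in_PQ by blast
    then have "geodesic_tangent p 3 (P \<times> span {a})" using a(2) by (intro geodesic_tangent.first_circle) auto
    moreover have "V = P \<times> span {a}" using eq a(3) by simp
    ultimately show ?thesis by (simp only:)
  next
    assume "v2 \<notin> span {w}"
    then have eq: "V = K1 \<times> Q" using Q_subset_K2[OF w v(1)] V_eq_times_K2 by blast
    then have "dim K1 = 1" using d dim_Times[OF K1 Q(1)] Q(2) by simp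
    then obtain a where a: "a \<in> K1" "a \<noteq> 0" "K1 = span {a}" by (rule dim_1_span[OF K1])
    then have "a \<in> P" using in_PQ by blast
    then have "geodesic_tangent p 3 (span {a} \<times> Q)" using a(2) by (intro geodesic_tangent.second_circle) auto
    moreover have "V = span {a} \<times> Q" using eq a(3) by simp
    ultimately show ?thesis by (simp only:)
  qed
qed

text \<open>When neither factor contains a direction of \<open>V\<close>, it is the graph of a linear isomorphism.
  Subtracting \<open>\<bar>v\<^sub>1\<bar>\<^sup>2 w - (v\<^sub>1 \<bullet> w\<^sub>1) v\<close> from the curvature term of \<open>v\<close> and \<open>w\<close> leaves a vector of
  \<open>V\<close> in the second factor, which must vanish; so this isomorphism preserves lengths.\<close>

lemma graph_norm_eq:
  assumes d: "dim V = 2" and K: "K1 = {0}" "K2 = {0}" and v: "v \<in> V"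
  shows "norm (fst v) = norm (snd v)"
proof (cases "v = 0")
  case False
  obtain v1 v2 where v12: "v = (v1, v2)" by (cases v)
  have "\<not> V \<subseteq> span {v}" using dim_subset[of V "span {v}"] d by (auto split: if_splits)
  then obtain w where w: "w \<in> V" "w \<notin> span {v}" by blast
  obtain w1 w2 where w12: "w = (w1, w2)" by (cases w)
  define a b where "a = v2 \<bullet> v2 - v1 \<bullet> v1" and "b = v1 \<bullet> w1 - v2 \<bullet> w2"
  have j: "(jacobi v1 w1, jacobi v2 w2) \<in> V" using jac[OF v w(1)] by (simp add: v12 w12)
  have "(jacobi v1 w1 - (v1 \<bullet> v1) *\<^sub>R w1 + (v1 \<bullet> w1) *\<^sub>R v1, jacobi v2 w2 - (v1 \<bullet> v1) *\<^sub>R w2 + (v1 \<bullet> w1) *\<^sub>R v2) \<in> V"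
    using v w(1) unfolding v12 w12 by (intro add_V diff_V scale_V j)
  also have "(jacobi v1 w1 - (v1 \<bullet> v1) *\<^sub>R w1 + (v1 \<bullet> w1) *\<^sub>R v1, jacobi v2 w2 - (v1 \<bullet> v1) *\<^sub>R w2 + (v1 \<bullet> w1) *\<^sub>R v2)
      = (0, a *\<^sub>R w2 + b *\<^sub>R v2)"
    by (simp add: jacobi_def a_def b_def algebra_simps)
  finally have 0: "a *\<^sub>R w2 + b *\<^sub>R v2 = 0" using K(2) by blast
  have "(a *\<^sub>R w1 + b *\<^sub>R v1, a *\<^sub>R w2 + b *\<^sub>R v2) \<in> V"
    using v w(1) unfolding v12 w12 by (intro add_V scale_V)
  then have "a *\<^sub>R w1 + b *\<^sub>R v1 = 0" using K(1) 0 by auto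
  then have eq: "a *\<^sub>R w = - b *\<^sub>R v"
    using 0 by (simp add: v12 w12 eq_neg_iff_add_eq_0 prod_eq_iff)
  have "a = 0"
  proof (rule ccontr)
    assume "a \<noteq> 0"
    then have "w = (- b / a) *\<^sub>R v"
      using arg_cong[OF eq, of "\<lambda>z. (1 / a) *\<^sub>R z"] by simp
    then show False using w(2) span_scale[OF span_base[of v "{v}"], of "- b / a"] by simp
  qed
  then show ?thesis by (simp add: a_def v12 norm_eq)
qed simp

text \<open>The isometry from \<open>P\<close> to \<open>Q\<close> extends to an orthogonal map that sends \<open>fst p\<close> to \<open>snd p\<close>.\<close>

lemma graph_isometry:
  assumes d: "dim V = 2" and K: "K1 = {0}" "K2 = {0}"
  shows "\<exists>R\<in>O3. snd p = R *v fst p \<and> V = (\<lambda>u. (u, R *v u)) ` P"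
proof -
  define x y where "x = fst p" and "y = snd p"
  have xy: "x \<bullet> x = 1" "y \<bullet> y = 1"
    using p by (auto simp: x_def y_def dot_square_norm mem_Times_iff)
  have sub: "fst ` V \<subseteq> P" using in_PQ by auto
  have df: "dim (fst ` V) = dim V" "inj_on fst V"
    using dim_fst_image[OF V] K(2) by auto
  have fst_V: "fst ` V = P"
    using sub df d P by (intro subspace_dim_equal linear_subspace_image[OF linear_fst V]) auto
  obtain h where h: "linear h" "\<And>v. v \<in> V \<Longrightarrow> h (fst v) = v"
    using linear_exists_left_inverse_on[OF linear_fst V df(2)] by blast
  have hP: "h u \<in> V \<and> fst (h u) = u" if "u \<in> P" for u
    using that h(2) unfolding fst_V[symmetric] by auto
  define f where "f z = (x \<bullet> z) *\<^sub>R y + snd (h (z - (x \<bullet> z) *\<^sub>R x))" for z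
  have "linear f"
    unfolding f_def
    by (rule linearI)
      (simp_all add: linear_add[OF h(1)] linear_diff[OF h(1)] linear_scale[OF h(1)] inner_add_right algebra_simps)
  moreover have "norm (f z) = norm z" for z
  proof -
    define u where "u = z - (x \<bullet> z) *\<^sub>R x"
    have xu: "x \<bullet> u = 0" using xy by (simp add: u_def inner_diff_right)
    then have hu: "h u \<in> V" "fst (h u) = u" using hP[of u] by (auto simp: x_def)
    then have "(u, snd (h u)) \<in> V" by (metis prod.collapse)
    then have yu: "y \<bullet> snd (h u) = 0" using in_PQ by (auto simp: y_def)
    have "norm u = norm (snd (h u))" using graph_norm_eq[OF d K hu(1)] hu(2) by simp
    then have n: "snd (h u) \<bullet> snd (h u) = u \<bullet> u" by (simp add: norm_eq)
    have "f z \<bullet> f z = (x \<bullet> z) * (x \<bullet> z) + u \<bullet> u"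
      using xy yu n by (simp add: f_def flip: u_def) (simp add: inner_add_left inner_add_right inner_commute)
    also have "\<dots> = ((x \<bullet> z) *\<^sub>R x + u) \<bullet> ((x \<bullet> z) *\<^sub>R x + u)"
      using xy xu by (simp add: inner_add_left inner_add_right inner_commute)
    also have "(x \<bullet> z) *\<^sub>R x + u = z" by (simp add: u_def)
    finally show ?thesis by (simp add: norm_eq)
  qed
  ultimately have ot: "orthogonal_transformation f" by (simp add: orthogonal_transformation)
  define R where "R = matrix f"
  have R: "R *v z = f z" for z
    using \<open>linear f\<close> by (simp add: R_def matrix_works linear_matrix_vector_mul_eq)
  have "R \<in> O3" using ot by (simp add: O3_def R_def orthogonal_transformation_matrix)
  moreover have "snd p = R *v fst p"
    using xy linear_0[OF h(1)] by (simp add: R f_def flip: x_def y_def)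
  moreover have "(\<lambda>u. (u, R *v u)) ` P = V"
  proof -
    have Rh: "(u, R *v u) = h u" if "u \<in> P" for u
      using that hP[OF that] by (simp add: R f_def prod_eq_iff flip: x_def)
    have "(\<lambda>u. (u, R *v u)) ` P = h ` P" using Rh by (intro image_cong) auto
    also have "\<dots> = (\<lambda>v. h (fst v)) ` V" unfolding fst_V[symmetric] by (simp add: image_image)
    also have "\<dots> = V" using h(2) by (simp cong: image_cong)
    finally show ?thesis .
  qed
  ultimately show ?thesis by blast
qed

lemma geodesic_tangent_dim_2:
  assumes d: "dim V = 2" shows "geodesic_tangent p 2 V"
proof -
  have sub: "fst ` V \<subseteq> P" "snd ` V \<subseteq> Q" using in_PQ by auto
  have zero: "A = span {0}" if "A = {0}" for A :: "(real^3) set" using that by simp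
  have proper: "\<exists>v\<in>A. v \<notin> span {u}" if "dim A = 2" for A and u :: "real^3"
  proof (rule ccontr)
    assume "\<not> ?thesis"
    then have "A \<subseteq> span {u}" by blast
    then show False using dim_subset[of A "span {u}"] that by (auto split: if_splits)
  qed
  consider "K1 = {0}" "K2 = {0}" | u where "K2 = {0}" "u \<in> K1" "u \<noteq> 0"
    | w where "K1 = {0}" "w \<in> K2" "w \<noteq> 0" | u w where "u \<in> K1" "u \<noteq> 0" "w \<in> K2" "w \<noteq> 0"
    using subspace_0[OF K1] subspace_0[OF K2] by blast
  then show ?thesis
  proof cases
    case 1
    then obtain R where R: "R \<in> O3" "snd p = R *v fst p" "V = (\<lambda>u. (u, R *v u)) ` P"
      using graph_isometry[OF d] by blast
    show ?thesis unfolding R(3) by (rule geodesic_tangent.graph[OF R(1,2)])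
  next
    case (2 u)
    then have "dim (fst ` V) = 2" using dim_fst_image(1)[OF V] d by auto
    then obtain v where "v \<in> V" "fst v \<notin> span {u}" using proper by blast
    then have "V = P \<times> K2" using P_subset_K1[OF 2(2,3), of "fst v" "snd v"] V_eq_K1_times by simp
    then have "V = P \<times> span {0}" unfolding zero[OF 2(1)] .
    then show ?thesis using geodesic_tangent.first[of p] by (simp only:)
  next
    case (3 w)
    then have "dim (snd ` V) = 2" using dim_snd_image[OF V] d by auto
    then obtain v where "v \<in> V" "snd v \<notin> span {w}" using proper by blast
    then have "V = K1 \<times> Q" using Q_subset_K2[OF 3(2,3), of "fst v" "snd v"] V_eq_times_K2 by simp
    then have "V = span {0} \<times> Q" unfolding zero[OF 3(1)] .
    then show ?thesis using geodesic_tangent.second[of p] by (simp only:)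
  next
    case (4 u w)
    have "span {u} \<times> span {w} \<subseteq> V"
    proof
      fix z assume "z \<in> span {u} \<times> span {w}"
      then obtain s t where "z = (s *\<^sub>R u, t *\<^sub>R w)" by (auto simp: span_singleton)
      then show "z \<in> V"
        using add_V[of "s *\<^sub>R u" 0 0 "t *\<^sub>R w"] scale_V[of u 0 s] scale_V[of 0 w t] 4 by simp
    qed
    then have "span {u} \<times> span {w} = V"
      using d V 4 by (intro subspace_dim_equal subspace_Times subspace_span) (auto simp: dim_Times)
    moreover have "u \<in> P" "w \<in> Q" using 4 in_PQ by blast+
    ultimately show ?thesis
      using 4 geodesic_tangent.torus[of p u w] by auto
  qed
qed

end

section \<open>Exponential images of the tangent spaces\<close>

text \<open>Every point of the sphere is on a great circle through \<open>x\<close>.  For \<open>- x\<close> its direction is arbitrary,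
  and one exists only in dimension at least two.\<close>

lemma gexp_hyperplane_image:
  fixes x :: "'a::euclidean_space"
  assumes x: "norm x = 1" and "2 \<le> DIM('a)"
  shows "gexp x ` {u. x \<bullet> u = 0} = sphere 0 1"
proof (intro equalityI subsetI)
  fix y assume "y \<in> gexp x ` {u. x \<bullet> u = 0}"
  then show "y \<in> sphere 0 1" using norm_gexp[OF x] by auto
next
  fix y :: 'a assume y: "y \<in> sphere 0 1"
  have xx: "x \<bullet> x = 1" "y \<bullet> y = 1" using x y by (auto simp: dot_square_norm)
  define w where "w = y - (x \<bullet> y) *\<^sub>R x"
  have xw: "x \<bullet> w = 0" using xx by (simp add: w_def inner_diff_right)
  have ww: "w \<bullet> w = 1 - (x \<bullet> y)\<^sup>2"
    using xx by (simp add: w_def inner_diff_left inner_diff_right inner_commute power2_eq_square)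
  obtain e where e: "norm e = 1" "x \<bullet> e = 0" "w = norm w *\<^sub>R e"
  proof (cases "w = 0")
    case True
    obtain e where "e \<noteq> 0" "orthogonal x e" using orthogonal_to_vector_exists[OF assms(2)] by blast
    then show ?thesis using True by (intro that[of "(1 / norm e) *\<^sub>R e"]) (auto simp: orthogonal_def)
  next
    case False
    then show ?thesis using xw by (intro that[of "(1 / norm w) *\<^sub>R w"]) auto
  qed
  define \<theta> where "\<theta> = arccos (x \<bullet> y)"
  have c: "\<bar>x \<bullet> y\<bar> \<le> 1" using Cauchy_Schwarz_ineq2[of x y] x y by simp
  then have \<theta>: "0 \<le> \<theta>" "cos \<theta> = x \<bullet> y" "sin \<theta> = norm w"
    using arccos_lbound[of "x \<bullet> y"] ww
    by (auto simp: \<theta>_def cos_arccos_abs sin_arccos_abs norm_eq_sqrt_inner)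
  have "gexp x (\<theta> *\<^sub>R e) = cos \<theta> *\<^sub>R x + sin \<theta> *\<^sub>R e"
    using e(1) by (simp add: gexp_line)
  also have "\<dots> = y" using e(3) by (simp add: \<theta> w_def)
  finally show "y \<in> gexp x ` {u. x \<bullet> u = 0}"
    using e(2) by (intro image_eqI[of _ _ "\<theta> *\<^sub>R e"]) auto
qed

lemma dgexp_orthogonal:
  assumes x: "norm x = 1" "x \<bullet> v = 0" "x \<bullet> w = 0"
  shows "gexp x v \<bullet> dgexp x v w = 0"
  using sphere_curve_velocity[OF _ _ _ dgexp_deriv[of x v w], of UNIV] norm_gexp[OF x(1)] x
  by (simp add: inner_add_right)

lemma dgexp_hyperplane_image:
  fixes x :: "'a::euclidean_space"
  assumes x: "norm x = 1" "x \<bullet> v = 0" "norm v < pi"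
  shows "dgexp x v ` {w. x \<bullet> w = 0} = {w. gexp x v \<bullet> w = 0}"
proof (rule subspace_dim_equal)
  let ?P = "{w. x \<bullet> w = 0}"
  have sub: "subspace ?P" by (rule subspace_hyperplane)
  show "subspace (dgexp x v ` ?P)" by (rule linear_subspace_image[OF dgexp_linear sub])
  show "subspace {w. gexp x v \<bullet> w = 0}" by (rule subspace_hyperplane)
  show "dgexp x v ` ?P \<subseteq> {w. gexp x v \<bullet> w = 0}" using dgexp_orthogonal[OF x(1,2)] by auto
  have "inj_on (dgexp x v) ?P"
    using dgexp_eq_0[OF x(1,2) _ x(3)] by (subst linear_inj_on_iff_eq_0[OF dgexp_linear sub]) auto
  then have "dim (dgexp x v ` ?P) = dim ?P"
    using dim_image_eq[OF dgexp_linear, of x v ?P] sub by (simp add: span_eq_iff[THEN iffD2])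
  moreover have "x \<noteq> 0" "gexp x v \<noteq> 0" using x(1) norm_gexp[OF x(1,2)] by auto
  ultimately show "dim {w. gexp x v \<bullet> w = 0} \<le> dim (dgexp x v ` ?P)"
    by (simp add: dim_hyperplane)
qed

lemma gexp_span_shift:
  assumes "norm x = 1" "x \<bullet> u = 0" "a \<in> span {u}"
  shows "gexp (gexp x a) ` dgexp x a ` span {u} = gexp x ` span {u}"
proof -
  obtain s where s: "a = s *\<^sub>R u" using assms(3) by (auto simp: span_singleton)
  have "gexp (gexp x a) ` dgexp x a ` span {u} = range (\<lambda>t. gexp x ((s + t) *\<^sub>R u))"
    unfolding span_singleton s
    by (simp add: image_image linear_scale[OF dgexp_linear] gexp_shift[OF assms(1,2)] flip: gvel_eq_dgexp)
  also have "\<dots> = (\<lambda>t. gexp x (t *\<^sub>R u)) ` range (\<lambda>t. s + t)" by (simp only: image_image)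
  also have "range (\<lambda>t. s + t) = UNIV" by (rule surj_plus)
  finally show ?thesis by (simp add: span_singleton image_image)
qed

lemma pexp_span_shift:
  assumes p: "p \<in> prod_sphere" "v \<in> sphere_tangent p" "a \<in> span {v}"
  shows "pexp (pexp p a) ` dpexp p a ` span {v} = pexp p ` span {v}"
proof -
  obtain s where s: "a = s *\<^sub>R v" using p(3) by (auto simp: span_singleton)
  have "pexp (pexp p a) ` dpexp p a ` span {v} = range (\<lambda>t. pexp p ((s + t) *\<^sub>R v))"
    unfolding span_singleton s
    by (simp add: image_image linear_scale[OF dpexp_linear] pexp_shift[OF p(1,2)])
  also have "\<dots> = (\<lambda>t. pexp p (t *\<^sub>R v)) ` range (\<lambda>t. s + t)" by (simp only: image_image)
  also have "range (\<lambda>t. s + t) = UNIV" by (rule surj_plus)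
  finally show ?thesis by (simp add: span_singleton image_image)
qed

lemma pexp_Times: "pexp p ` (A \<times> B) = (gexp (fst p) ` A) \<times> (gexp (snd p) ` B)"
  by (force simp: pexp_def image_iff)

lemma dpexp_Times: "dpexp p v ` (A \<times> B) = (dgexp (fst p) (fst v) ` A) \<times> (dgexp (snd p) (snd v) ` B)"
  by (force simp: dpexp_def image_iff)

lemma norm_O3: "R \<in> O3 \<Longrightarrow> norm (R *v z) = norm z"
  and inner_O3: "R \<in> O3 \<Longrightarrow> (R *v z) \<bullet> (R *v z') = z \<bullet> z'"
  using orthogonal_transformation_matrix[of "(*v) R"]
  by (auto simp: O3_def orthogonal_transformation_norm orthogonal_transformation_def)

lemma gexp_orthogonal:
  assumes R: "R \<in> O3"
  shows "gexp (R *v x) (R *v v) = R *v gexp x v"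
    and "dgexp (R *v x) (R *v v) (R *v w) = R *v dgexp x v w"
proof -
  have lin: "linear ((*v) R)" by simp
  have z: "R *v z = 0 \<longleftrightarrow> z = 0" for z using norm_O3[OF R, of z] by (metis norm_eq_zero)
  show "gexp (R *v x) (R *v v) = R *v gexp x v"
    by (simp add: gexp_def norm_O3[OF R] linear_add[OF lin] linear_scale[OF lin])
  show "dgexp (R *v x) (R *v v) (R *v w) = R *v dgexp x v w"
    by (simp add: dgexp_def norm_O3[OF R] inner_O3[OF R] z linear_add[OF lin] linear_diff[OF lin]
        linear_scale[OF lin])
qed

lemma pexp_graph:
  assumes "R \<in> O3" "snd p = R *v fst p" "norm (fst p) = 1"
  shows "pexp p ` (\<lambda>u. (u, R *v u)) ` {u. fst p \<bullet> u = 0} = {(z, R *v z) |z. z \<in> sphere 0 1}"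
proof -
  have "pexp p ` (\<lambda>u. (u, R *v u)) ` {u. fst p \<bullet> u = 0} = (\<lambda>z. (z, R *v z)) ` gexp (fst p) ` {u. fst p \<bullet> u = 0}"
    by (simp add: image_image pexp_def assms(2) gexp_orthogonal[OF assms(1)])
  then show ?thesis using assms(3) by (auto simp: gexp_hyperplane_image)
qed

text \<open>For each of the possible tangent spaces the exponential image does not change when the base
  point moves within it and the tangent space is transported by the differential of the exponential
  map.\<close>

lemma geodesic_tangent_shift:
  assumes V: "geodesic_tangent p k V" and p: "p \<in> prod_sphere" and v: "v \<in> V" "v \<in> sphere_tangent p"
    and n: "norm v < pi"
  shows "pexp (pexp p v) ` dpexp p v ` V = pexp p ` V"
proof -
  let ?P = "{u. fst p \<bullet> u = 0}" and ?Q = "{w. snd p \<bullet> w = 0}"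
  have p1: "norm (fst p) = 1" "norm (snd p) = 1" using p by (auto simp: mem_Times_iff)
  have v1: "fst p \<bullet> fst v = 0" "snd p \<bullet> snd v = 0" using v by (auto simp: sphere_tangent_def)
  have n1: "norm (fst v) < pi" "norm (snd v) < pi"
    using n norm_fst_le[of "fst v" "snd v"] norm_snd_le[of "snd v" "fst v"] by auto
  have q1: "norm (gexp (fst p) (fst v)) = 1" "norm (gexp (snd p) (snd v)) = 1"
    using norm_gexp p1 v1 by auto
  have P: "gexp (gexp (fst p) (fst v)) ` dgexp (fst p) (fst v) ` ?P = gexp (fst p) ` ?P"
    unfolding dgexp_hyperplane_image[OF p1(1) v1(1) n1(1)]
    using gexp_hyperplane_image[OF q1(1)] gexp_hyperplane_image[OF p1(1)] by simp
  have Q: "gexp (gexp (snd p) (snd v)) ` dgexp (snd p) (snd v) ` ?Q = gexp (snd p) ` ?Q"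
    unfolding dgexp_hyperplane_image[OF p1(2) v1(2) n1(2)]
    using gexp_hyperplane_image[OF q1(2)] gexp_hyperplane_image[OF p1(2)] by simp
  have times_case: ?thesis
    if "V = A \<times> B" "A = ?P \<or> (\<exists>u\<in>?P. A = span {u})" "B = ?Q \<or> (\<exists>w\<in>?Q. B = span {w})" for A B
  proof -
    have AB: "fst v \<in> A" "snd v \<in> B" using v(1) that(1) by auto
    have "gexp (gexp (fst p) (fst v)) ` dgexp (fst p) (fst v) ` A = gexp (fst p) ` A"
      using that(2)
    proof
      assume "\<exists>u\<in>?P. A = span {u}"
      then obtain u where "fst p \<bullet> u = 0" "A = span {u}" by blast
      then show ?thesis using gexp_span_shift[OF p1(1)] AB(1) by simp
    qed (use P in simp)
    moreover have "gexp (gexp (snd p) (snd v)) ` dgexp (snd p) (snd v) ` B = gexp (snd p) ` B"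
      using that(3)
    proof
      assume "\<exists>w\<in>?Q. B = span {w}"
      then obtain w where "snd p \<bullet> w = 0" "B = span {w}" by blast
      then show ?thesis using gexp_span_shift[OF p1(2)] AB(2) by simp
    qed (use Q in simp)
    ultimately show ?thesis
      unfolding that(1) dpexp_Times pexp_Times by (simp add: pexp_def)
  qed
  show ?thesis
    using V
  proof (cases rule: geodesic_tangent.cases)
    case (line u)
    then show ?thesis using pexp_span_shift[OF p line(3)] v(1) by simp
  next
    case (graph R)
    have v': "v = (fst v, R *v fst v)" using v(1) graph(2) by auto
    have "dpexp p v ` V = (\<lambda>u. (u, R *v u)) ` dgexp (fst p) (fst v) ` ?P"
    proof -
      have "dpexp p v (u, R *v u) = (dgexp (fst p) (fst v) u, R *v dgexp (fst p) (fst v) u)" for u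
        using v' gexp_orthogonal(2)[OF graph(3), of "fst p" "fst v" u] graph(4)
        by (simp add: dpexp_def) (metis snd_conv)
      then show ?thesis unfolding graph(2) by (simp add: image_image)
    qed
    also have "\<dots> = (\<lambda>u. (u, R *v u)) ` {u. fst (pexp p v) \<bullet> u = 0}"
      unfolding dgexp_hyperplane_image[OF p1(1) v1(1) n1(1)] by (simp add: pexp_def)
    finally have im: "dpexp p v ` V = (\<lambda>u. (u, R *v u)) ` {u. fst (pexp p v) \<bullet> u = 0}" .
    have "snd (pexp p v) = R *v fst (pexp p v)"
      using v' gexp_orthogonal(1)[OF graph(3), of "fst p" "fst v"] graph(4)
      by (simp add: pexp_def) (metis snd_conv)
    then have "pexp (pexp p v) ` dpexp p v ` V = {(z, R *v z) |z. z \<in> sphere 0 1}"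
      unfolding im using q1(1) by (intro pexp_graph[OF graph(3)]) (auto simp: pexp_def)
    also have "\<dots> = pexp p ` V"
      unfolding graph(2) by (rule pexp_graph[OF graph(3,4) p1(1), symmetric])
    finally show ?thesis .
  next
    case (torus u w)
    then show ?thesis by (intro times_case[of "span {u}" "span {w}"]) auto
  qed (rule times_case, assumption, fastforce, fastforce)+
qed

section \<open>Connected geodesic submanifolds\<close>

lemma geodesic_chart_exists:
  fixes X :: "('a::euclidean_space \<times> 'b::euclidean_space) topology"
  assumes X: "geodesic_submanifold prod_sphere k X" and p: "p \<in> topspace X"
  obtains U W W' \<Phi> \<Psi> S where "geodesic_chart X U W W' \<Phi> \<Psi> S k" "p \<in> U"
proof -
  have "immersed_submanifold k X" using X by (simp add: geodesic_submanifold_def)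
  then obtain U W W' \<Phi> \<Psi> S where "slice_chart X U W W' \<Phi> \<Psi> S" "p \<in> U" "dim S = k"
    using immersed_submanifold_chart p by blast
  then show ?thesis
    using X that unfolding geodesic_chart_def geodesic_chart_axioms_def by blast
qed

context
  fixes X :: "((real^3) \<times> (real^3)) topology" and k :: nat
  assumes X: "geodesic_submanifold prod_sphere k X" and k: "k \<in> {1, 2, 3}"
begin

lemma tangent_space_classification:
  assumes p: "p \<in> topspace X"
  shows "geodesic_tangent p k (tangent_space X p)"
proof -
  obtain U W W' \<Phi> \<Psi> S where "geodesic_chart X U W W' \<Phi> \<Psi> S k" and pU: "p \<in> U"
    using geodesic_chart_exists[OF X p] by metis
  then interpret geodesic_chart X U W W' \<Phi> \<Psi> S k by simp
  interpret curvature_invariant p "tangent_space X p"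
    by unfold_locales (auto intro: in_sphere[OF pU] tangent_space_subspace[OF pU]
        tangent_in_sphere_tangent tangent_space_jacobi[OF pU] simp del: mem_Times_iff)
  have "dim (tangent_space X p) = k" using tangent_space_dim[OF pU] dim_S by simp
  then show ?thesis using k geodesic_tangent_dim_1 geodesic_tangent_dim_2 geodesic_tangent_dim_3 by auto
qed

text \<open>A point \<open>q\<close> near \<open>p\<close> is \<open>pexp p v\<close> with \<open>v\<close> short, and its tangent space is the transported one, so
  \<open>geodesic_tangent_shift\<close> applies.\<close>

lemma exp_image_locally_constant:
  assumes p: "p \<in> topspace X"
  obtains N where "openin X N" "p \<in> N" "N \<subseteq> pexp p ` tangent_space X p"
    "\<And>q. q \<in> N \<Longrightarrow> pexp q ` tangent_space X q = pexp p ` tangent_space X p"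
proof -
  obtain U W W' \<Phi> \<Psi> S where "geodesic_chart X U W W' \<Phi> \<Psi> S k" and pU: "p \<in> U"
    using geodesic_chart_exists[OF X p] by metis
  then interpret geodesic_chart X U W W' \<Phi> \<Psi> S k by simp
  obtain \<delta> where \<delta>: "0 < \<delta>" "\<delta> \<le> 1"
    and tr: "\<And>q v. q \<in> U \<Longrightarrow> dist q p < \<delta> \<Longrightarrow> v \<in> tangent_space X q \<Longrightarrow> norm v < \<delta> \<Longrightarrow>
       pexp q v \<in> U \<and> tangent_space X (pexp q v) = dpexp q v ` tangent_space X q"
    using tangent_transport[OF pU] by metis
  obtain N where N: "openin X N" "p \<in> N" "N \<subseteq> pexp p ` (tangent_space X p \<inter> ball 0 \<delta>)"
    using local_exp_image[OF pU \<delta>(1)] by metis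
  show ?thesis
  proof (rule that[OF N(1,2)])
    show "N \<subseteq> pexp p ` tangent_space X p" using N(3) by blast
    fix q assume "q \<in> N"
    then obtain v where v: "v \<in> tangent_space X p" "norm v < \<delta>" "q = pexp p v" using N(3) by auto
    then have "tangent_space X q = dpexp p v ` tangent_space X p"
      using tr[OF pU _ v(1,2)] \<delta>(1) by simp
    then show "pexp q ` tangent_space X q = pexp p ` tangent_space X p"
      using geodesic_tangent_shift[OF tangent_space_classification[OF p] in_sphere[OF pU] v(1)
          tangent_in_sphere_tangent[OF v(1)]] v(2,3) \<delta>(2) pi_gt3 by simp
  qed
qed

lemma connected_subset_exp_image:
  assumes conn: "connected_space X" and p: "p \<in> topspace X"
  shows "topspace X \<subseteq> pexp p ` tangent_space X p"
proof -
  define E where "E q = pexp q ` tangent_space X q" for q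
  have E: "\<exists>N. openin X N \<and> q \<in> N \<and> (\<forall>r\<in>N. E r = E q)" if "q \<in> topspace X" for q
    using exp_image_locally_constant[OF that] unfolding E_def by metis
  define A where "A = {q \<in> topspace X. E q = E p}"
  define B where "B = {q \<in> topspace X. E q \<noteq> E p}"
  have "openin X A"
  proof (subst openin_subopen, intro ballI)
    fix q assume q: "q \<in> A"
    then obtain N where N: "openin X N" "q \<in> N" "\<And>r. r \<in> N \<Longrightarrow> E r = E q"
      using E[of q] by (auto simp: A_def)
    have "r \<in> A" if "r \<in> N" for r
      using q N(3)[OF that] openin_subset[OF N(1)] that by (auto simp: A_def)
    then have "N \<subseteq> A" by blast
    then show "\<exists>T. openin X T \<and> q \<in> T \<and> T \<subseteq> A" using N by blast
  qed
  moreover have "openin X B"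
  proof (subst openin_subopen, intro ballI)
    fix q assume q: "q \<in> B"
    then obtain N where N: "openin X N" "q \<in> N" "\<And>r. r \<in> N \<Longrightarrow> E r = E q"
      using E[of q] by (auto simp: B_def)
    have "r \<in> B" if "r \<in> N" for r
      using q N(3)[OF that] openin_subset[OF N(1)] that by (auto simp: B_def)
    then have "N \<subseteq> B" by blast
    then show "\<exists>T. openin X T \<and> q \<in> T \<and> T \<subseteq> B" using N by blast
  qed
  moreover have "p \<in> A" using p by (simp add: A_def)
  moreover have "topspace X \<subseteq> A \<union> B" "A \<inter> B = {}" by (auto simp: A_def B_def)
  ultimately have "B = {}" using connected_spaceD[OF conn, of A B] by blast
  then have "q \<notin> B" for q by simp
  then have EB: "E q = E p" if "q \<in> topspace X" for q using that by (simp add: B_def)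
  show ?thesis
  proof
    fix q assume q: "q \<in> topspace X"
    obtain N where "q \<in> N" "N \<subseteq> E q"
      using exp_image_locally_constant[OF q] unfolding E_def by metis
    then have "q \<in> E q" by (rule subsetD[rotated])
    then show "q \<in> pexp p ` tangent_space X p" using EB[OF q] by (simp only: E_def)
  qed
qed

text \<open>In a complete submanifold the geodesic with velocity \<open>v\<close> stays in it up to time one, when it is at \<open>pexp p v\<close>.\<close>

lemma complete_exp_image_subset:
  assumes compl: "geodesically_complete prod_sphere X" and p: "p \<in> topspace X"
  shows "pexp p ` tangent_space X p \<subseteq> topspace X"
proof
  fix q assume "q \<in> pexp p ` tangent_space X p"
  then obtain v where v: "v \<in> tangent_space X p" "q = pexp p v" by blast
  obtain c where c: "geodesic_on prod_sphere UNIV c" "c 0 = p" "(c has_vector_derivative v) (at 0)"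
    "continuous_map euclideanreal X c"
    using compl p v(1) unfolding geodesically_complete_def by blast
  have "geodesic_on prod_sphere {-2<..<2} c"
    using c(1) smooth_on_subset[of UNIV c] unfolding geodesic_on_def by auto
  then have "c 1 = q" using geodesic_on_eq_pexp[OF _ _ c(2,3), of 2 1] v(2) by simp
  then show "q \<in> topspace X" using continuous_map_image_subset_topspace[OF c(4)] by auto
qed

end

section \<open>Constructing embedded submanifolds\<close>

definition has_slice_chart :: "nat \<Rightarrow> 'a::euclidean_space set \<Rightarrow> 'a \<Rightarrow> bool" where
  "has_slice_chart k U p \<longleftrightarrow>
     (\<exists>W W' \<Phi> \<Psi> S. open W \<and> p \<in> W \<and> open W' \<and> homeomorphism W W' \<Phi> \<Psi> \<and> smooth_on W \<Phi> \<and>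
        smooth_on W' \<Psi> \<and> subspace S \<and> dim S = k \<and> \<Phi> ` (U \<inter> W) = W' \<inter> (S :: 'a set))"

lemma embedded_submanifold_iff: "embedded_submanifold k U \<longleftrightarrow> (\<forall>p\<in>U. has_slice_chart k U p)"
  unfolding embedded_submanifold_def has_slice_chart_def ..

lemma has_slice_chartI:
  fixes U W W' S :: "'a::euclidean_space set"
  assumes "open W" "p \<in> W" "open W'" "homeomorphism W W' \<Phi> \<Psi>" "smooth_on W \<Phi>" "smooth_on W' \<Psi>"
    "subspace S" "dim S = k" "\<Phi> ` (U \<inter> W) = W' \<inter> S"
  shows "has_slice_chart k U p"
  unfolding has_slice_chart_def
  by (rule exI[of _ W], rule exI[of _ W'], rule exI[of _ \<Phi>], rule exI[of _ \<Psi>], rule exI[of _ S])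
    (intro conjI assms)

lemma has_slice_chartE:
  fixes U :: "'a::euclidean_space set"
  assumes "embedded_submanifold k U" "p \<in> U"
  obtains W W' \<Phi> \<Psi> and S :: "'a set" where "open W" "p \<in> W" "open W'" "homeomorphism W W' \<Phi> \<Psi>"
    "smooth_on W \<Phi>" "smooth_on W' \<Psi>" "subspace S" "dim S = k" "\<Phi> ` (U \<inter> W) = W' \<inter> S"
  using bspec[OF assms(1)[unfolded embedded_submanifold_def] assms(2)] that by blast

lemma embedded_submanifold_diffeo_image:
  fixes U :: "'a::euclidean_space set" and F G :: "'a \<Rightarrow> 'a"
  assumes U: "embedded_submanifold k U"
    and Q: "open Q" "open Q'" "homeomorphism Q Q' F G" "smooth_on Q F" "smooth_on Q' G"
  shows "embedded_submanifold k (F ` (U \<inter> Q))"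
  unfolding embedded_submanifold_iff
proof
  fix q assume "q \<in> F ` (U \<inter> Q)"
  then obtain p where p: "p \<in> U" "p \<in> Q" "q = F p" by blast
  obtain W W' \<Phi> \<Psi> and S :: "'a set" where ch: "open W" "p \<in> W" "open W'" "homeomorphism W W' \<Phi> \<Psi>"
    "smooth_on W \<Phi>" "smooth_on W' \<Psi>" "subspace S" "dim S = k" "\<Phi> ` (U \<inter> W) = W' \<inter> S"
    by (rule has_slice_chartE[OF U p(1)])
  have h: "\<And>x. x \<in> W \<Longrightarrow> \<Psi> (\<Phi> x) = x \<and> \<Phi> x \<in> W'" "\<And>y. y \<in> W' \<Longrightarrow> \<Phi> (\<Psi> y) = y \<and> \<Psi> y \<in> W"
    using ch(4) by (auto simp: homeomorphism_def)
  have g: "\<And>x. x \<in> Q \<Longrightarrow> G (F x) = x \<and> F x \<in> Q'" "\<And>y. y \<in> Q' \<Longrightarrow> F (G y) = y \<and> G y \<in> Q"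
    using Q(3) by (auto simp: homeomorphism_def)
  let ?Y = "Q' \<inter> G -` W" and ?Y' = "W' \<inter> \<Psi> -` Q"
  let ?\<Phi> = "\<lambda>z. \<Phi> (G z)" and ?\<Psi> = "\<lambda>z. F (\<Psi> z)"
  have open': "open ?Y" "open ?Y'"
    using continuous_open_preimage[OF smooth_on_continuous[OF Q(5)] Q(2) ch(1)]
      continuous_open_preimage[OF smooth_on_continuous[OF ch(6)] ch(3) Q(1)] by auto
  have sm: "smooth_on ?Y ?\<Phi>" "smooth_on ?Y' ?\<Psi>"
    by (rule smooth_on_compose[OF open'(1) ch(1) _ ch(5) smooth_on_subset[OF Q(5)]], auto)
      (rule smooth_on_compose[OF open'(2) Q(1) _ Q(4) smooth_on_subset[OF ch(6)]], auto)
  have "homeomorphism ?Y ?Y' ?\<Phi> ?\<Psi>"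
    by (rule homeomorphismI[OF smooth_on_continuous[OF sm(1)] smooth_on_continuous[OF sm(2)]])
      (use h g in auto)
  moreover have "?\<Phi> ` (F ` (U \<inter> Q) \<inter> ?Y) = ?Y' \<inter> S"
  proof (intro equalityI subsetI)
    fix y assume "y \<in> ?\<Phi> ` (F ` (U \<inter> Q) \<inter> ?Y)"
    then obtain u where u: "u \<in> U" "u \<in> Q" "G (F u) \<in> W" "y = \<Phi> (G (F u))" by auto
    then have "G (F u) = u" using g by auto
    then show "y \<in> ?Y' \<inter> S" using u ch(9) h by auto
  next
    fix y assume y: "y \<in> ?Y' \<inter> S"
    then have "y \<in> \<Phi> ` (U \<inter> W)" using ch(9) by blast
    then obtain u where u: "u \<in> U" "u \<in> W" "y = \<Phi> u" by auto
    moreover have "u \<in> Q" using u y h by auto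
    ultimately have "G (F u) = u" "F u \<in> Q'" "u \<in> Q" using g by auto
    then show "y \<in> ?\<Phi> ` (F ` (U \<inter> Q) \<inter> ?Y)" using u by (intro image_eqI[of _ _ "F u"]) auto
  qed
  moreover have "q \<in> ?Y" using p ch(2) g by auto
  ultimately show "has_slice_chart k (F ` (U \<inter> Q)) q"
    by (intro has_slice_chartI[OF open'(1) _ open'(2) _ sm ch(7,8)])
qed

lemma embedded_submanifold_Times:
  fixes A :: "'a::euclidean_space set" and B :: "'b::euclidean_space set"
  assumes A: "embedded_submanifold j A" and B: "embedded_submanifold k B"
  shows "embedded_submanifold (j + k) (A \<times> B)"
  unfolding embedded_submanifold_iff
proof
  fix p assume "p \<in> A \<times> B"
  then have p: "fst p \<in> A" "snd p \<in> B" by auto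
  obtain W W' \<Phi> \<Psi> and S :: "'a set" where c1: "open W" "fst p \<in> W" "open W'" "homeomorphism W W' \<Phi> \<Psi>"
    "smooth_on W \<Phi>" "smooth_on W' \<Psi>" "subspace S" "dim S = j" "\<Phi> ` (A \<inter> W) = W' \<inter> S"
    by (rule has_slice_chartE[OF A p(1)])
  obtain V V' \<Phi>2 \<Psi>2 and T :: "'b set" where c2: "open V" "snd p \<in> V" "open V'" "homeomorphism V V' \<Phi>2 \<Psi>2"
    "smooth_on V \<Phi>2" "smooth_on V' \<Psi>2" "subspace T" "dim T = k" "\<Phi>2 ` (B \<inter> V) = V' \<inter> T"
    by (rule has_slice_chartE[OF B p(2)])
  let ?\<Phi> = "\<lambda>z. (\<Phi> (fst z), \<Phi>2 (snd z))" and ?\<Psi> = "\<lambda>z. (\<Psi> (fst z), \<Psi>2 (snd z))"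
  have prod: "smooth_on (M \<times> N) (\<lambda>z. (f (fst z), g (snd z)))"
    if "open M" "open N" "smooth_on M f" "smooth_on N g"
    for M :: "'a set" and N :: "'b set" and f :: "'a \<Rightarrow> 'a" and g :: "'b \<Rightarrow> 'b"
  proof (rule smooth_on_Pair[OF open_Times[OF that(1,2)]])
    have o: "open (M \<times> N)" using that open_Times by blast
    show "smooth_on (M \<times> N) (\<lambda>z. f (fst z))"
      by (rule smooth_on_compose[OF o that(1) _ that(3) smooth_on_linear[OF bounded_linear_fst o]]) auto
    show "smooth_on (M \<times> N) (\<lambda>z. g (snd z))"
      by (rule smooth_on_compose[OF o that(2) _ that(4) smooth_on_linear[OF bounded_linear_snd o]]) auto
  qed
  have sm: "smooth_on (W \<times> V) ?\<Phi>" "smooth_on (W' \<times> V') ?\<Psi>"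
    using prod c1 c2 by auto
  have "homeomorphism (W \<times> V) (W' \<times> V') ?\<Phi> ?\<Psi>"
    by (rule homeomorphismI[OF smooth_on_continuous[OF sm(1)] smooth_on_continuous[OF sm(2)]])
      (use c1(4) c2(4) in \<open>auto simp: homeomorphism_def\<close>)
  moreover have "?\<Phi> ` ((A \<times> B) \<inter> (W \<times> V)) = (W' \<times> V') \<inter> (S \<times> T)"
  proof -
    have "?\<Phi> ` ((A \<times> B) \<inter> (W \<times> V)) = (\<Phi> ` (A \<inter> W)) \<times> (\<Phi>2 ` (B \<inter> V))"
      by (force simp: image_iff)
    then show ?thesis by (simp only: c1(9) c2(9) Times_Int_Times)
  qed
  moreover have "subspace (S \<times> T)" "dim (S \<times> T) = j + k"
    using c1(7,8) c2(7,8) by (auto simp: subspace_Times dim_Times)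
  moreover have "open (W \<times> V)" "open (W' \<times> V')" "p \<in> W \<times> V"
    using c1 c2 by (auto simp: open_Times mem_Times_iff)
  ultimately show "has_slice_chart (j + k) (A \<times> B) p"
    by (intro has_slice_chartI[OF _ _ _ _ sm])
qed

lemma embedded_submanifold_point: "embedded_submanifold 0 {y}"
  unfolding embedded_submanifold_iff
proof
  fix p assume p: "p \<in> {y}"
  have "smooth_on UNIV (\<lambda>z. z - y)" "smooth_on UNIV (\<lambda>z. z + y)"
    by (auto intro!: smooth_on_diff smooth_on_add smooth_on_ident smooth_on_const)
  moreover have "homeomorphism UNIV UNIV (\<lambda>z. z - y) (\<lambda>z. z + y)"
    by (rule homeomorphismI) (auto intro!: continuous_intros)
  moreover have "(\<lambda>z. z - y) ` ({y} \<inter> UNIV) = UNIV \<inter> {0}" by auto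
  ultimately show "has_slice_chart 0 {y} p"
    by (intro has_slice_chartI[of UNIV _ UNIV "\<lambda>z. z - y" "\<lambda>z. z + y" "{0}"]) (auto simp: subspace_single_0)
qed

lemma dim_hyperplane_section:
  fixes P :: "'a::euclidean_space set"
  assumes P: "subspace P" and p: "p \<in> P" "p \<noteq> 0"
  shows "subspace (P \<inter> {w. p \<bullet> w = 0})" "dim (P \<inter> {w. p \<bullet> w = 0}) = dim P - 1"
proof -
  let ?S = "P \<inter> {w. p \<bullet> w = 0}"
  show S: "subspace ?S" using P subspace_hyperplane by (rule subspace_inter)
  have "P \<subseteq> span (insert p ?S)"
  proof
    fix z assume z: "z \<in> P"
    let ?c = "(p \<bullet> z) / (p \<bullet> p)"
    have "z - ?c *\<^sub>R p \<in> ?S"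
      using z p by (auto simp: inner_diff_right intro!: subspace_diff[OF P] subspace_scale[OF P])
    then have "(z - ?c *\<^sub>R p) + ?c *\<^sub>R p \<in> span (insert p ?S)"
      by (intro span_add span_scale span_base) auto
    then show "z \<in> span (insert p ?S)" by simp
  qed
  moreover have "span (insert p ?S) \<subseteq> P" using p P by (intro span_minimal) auto
  ultimately have "dim P = dim (insert p ?S)" by (metis dim_span subset_antisym)
  moreover have "p \<notin> span ?S" using S p by (simp add: span_eq_iff[THEN iffD2])
  ultimately show "dim ?S = dim P - 1" by (simp add: dim_insert)
qed

text \<open>The inversion in the sphere of radius \<open>\<surd>2\<close> about \<open>- p\<close>.  On the unit sphere without
  \<open>- p\<close> it is the stereographic projection to the hyperplane orthogonal to \<open>p\<close>, and it preserves the
  linear subspaces that contain \<open>p\<close>; so it is a slice chart for all sections of the sphere by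
  these.\<close>

definition inversion :: "'a::real_inner \<Rightarrow> 'a \<Rightarrow> 'a" where
  "inversion p z = (2 * inverse ((z + p) \<bullet> (z + p))) *\<^sub>R (z + p) - p"

lemma inversion_involution:
  assumes "z \<noteq> - p"
  shows "inversion p z \<noteq> - p" "inversion p (inversion p z) = z"
proof -
  have ne: "z + p \<noteq> 0" using assms by (simp add: eq_neg_iff_add_eq_0)
  have eq: "inversion p z + p = (2 * inverse ((z + p) \<bullet> (z + p))) *\<^sub>R (z + p)"
    by (simp add: inversion_def)
  have "inversion p z + p \<noteq> 0" unfolding eq using ne by simp
  then show "inversion p z \<noteq> - p" by (metis add.left_inverse)
  define n where "n = (z + p) \<bullet> (z + p)"
  have n: "n \<noteq> 0" using ne by (simp add: n_def)
  have "inversion p (inversion p z) + p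
      = (2 * inverse ((2 * inverse n) * (2 * inverse n) * n)) *\<^sub>R (2 * inverse n) *\<^sub>R (z + p)"
    unfolding inversion_def[of p "inversion p z"] eq by (simp flip: n_def)
  also have "\<dots> = z + p" using n by (simp add: field_simps)
  finally show "inversion p (inversion p z) = z" by simp
qed

lemma inversion_smooth: "smooth_on (- {- p}) (inversion p)"
  unfolding inversion_def
  by (intro smooth_on_diff smooth_on_scaleR smooth_on_mult smooth_on_const smooth_on_inverse_compose
      smooth_on_inner smooth_on_add smooth_on_ident open_Compl closed_singleton)
    (simp add: eq_neg_iff_add_eq_0)

lemma embedded_sphere_section:
  fixes P :: "'a::euclidean_space set"
  assumes P: "subspace P"
  shows "embedded_submanifold (dim P - 1) (sphere 0 1 \<inter> P)"
  unfolding embedded_submanifold_iff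
proof
  fix p assume "p \<in> sphere 0 1 \<inter> P"
  then have p: "norm p = 1" "p \<in> P" by auto
  then have pp: "p \<bullet> p = 1" "p \<noteq> 0" by (auto simp: dot_square_norm)
  have pm: "p \<noteq> - p"
  proof
    assume "p = - p"
    then have "p \<bullet> p = (- p) \<bullet> p" by (rule arg_cong)
    then show False using pp(1) by simp
  qed
  let ?W = "- {- p}" and ?S = "P \<inter> {w. p \<bullet> w = 0}"
  have notin: "- p \<notin> inversion p ` ?W"
  proof
    assume "- p \<in> inversion p ` ?W"
    then obtain z where "z \<noteq> - p" "inversion p z = - p" by (elim imageE) simp
    then show False using inversion_involution(1) by blast
  qed
  have "homeomorphism ?W ?W (inversion p) (inversion p)"
    by (rule homeomorphismI[OF smooth_on_continuous[OF inversion_smooth] smooth_on_continuous[OF inversion_smooth]])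
      (use notin in \<open>simp_all add: inversion_involution\<close>)
  moreover have im: "inversion p z \<in> P" if "z \<in> P" for z
    unfolding inversion_def using that p(2)
    by (intro subspace_diff[OF P] subspace_scale[OF P] subspace_add[OF P])
  have "inversion p ` (sphere 0 1 \<inter> P \<inter> ?W) = ?W \<inter> ?S"
  proof (intro equalityI subsetI)
    fix w assume "w \<in> inversion p ` (sphere 0 1 \<inter> P \<inter> ?W)"
    then obtain z where "z \<in> sphere 0 1 \<inter> P \<inter> ?W" "w = inversion p z" by blast
    then have z: "norm z = 1" "z \<in> P" "z \<noteq> - p" "w = inversion p z" by auto
    have zz: "z \<bullet> z = 1" using z(1) by (simp add: dot_square_norm)
    have "z + p \<noteq> 0" using z(3) by (simp add: eq_neg_iff_add_eq_0)
    then have "(z + p) \<bullet> (z + p) \<noteq> 0" by simp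
    moreover have n: "(z + p) \<bullet> (z + p) = 2 * (p \<bullet> (z + p))"
      using zz pp(1) by (simp add: inner_add_left inner_add_right inner_commute)
    ultimately have "p \<bullet> w = 0"
      unfolding z(4) inversion_def inner_diff_right inner_scaleR_right pp(1) n by (simp add: field_simps)
    then show "w \<in> ?W \<inter> ?S" using im[OF z(2)] inversion_involution(1)[OF z(3)] z(4) by auto
  next
    fix w assume "w \<in> ?W \<inter> ?S"
    then have w: "w \<noteq> - p" "w \<in> P" "p \<bullet> w = 0" by auto
    let ?z = "inversion p w" and ?n = "(w + p) \<bullet> (w + p)"
    have n0: "?n \<noteq> 0" using w(1) by (simp add: eq_neg_iff_add_eq_0)
    have wp: "(w + p) \<bullet> p = 1" using w(3) pp(1) by (simp add: inner_add_left inner_add_right inner_commute)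
    have "?z \<bullet> ?z = (2 * inverse ?n) * (2 * inverse ?n) * ?n - 2 * (2 * inverse ?n) * ((w + p) \<bullet> p) + p \<bullet> p"
      unfolding inversion_def inner_diff_left inner_diff_right inner_scaleR_left inner_scaleR_right
      by (simp add: inner_commute algebra_simps)
    also have "\<dots> = 1" unfolding wp pp(1) using n0 by (simp add: field_simps)
    finally have "norm ?z = 1" by (simp add: norm_eq_1)
    moreover have "?z \<in> P" by (rule im[OF w(2)])
    ultimately have "?z \<in> sphere 0 1 \<inter> P \<inter> ?W" using inversion_involution(1)[OF w(1)] by simp
    then show "w \<in> inversion p ` (sphere 0 1 \<inter> P \<inter> ?W)"
      using inversion_involution(2)[OF w(1)] by (metis imageI)
  qed
  ultimately show "has_slice_chart (dim P - 1) (sphere 0 1 \<inter> P) p"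
    using dim_hyperplane_section[OF P p(2) pp(2)] inversion_smooth[of p] pm
    by (intro has_slice_chartI[of ?W _ ?W "inversion p" "inversion p" ?S]) auto
qed

section \<open>Complete geodesic submanifolds\<close>

lemma complete_connected_geodesic_submanifoldI:
  fixes X :: "('a::euclidean_space \<times> 'b::euclidean_space) topology"
  assumes X: "immersed_submanifold k X" "connected_space X" "topspace X \<noteq> {}" "topspace X \<subseteq> prod_sphere"
    and geo: "\<And>p v. p \<in> topspace X \<Longrightarrow> v \<in> tangent_space X p \<Longrightarrow>
      continuous_map euclideanreal X (\<lambda>t. pexp p (t *\<^sub>R v))"
  shows "complete_connected_geodesic_submanifold prod_sphere k (topspace X)"
proof -
  have *: "geodesic_on prod_sphere I (\<lambda>t. pexp p (t *\<^sub>R v)) \<and> pexp p (0 *\<^sub>R v) = p \<and>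
      ((\<lambda>t. pexp p (t *\<^sub>R v)) has_vector_derivative v) (at 0) \<and>
      continuous_map (top_of_set I) X (\<lambda>t. pexp p (t *\<^sub>R v))"
    if p: "p \<in> topspace X" and v: "v \<in> tangent_space X p" and I: "open I" for p v I
    using geodesic_on_pexp[OF _ tangent_space_subset_sphere_tangent[OF X(4) v] I] X(4) p
      pexp_line_deriv[of p v 0] continuous_map_from_subtopology[OF geo[OF p v]] by auto
  have "geodesically_complete prod_sphere X"
    unfolding geodesically_complete_def using *[of _ _ UNIV] by (metis open_UNIV subtopology_UNIV)
  moreover have "geodesic_submanifold prod_sphere k X"
    unfolding geodesic_submanifold_def
  proof (intro conjI ballI X)
    fix p v assume "p \<in> topspace X" "v \<in> tangent_space X p"
    from *[OF this, of "{-1<..<1}"]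
    show "\<exists>\<epsilon>>0. \<exists>c. geodesic_on prod_sphere {-\<epsilon><..<\<epsilon>} c \<and> c 0 = p \<and> (c has_vector_derivative v) (at 0) \<and>
        continuous_map (top_of_set {-\<epsilon><..<\<epsilon>}) X c"
      by (intro exI[of _ 1] conjI exI[of _ "\<lambda>t. pexp p (t *\<^sub>R v)"]) auto
  qed
  ultimately show ?thesis
    unfolding complete_connected_geodesic_submanifold_def using X by blast
qed

lemma second_countable_euclidean: "second_countable (euclidean :: 'a::second_countable_topology topology)"
proof -
  obtain \<B> :: "'a set set" where B: "countable \<B>" "\<And>C. C \<in> \<B> \<Longrightarrow> open C" "\<And>S. open S \<Longrightarrow> \<exists>U. U \<subseteq> \<B> \<and> S = \<Union>U"
    using univ_second_countable by metis
  show ?thesis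
    unfolding second_countable_def
  proof (intro exI[of _ \<B>] conjI ballI allI impI B(1))
    fix U and x :: 'a assume "openin euclidean U \<and> x \<in> U"
    then show "\<exists>V\<in>\<B>. x \<in> V \<and> V \<subseteq> U" using B(3)[of U] by (auto simp: open_openin[symmetric])
  qed (use B(2) in auto)
qed

lemma embedded_imp_immersed:
  assumes "embedded_submanifold k L"
  shows "immersed_submanifold k (top_of_set L)"
  unfolding immersed_submanifold_def
  using assms second_countable_subtopology[OF second_countable_euclidean]
  by (auto intro!: exI[of _ L] simp: subtopology_subtopology)

lemma complete_connected_embedded:
  fixes L :: "('a::euclidean_space \<times> 'b::euclidean_space) set"
  assumes L: "embedded_submanifold k L" "connected L" "L \<noteq> {}" "L \<subseteq> prod_sphere"
    and geo: "\<And>p v t. p \<in> L \<Longrightarrow> v \<in> tangent_space (top_of_set L) p \<Longrightarrow> pexp p (t *\<^sub>R v) \<in> L"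
  shows "complete_connected_geodesic_submanifold prod_sphere k L"
proof -
  have "complete_connected_geodesic_submanifold prod_sphere k (topspace (top_of_set L))"
  proof (rule complete_connected_geodesic_submanifoldI[OF embedded_imp_immersed[OF L(1)]])
    show "connected_space (top_of_set L)" using L(2) unfolding connectedin_iff_connected[symmetric] connectedin_def by simp
    fix p v assume "p \<in> topspace (top_of_set L)" "v \<in> tangent_space (top_of_set L) p"
    then show "continuous_map euclideanreal (top_of_set L) (\<lambda>t. pexp p (t *\<^sub>R v))"
      using smooth_on_continuous[OF pexp_smooth, of p v] geo[of p v]
      by (simp add: continuous_map_in_subtopology Pi_iff del: split_paired_All)
  qed (use L in auto)
  then show ?thesis by simp
qed

text \<open>The factors of the product submanifolds: single points, great circles and the whole sphere.\<close>

definition sphere_factor :: "nat \<Rightarrow> 'a::euclidean_space set \<Rightarrow> bool" where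
  "sphere_factor k A \<longleftrightarrow> embedded_submanifold k A \<and> connected A \<and> A \<noteq> {} \<and> A \<subseteq> sphere 0 1 \<and>
     (\<forall>\<epsilon>>0. \<forall>c v t. (\<forall>s\<in>{-\<epsilon><..<\<epsilon>}. c s \<in> A) \<and> (c has_vector_derivative v) (at 0) \<longrightarrow> gexp (c 0) (t *\<^sub>R v) \<in> A)"

lemma curve_in_subspace_derivative:
  fixes c :: "real \<Rightarrow> 'a::euclidean_space"
  assumes "subspace P" "\<epsilon> > 0" "\<And>s. s \<in> {-\<epsilon><..<\<epsilon>} \<Longrightarrow> c s \<in> P" "(c has_vector_derivative v) (at 0)"
  shows "v \<in> P"
proof (rule derivative_in_subspace[OF assms(1,4)])
  show "\<forall>\<^sub>F s in at 0. c s \<in> P"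
    using eventually_at_in_open'[of "{-\<epsilon><..<\<epsilon>}" 0] assms(2,3) by (auto elim: eventually_mono)
qed (use assms in auto)

lemma gexp_in_subspace: "subspace P \<Longrightarrow> x \<in> P \<Longrightarrow> v \<in> P \<Longrightarrow> gexp x v \<in> P"
  unfolding gexp_def by (intro subspace_add subspace_scale)

lemma sphere_factor_section:
  assumes P: "subspace P" and "connected (sphere 0 1 \<inter> P)" "sphere 0 1 \<inter> P \<noteq> {}"
  shows "sphere_factor (dim P - 1) (sphere 0 1 \<inter> P)"
  unfolding sphere_factor_def
proof (intro conjI allI impI)
  fix \<epsilon> c v and t :: real
  assume \<epsilon>: "\<epsilon> > 0" and c: "(\<forall>s\<in>{-\<epsilon><..<\<epsilon>}. c s \<in> sphere 0 1 \<inter> P) \<and> (c has_vector_derivative v) (at 0)"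
  then have "v \<in> P" using curve_in_subspace_derivative[OF P \<epsilon>, of c v] by auto
  moreover have c0: "c 0 \<in> P" "norm (c 0) = 1" using c \<epsilon> by auto
  moreover have "c 0 \<bullet> v = 0"
    by (rule sphere_curve_velocity[of "{-\<epsilon><..<\<epsilon>}"]) (use c \<epsilon> in auto)
  ultimately show "gexp (c 0) (t *\<^sub>R v) \<in> sphere 0 1 \<inter> P"
    using norm_gexp[of "c 0" "t *\<^sub>R v"] gexp_in_subspace[OF P, of "c 0" "t *\<^sub>R v"] subspace_scale[OF P, of v t] by simp
qed (use assms embedded_sphere_section[OF P] in auto)

lemma sphere_factor_point:
  assumes "norm y = 1"
  shows "sphere_factor 0 {y}"
  unfolding sphere_factor_def
proof (intro conjI allI impI)
  fix \<epsilon> c v and t :: real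
  assume \<epsilon>: "\<epsilon> > 0" and c: "(\<forall>s\<in>{-\<epsilon><..<\<epsilon>}. c s \<in> {y}) \<and> (c has_vector_derivative v) (at 0)"
  have "v = 0" by (rule derivative_of_constant[of "{-\<epsilon><..<\<epsilon>}" 0 c y]) (use c \<epsilon> in auto)
  then show "gexp (c 0) (t *\<^sub>R v) \<in> {y}" using c \<epsilon> by auto
qed (use assms embedded_submanifold_point in auto)

lemma complete_connected_Times:
  assumes A: "sphere_factor j A" and B: "sphere_factor k B"
  shows "complete_connected_geodesic_submanifold prod_sphere (j + k) (A \<times> B)"
proof (rule complete_connected_embedded)
  fix p v and t :: real
  assume "p \<in> A \<times> B" "v \<in> tangent_space (top_of_set (A \<times> B)) p"
  then obtain \<epsilon> c where \<epsilon>: "\<epsilon> > 0" and cont: "continuous_map (top_of_set {-\<epsilon><..<\<epsilon>}) (top_of_set (A \<times> B)) c"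
    and c: "c 0 = p" "(c has_vector_derivative v) (at 0)"
    unfolding tangent_space_def by blast
  have im: "fst (c s) \<in> A" "snd (c s) \<in> B" if "s \<in> {-\<epsilon><..<\<epsilon>}" for s
    using continuous_map_image_subset_topspace[OF cont] that by (auto simp: image_subset_iff mem_Times_iff)
  have "gexp (fst (c 0)) (t *\<^sub>R fst v) \<in> A" "gexp (snd (c 0)) (t *\<^sub>R snd v) \<in> B"
    using A B \<epsilon> im c(2) unfolding sphere_factor_def has_vector_derivative_Pair_iff by metis+
  then show "pexp p (t *\<^sub>R v) \<in> A \<times> B" using c(1) by (simp add: pexp_def)
qed (use assms in \<open>auto simp: sphere_factor_def embedded_submanifold_Times connected_Times\<close>)

text \<open>The graph is the image of \<open>S2 \<times> {0}\<close> under a shear.  Its geodesics project to great circles because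
  the matrix is orthogonal and so commutes with \<open>gexp\<close>.\<close>

lemma complete_connected_graph:
  fixes R :: "real^3^3"
  assumes R: "R \<in> O3"
  shows "complete_connected_geodesic_submanifold prod_sphere 2 {(x, R *v x) |x. x \<in> sphere 0 1}"
    (is "complete_connected_geodesic_submanifold _ _ ?L")
proof (rule complete_connected_embedded)
  have L: "?L = (\<lambda>x. (x, R *v x)) ` sphere 0 1" by auto
  have bl: "bounded_linear ((*v) R)" by simp
  let ?F = "\<lambda>z. (fst z, snd z + R *v fst z)" and ?G = "\<lambda>z. (fst z, snd z - R *v fst z)"
  have FG: "bounded_linear ?F" "bounded_linear ?G"
    by (auto intro!: bounded_linear_Pair bounded_linear_add bounded_linear_sub bounded_linear_fst bounded_linear_snd
        bounded_linear_compose[OF bl])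
  have "embedded_submanifold 2 (sphere 0 1 :: (real^3) set)"
    using embedded_sphere_section[OF subspace_UNIV, where 'a = "real^3"] by simp
  from embedded_submanifold_Times[OF this embedded_submanifold_point[of "0 :: real^3"]]
  have "embedded_submanifold 2 ((sphere 0 1 :: (real^3) set) \<times> {0 :: real^3})" by simp
  then have "embedded_submanifold 2 (?F ` ((sphere 0 1 \<times> {0 :: real^3}) \<inter> UNIV))"
    by (rule embedded_submanifold_diffeo_image[where Q' = UNIV and G = ?G])
      (use FG in \<open>auto intro!: smooth_on_linear homeomorphismI linear_continuous_on simp: image_iff\<close>)
  also have "?F ` ((sphere 0 1 \<times> {0}) \<inter> UNIV) = ?L" by (auto simp: image_iff)
  finally show "embedded_submanifold 2 ?L" .
  show "connected ?L"
    unfolding L by (intro connected_continuous_image connected_sphere continuous_on_Pair continuous_on_id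
        linear_continuous_on bl) simp_all
  show "?L \<noteq> {}" using vector_choose_size[of 1] by (auto simp: L)
  show "?L \<subseteq> prod_sphere" by (auto simp: norm_O3[OF R])
  fix p v and t :: real
  assume p: "p \<in> ?L" and "v \<in> tangent_space (top_of_set ?L) p"
  then obtain \<epsilon> c where \<epsilon>: "\<epsilon> > 0" and cont: "continuous_map (top_of_set {-\<epsilon><..<\<epsilon>}) (top_of_set ?L) c"
    and c: "c 0 = p" "(c has_vector_derivative v) (at 0)"
    unfolding tangent_space_def by blast
  have "c ` {-\<epsilon><..<\<epsilon>} \<subseteq> ?L"
    using continuous_map_image_subset_topspace[OF cont] by simp
  then have im: "snd (c s) = R *v fst (c s) \<and> norm (fst (c s)) = 1" if "s \<in> {-\<epsilon><..<\<epsilon>}" for s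
    using that by fastforce
  have "snd v - R *v fst v = 0"
  proof (rule derivative_of_constant[of "{-\<epsilon><..<\<epsilon>}" 0 "\<lambda>s. snd (c s) - R *v fst (c s)" 0])
    show "((\<lambda>s. snd (c s) - R *v fst (c s)) has_vector_derivative snd v - R *v fst v) (at 0)"
      using c(2) bounded_linear.has_vector_derivative[OF bl]
      by (auto simp: has_vector_derivative_Pair_iff intro!: has_vector_derivative_diff)
  qed (use \<epsilon> im in auto)
  then have v: "snd v = R *v fst v" by simp
  have "fst p \<bullet> fst v = 0"
    using sphere_curve_velocity[of "{-\<epsilon><..<\<epsilon>}" 0 "\<lambda>s. fst (c s)" "fst v"] c im \<epsilon>
    by (simp add: has_vector_derivative_Pair_iff)
  moreover have pL: "norm (fst p) = 1" "snd p = R *v fst p" using p by auto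
  ultimately have "norm (gexp (fst p) (t *\<^sub>R fst v)) = 1" by (intro norm_gexp) auto
  moreover have "pexp p (t *\<^sub>R v) = (gexp (fst p) (t *\<^sub>R fst v), R *v gexp (fst p) (t *\<^sub>R fst v))"
    using gexp_orthogonal(1)[OF R, of "fst p" "t *\<^sub>R fst v"] pL v by (simp add: pexp_def matrix_vector_mult_scaleR)
  ultimately show "pexp p (t *\<^sub>R v) \<in> ?L" by auto
qed

section \<open>Great circles\<close>

lemma in_span_pair: "z \<in> span {x, u} \<longleftrightarrow> (\<exists>a b. z = a *\<^sub>R x + b *\<^sub>R u)"
  by (auto simp: span_breakdown_eq span_singleton image_iff algebra_simps)

lemma great_circle_eq:
  fixes x u :: "'a::euclidean_space"
  assumes x: "norm x = 1" "x \<bullet> u = 0" "u \<noteq> 0"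
  shows "gexp x ` span {u} = sphere 0 1 \<inter> span {x, u}"
proof (intro equalityI subsetI)
  fix z assume "z \<in> gexp x ` span {u}"
  then obtain t where z: "z = gexp x (t *\<^sub>R u)" by (auto simp: span_singleton)
  have "z \<in> span {x, u}"
    unfolding z by (intro gexp_in_subspace span_scale span_base) auto
  then show "z \<in> sphere 0 1 \<inter> span {x, u}" using norm_gexp[of x "t *\<^sub>R u"] x z by simp
next
  fix z assume z: "z \<in> sphere 0 1 \<inter> span {x, u}"
  then obtain a b where ab: "z = a *\<^sub>R x + b *\<^sub>R u" by (auto simp: in_span_pair)
  have "x \<bullet> x = 1" "u \<bullet> x = 0" "u \<bullet> u = norm u * norm u"
    using x by (auto simp: dot_square_norm inner_commute power2_eq_square)
  moreover have "z \<bullet> z = 1" using z by (simp add: dot_square_norm)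
  ultimately have "a\<^sup>2 + (norm u * b)\<^sup>2 = 1"
    using x(2) by (simp add: ab inner_add_left inner_add_right power2_eq_square algebra_simps)
  then obtain \<theta> where \<theta>: "a = cos \<theta>" "norm u * b = sin \<theta>" by (rule sincos_total_2pi) auto
  have "z = gexp x ((\<theta> / norm u) *\<^sub>R u)"
    using x(3) \<theta> by (simp add: gexp_line ab flip: \<theta>(2))
  then show "z \<in> gexp x ` span {u}" by (auto simp: span_singleton)
qed

lemma dim_span_pair:
  fixes x u :: "'a::euclidean_space"
  assumes "norm x = 1" "x \<bullet> u = 0" "u \<noteq> 0"
  shows "dim (span {x, u}) = 2"
proof -
  have "x \<notin> span {u}"
    using assms by (auto simp: span_singleton)
  then show ?thesis using assms(3) by (simp add: dim_insert)
qed

lemma sphere_factor_great_circle: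
  assumes "norm x = 1" "x \<bullet> u = 0" "u \<noteq> 0"
  shows "sphere_factor 1 (gexp x ` span {u})"
proof -
  have "gexp x ` span {u} = range (\<lambda>t. gexp x (t *\<^sub>R u))"
    by (simp add: span_singleton image_image)
  then have "connected (gexp x ` span {u})"
    using connected_continuous_image[OF smooth_on_continuous[OF gexp_smooth] connected_UNIV] by simp
  moreover have "gexp x ` span {u} \<noteq> {}" using span_zero[of "{u}"] by blast
  ultimately show ?thesis
    using sphere_factor_section[of "span {x, u}"] dim_span_pair[OF assms] great_circle_eq[OF assms] by simp
qed

text \<open>On the great circle without the point opposite to \<open>x\<close> the parameter is recovered from
  \<open>tan (\<theta> / 2) = sin \<theta> / (1 + cos \<theta>)\<close>.\<close>

definition circle_param :: "'a::real_inner \<Rightarrow> 'a \<Rightarrow> 'a \<Rightarrow> real" where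
  "circle_param x u z = (2 / norm u) * arctan ((z \<bullet> u) * inverse (norm u) * inverse (1 + x \<bullet> z))"

lemma circle_param_gexp:
  assumes x: "norm x = 1" "x \<bullet> u = 0" "u \<noteq> 0" and t: "\<bar>t\<bar> < pi / norm u"
  shows "circle_param x u (gexp x (t *\<^sub>R u)) = t" "1 + x \<bullet> gexp x (t *\<^sub>R u) > 0"
proof -
  define \<theta> where "\<theta> = norm u * t / 2"
  have u: "norm u > 0" using x by simp
  have "\<bar>norm u * t\<bar> < pi"
    using t u by (simp add: abs_mult pos_less_divide_eq mult.commute)
  then have \<theta>: "- (pi / 2) < \<theta>" "\<theta> < pi / 2"
    unfolding \<theta>_def by linarith+
  have "x \<bullet> gexp x (t *\<^sub>R u) = cos (2 * \<theta>)"
    using x by (simp add: gexp_line inner_add_right dot_square_norm \<theta>_def)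
  moreover have "gexp x (t *\<^sub>R u) \<bullet> u = sin (2 * \<theta>) * norm u"
    using x by (simp add: gexp_line inner_add_left dot_square_norm \<theta>_def power2_eq_square)
  ultimately have "circle_param x u (gexp x (t *\<^sub>R u)) = (2 / norm u) * arctan (sin (2 * \<theta>) / (cos (2 * \<theta>) + 1))"
    using u by (simp add: circle_param_def field_simps)
  also have "\<dots> = (2 / norm u) * \<theta>"
    unfolding tan_half[symmetric] using arctan_tan[OF \<theta>] by simp
  also have "\<dots> = t" using u by (simp add: \<theta>_def)
  finally show "circle_param x u (gexp x (t *\<^sub>R u)) = t" .
  have "cos \<theta> > 0" using cos_gt_zero_pi[OF \<theta>] .
  then have "1 + cos (2 * \<theta>) > 0" by (simp add: cos_double_cos)
  then show "1 + x \<bullet> gexp x (t *\<^sub>R u) > 0" using \<open>x \<bullet> gexp x (t *\<^sub>R u) = cos (2 * \<theta>)\<close> by simp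
qed

lemma circle_param_smooth:
  fixes x u :: "'a::euclidean_space"
  shows "open {z. 1 + x \<bullet> z > 0}" "smooth_on {z. 1 + x \<bullet> z > 0} (circle_param x u)"
proof -
  let ?Q = "{z. 1 + x \<bullet> z > 0}"
  show Q: "open ?Q" by (intro open_Collect_less continuous_intros)
  have "smooth_on ?Q (\<lambda>z. inverse (1 + x \<bullet> z))"
    using Q by (intro smooth_on_inverse_compose smooth_on_add smooth_on_const smooth_on_inner smooth_on_ident) auto
  then have arg: "smooth_on ?Q (\<lambda>z. (z \<bullet> u) * inverse (norm u) * inverse (1 + x \<bullet> z))"
    using Q by (intro smooth_on_mult smooth_on_const smooth_on_inner smooth_on_ident)
  have "smooth_on ?Q (\<lambda>z. arctan ((z \<bullet> u) * inverse (norm u) * inverse (1 + x \<bullet> z)))"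
    by (rule smooth_on_compose[OF Q open_UNIV _ smooth_on_arctan arg]) simp
  then show "smooth_on ?Q (circle_param x u)"
    unfolding circle_param_def[abs_def] using Q by (intro smooth_on_mult smooth_on_const)
qed

lemma open_great_circle_arc:
  fixes x u :: "'a::euclidean_space"
  assumes x: "norm x = 1" "x \<bullet> u = 0" "u \<noteq> 0"
  shows "sphere 0 1 \<inter> span {x, u} \<inter> {z. 1 + x \<bullet> z > 0}
    = (\<lambda>t. gexp x (t *\<^sub>R u)) ` {-(pi / norm u)<..<pi / norm u}"
proof (intro equalityI subsetI)
  fix z assume "z \<in> (\<lambda>t. gexp x (t *\<^sub>R u)) ` {-(pi / norm u)<..<pi / norm u}"
  then obtain t where t: "z = gexp x (t *\<^sub>R u)" "\<bar>t\<bar> < pi / norm u" by auto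
  then have "z \<in> gexp x ` span {u}" by (auto simp: span_singleton)
  then show "z \<in> sphere 0 1 \<inter> span {x, u} \<inter> {z. 1 + x \<bullet> z > 0}"
    using great_circle_eq[OF x] circle_param_gexp(2)[OF x t(2)] t(1) by auto
next
  fix z assume z: "z \<in> sphere 0 1 \<inter> span {x, u} \<inter> {z. 1 + x \<bullet> z > 0}"
  then obtain s where s: "z = gexp x (s *\<^sub>R u)"
    unfolding great_circle_eq[OF x, symmetric] by (auto simp: span_singleton)
  obtain \<theta> where \<theta>: "- pi < \<theta>" "\<theta> \<le> pi" "sin \<theta> = sin (norm u * s)" "cos \<theta> = cos (norm u * s)"
    using sincos_principal_value[of "norm u * s"] by blast
  have "z = gexp x ((\<theta> / norm u) *\<^sub>R u)"
    using x(3) \<theta> by (simp add: gexp_line s)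
  moreover have "x \<bullet> z = cos \<theta>"
    using x \<theta>(4) by (simp add: s gexp_line inner_add_right dot_square_norm)
  then have "\<theta> \<noteq> pi" using z by auto
  then have "\<theta> / norm u \<in> {-(pi / norm u)<..<pi / norm u}"
    using \<theta> x(3) by (auto simp: divide_strict_right_mono minus_divide_left simp del: minus_divide_left[symmetric])
  ultimately show "z \<in> (\<lambda>t. gexp x (t *\<^sub>R u)) ` {-(pi / norm u)<..<pi / norm u}" by blast
qed

section \<open>Geodesics as immersed submanifolds\<close>

text \<open>A short arc of a geodesic whose first component moves is a graph over an arc of a great
  circle.\<close>

lemma embedded_geodesic_arc_fst:
  fixes p v :: "'a::euclidean_space \<times> 'a"
  assumes p: "p \<in> prod_sphere" and v: "v \<in> sphere_tangent p" and v0: "fst v \<noteq> 0"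
  obtains \<eta> \<tau> Q where "0 < (\<eta>::real)" "open Q" "continuous_on Q \<tau>"
    "\<And>t. \<bar>t\<bar> < \<eta> \<Longrightarrow> pexp p (t *\<^sub>R v) \<in> Q \<and> \<tau> (pexp p (t *\<^sub>R v)) = t"
    "embedded_submanifold 1 ((\<lambda>t. pexp p (t *\<^sub>R v)) ` {-\<eta><..<\<eta>})"
proof -
  define x u where "x = fst p" and "u = fst v"
  have x: "norm x = 1" "x \<bullet> u = 0" "u \<noteq> 0"
    using p v v0 by (auto simp: x_def u_def sphere_tangent_def mem_Times_iff)
  define \<eta> where "\<eta> = pi / norm u"
  have \<eta>: "\<eta> > 0" using x(3) by (simp add: \<eta>_def)
  let ?Q = "{z. 1 + x \<bullet> z > 0}"
  define C where "C = sphere 0 1 \<inter> span {x, u} \<inter> ?Q"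
  have C_eq: "C = (\<lambda>t. gexp x (t *\<^sub>R u)) ` {-\<eta><..<\<eta>}"
    unfolding C_def \<eta>_def by (rule open_great_circle_arc[OF x])
  have "embedded_submanifold 1 (sphere 0 1 \<inter> span {x, u})"
    using embedded_sphere_section[OF subspace_span, of "{x, u}"] dim_span_pair[OF x] by simp
  from embedded_submanifold_Times[OF this embedded_submanifold_point]
  have C0: "embedded_submanifold 1 ((sphere 0 1 \<inter> span {x, u}) \<times> {0 :: 'a})" by simp
  define g where "g = (\<lambda>z. gexp (snd p) (circle_param x u z *\<^sub>R snd v))"
  have g: "smooth_on ?Q g"
    unfolding g_def
    by (rule smooth_on_compose[OF circle_param_smooth(1) open_UNIV _ gexp_smooth circle_param_smooth(2)]) simp
  let ?F = "\<lambda>z. (fst z, snd z + g (fst z))" and ?G = "\<lambda>z. (fst z, snd z - g (fst z))"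
  let ?O = "?Q \<times> (UNIV :: 'a set)"
  have O: "open ?O" using circle_param_smooth(1) by (intro open_Times) auto
  have gO: "smooth_on ?O (\<lambda>z. g (fst z))"
    by (rule smooth_on_compose[OF O circle_param_smooth(1) _ g smooth_on_linear[OF bounded_linear_fst O]]) auto
  have F: "smooth_on ?O ?F" and G: "smooth_on ?O ?G"
    by (intro smooth_on_Pair[OF O] smooth_on_add[OF O] smooth_on_diff[OF O] gO
        smooth_on_linear[OF bounded_linear_fst O] smooth_on_linear[OF bounded_linear_snd O])+
  have hom: "homeomorphism ?O ?O ?F ?G"
    by (rule homeomorphismI[OF smooth_on_continuous[OF F] smooth_on_continuous[OF G]]) auto
  have "embedded_submanifold 1 (?F ` ((sphere 0 1 \<inter> span {x, u}) \<times> {0} \<inter> ?O))"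
    by (rule embedded_submanifold_diffeo_image[OF C0 O O hom F G])
  also have "((sphere 0 1 \<inter> span {x, u}) \<times> {0} \<inter> ?O) = C \<times> {0}" by (auto simp: C_def)
  also have "?F ` (C \<times> {0}) = (\<lambda>t. pexp p (t *\<^sub>R v)) ` {-\<eta><..<\<eta>}"
  proof -
    have "?F ` (C \<times> {0}) = (\<lambda>z. (z, g z)) ` C" by (force simp: image_iff)
    also have "\<dots> = (\<lambda>t. (gexp x (t *\<^sub>R u), g (gexp x (t *\<^sub>R u)))) ` {-\<eta><..<\<eta>}"
      unfolding C_eq by (simp add: image_image)
    also have "\<dots> = (\<lambda>t. pexp p (t *\<^sub>R v)) ` {-\<eta><..<\<eta>}"
    proof (rule image_cong[OF refl])
      fix t assume "t \<in> {-\<eta><..<\<eta>}"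
      then have "\<bar>t\<bar> < pi / norm u" by (auto simp: \<eta>_def)
      then show "(gexp x (t *\<^sub>R u), g (gexp x (t *\<^sub>R u))) = pexp p (t *\<^sub>R v)"
        using circle_param_gexp(1)[OF x] by (simp add: g_def pexp_def x_def u_def)
    qed
    finally show ?thesis .
  qed
  finally have emb: "embedded_submanifold 1 ((\<lambda>t. pexp p (t *\<^sub>R v)) ` {-\<eta><..<\<eta>})" .
  show ?thesis
  proof (rule that[OF \<eta> O _ _ emb])
    show "continuous_on ?O (\<lambda>z. circle_param x u (fst z))"
      by (rule continuous_on_compose2[OF smooth_on_continuous[OF circle_param_smooth(2)] continuous_on_fst[OF continuous_on_id]]) auto
    show "pexp p (t *\<^sub>R v) \<in> ?O \<and> circle_param x u (fst (pexp p (t *\<^sub>R v))) = t" if "\<bar>t\<bar> < \<eta>" for t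
      using circle_param_gexp[OF x, of t] that by (simp add: \<eta>_def pexp_def x_def u_def)
  qed
qed

lemma pexp_swap: "pexp (prod.swap p) (prod.swap v) = prod.swap (pexp p v)"
  by (simp add: pexp_def prod.swap_def)

text \<open>If the first component is stationary the two factors are exchanged.  The function \<open>\<tau>\<close> recovers the
  parameter continuously from the point; it shows that the topology of the line and the subspace
  topology agree on the arc.\<close>

lemma embedded_geodesic_arc:
  fixes p v :: "'a::euclidean_space \<times> 'a"
  assumes p: "p \<in> prod_sphere" and v: "v \<in> sphere_tangent p" and v0: "v \<noteq> 0"
  obtains \<eta> \<tau> Q where "0 < (\<eta>::real)" "open Q" "continuous_on Q \<tau>"
    "\<And>t. \<bar>t\<bar> < \<eta> \<Longrightarrow> pexp p (t *\<^sub>R v) \<in> Q \<and> \<tau> (pexp p (t *\<^sub>R v)) = t"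
    "embedded_submanifold 1 ((\<lambda>t. pexp p (t *\<^sub>R v)) ` {-\<eta><..<\<eta>})"
proof (cases "fst v = 0")
  case False
  from embedded_geodesic_arc_fst[OF p v False] show ?thesis using that by metis
next
  case True
  have sw: "bounded_linear (prod.swap :: 'a \<times> 'a \<Rightarrow> 'a \<times> 'a)"
    unfolding prod.swap_def by (intro bounded_linear_Pair bounded_linear_fst bounded_linear_snd)
  have "prod.swap p \<in> prod_sphere" "prod.swap v \<in> sphere_tangent (prod.swap p)" "fst (prod.swap v) \<noteq> 0"
    using p v v0 True by (auto simp: sphere_tangent_def prod_eq_iff)
  then obtain \<eta> \<tau> Q where *: "0 < (\<eta>::real)" "open Q" "continuous_on Q \<tau>"
    "\<And>t. \<bar>t\<bar> < \<eta> \<Longrightarrow> pexp (prod.swap p) (t *\<^sub>R prod.swap v) \<in> Q \<and> \<tau> (pexp (prod.swap p) (t *\<^sub>R prod.swap v)) = t"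
    "embedded_submanifold 1 ((\<lambda>t. pexp (prod.swap p) (t *\<^sub>R prod.swap v)) ` {-\<eta><..<\<eta>})"
    using embedded_geodesic_arc_fst by metis
  have swap: "pexp (prod.swap p) (t *\<^sub>R prod.swap v) = prod.swap (pexp p (t *\<^sub>R v))" for t
    using pexp_swap[of p "t *\<^sub>R v"] by (simp add: prod.swap_def)
  have cs: "continuous_on A (prod.swap :: 'a \<times> 'a \<Rightarrow> 'a \<times> 'a)" for A
    by (rule linear_continuous_on[OF sw])
  show ?thesis
  proof (rule that[OF *(1)])
    show "open (prod.swap -` Q)" using open_vimage[OF *(2) cs] .
    show "continuous_on (prod.swap -` Q) (\<lambda>z. \<tau> (prod.swap z))"
      by (rule continuous_on_compose2[OF *(3) cs]) auto
    show "pexp p (t *\<^sub>R v) \<in> prod.swap -` Q \<and> \<tau> (prod.swap (pexp p (t *\<^sub>R v))) = t" if "\<bar>t\<bar> < \<eta>" for t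
      using *(4)[OF that] by (simp add: swap)
    have "embedded_submanifold 1 (prod.swap ` ((\<lambda>t. prod.swap (pexp p (t *\<^sub>R v))) ` {-\<eta><..<\<eta>} \<inter> UNIV))"
      using *(5) unfolding swap
      by (rule embedded_submanifold_diffeo_image[where Q' = UNIV and G = prod.swap])
        (auto intro!: smooth_on_linear sw homeomorphismI cs)
    then show "embedded_submanifold 1 ((\<lambda>t. pexp p (t *\<^sub>R v)) ` {-\<eta><..<\<eta>})"
      by (simp add: image_image)
  qed
qed

text \<open>A geodesic that returns to a point does so with the same velocity, because great circles do.\<close>

lemma gexp_line_eq_shift:
  assumes x: "norm x = 1" "x \<bullet> u = 0" and eq: "gexp x (s *\<^sub>R u) = gexp x (t *\<^sub>R u)"
  shows "gexp x ((s + r) *\<^sub>R u) = gexp x ((t + r) *\<^sub>R u)"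
proof (cases "u = 0")
  case False
  have xx: "x \<bullet> x = 1" "u \<bullet> x = 0" using x by (auto simp: dot_square_norm inner_commute)
  have "cos (norm u * s) = cos (norm u * t)"
    using arg_cong[OF eq, of "\<lambda>z. x \<bullet> z"] by (simp add: gexp_line inner_add_right xx x)
  moreover have "sin (norm u * s) = sin (norm u * t)"
    using arg_cong[OF eq, of "\<lambda>z. u \<bullet> z"] False by (simp add: gexp_line inner_add_right xx)
  ultimately have "gvel x u s = gvel x u t" by (simp add: gvel_def)
  then show ?thesis using gexp_shift[OF x, of s r] gexp_shift[OF x, of t r] eq by simp
qed simp

lemma pexp_line_eq_shift:
  assumes "p \<in> prod_sphere" "v \<in> sphere_tangent p" "pexp p (s *\<^sub>R v) = pexp p (t *\<^sub>R v)"
  shows "pexp p ((s + r) *\<^sub>R v) = pexp p ((t + r) *\<^sub>R v)"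
  using assms gexp_line_eq_shift[of "fst p" "fst v" s t r] gexp_line_eq_shift[of "snd p" "snd v" s t r]
  by (simp add: pexp_def sphere_tangent_def mem_Times_iff)

text \<open>A geodesic need not be embedded: it may be dense in a torus.  It carries the quotient topology
  of the real line.\<close>

definition curve_topology :: "(real \<Rightarrow> 'a) \<Rightarrow> 'a topology" where
  "curve_topology c = topology (\<lambda>V. V \<subseteq> range c \<and> open (c -` V))"

lemma openin_curve_topology: "openin (curve_topology c) V \<longleftrightarrow> V \<subseteq> range c \<and> open (c -` V)"
proof -
  have "istopology (\<lambda>V. V \<subseteq> range c \<and> open (c -` V))"
    unfolding istopology_def by (auto simp: vimage_Union intro!: open_Int)
  then show ?thesis by (simp add: curve_topology_def topology_inverse')
qed

lemma topspace_curve_topology: "topspace (curve_topology c) = range c"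
proof (rule equalityI)
  show "topspace (curve_topology c) \<subseteq> range c"
    using openin_topspace[of "curve_topology c"] unfolding openin_curve_topology by blast
  have "c -` range c = UNIV" by blast
  then have "openin (curve_topology c) (range c)" by (simp add: openin_curve_topology)
  then show "range c \<subseteq> topspace (curve_topology c)" by (rule openin_subset)
qed

lemma continuous_map_curve_topology: "continuous_map euclideanreal (curve_topology c) c"
  unfolding continuous_map_def by (auto simp: openin_curve_topology topspace_curve_topology vimage_def)

context
  fixes p v :: "'a::euclidean_space \<times> 'a"
  assumes p: "p \<in> prod_sphere" and v: "v \<in> sphere_tangent p" and v0: "v \<noteq> 0"
begin

private abbreviation c where "c \<equiv> \<lambda>t. pexp p (t *\<^sub>R v)"
private abbreviation X where "X \<equiv> curve_topology (\<lambda>t. pexp p (t *\<^sub>R v))"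

private lemma c_continuous: "continuous_on UNIV c"
  by (rule smooth_on_continuous[OF pexp_smooth])

text \<open>By \<open>pexp_line_eq_shift\<close> the parameters of the points of an arc form a union of translates of the
  parameter interval.\<close>

lemma open_map_geodesic:
  assumes "open T"
  shows "openin X (c ` T)"
  unfolding openin_curve_topology
proof
  show "open (c -` c ` T)"
    unfolding open_dist
  proof
    fix t assume "t \<in> c -` c ` T"
    then obtain s where s: "s \<in> T" "c s = c t" by force
    then obtain e where e: "e > 0" "\<And>s'. dist s' s < e \<Longrightarrow> s' \<in> T" using assms unfolding open_dist by blast
    have "t' \<in> c -` c ` T" if "dist t' t < e" for t'
    proof -
      have "s + (t' - t) \<in> T" using that by (intro e(2)) (simp add: dist_real_def)
      moreover have "c (s + (t' - t)) = c t'"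
        using pexp_line_eq_shift[OF p v s(2), of "t' - t"] by simp
      ultimately show ?thesis by (metis imageI vimageI)
    qed
    then show "\<exists>e>0. \<forall>t'. dist t' t < e \<longrightarrow> t' \<in> c -` c ` T" using e(1) by blast
  qed
qed auto

lemma geodesic_shift_velocity:
  "pexp p (t *\<^sub>R v) \<in> prod_sphere" "dpexp p (t *\<^sub>R v) v \<in> sphere_tangent (pexp p (t *\<^sub>R v))" "dpexp p (t *\<^sub>R v) v \<noteq> 0"
proof -
  show "pexp p (t *\<^sub>R v) \<in> prod_sphere"
    by (rule pexp_in_prod_sphere[OF p subspace_scale[OF subspace_sphere_tangent v]])
  show "dpexp p (t *\<^sub>R v) v \<in> sphere_tangent (pexp p (t *\<^sub>R v))"
    using inner_gexp_gvel[of "fst p" "fst v" t] inner_gexp_gvel[of "snd p" "snd v" t] p v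
    by (simp add: sphere_tangent_def pexp_def dpexp_def mem_Times_iff flip: gvel_eq_dgexp)
  show "dpexp p (t *\<^sub>R v) v \<noteq> 0" using norm_dpexp_line[OF p v, of t] v0 by auto
qed

lemma immersed_geodesic: "immersed_submanifold 1 X"
  unfolding immersed_submanifold_def
proof (intro conjI ballI)
  show "second_countable X"
    using second_countable_open_map_image[OF continuous_map_curve_topology, of c] open_map_geodesic
      second_countable_euclidean
    by (simp add: open_map_def topspace_curve_topology)
  fix q assume "q \<in> topspace X"
  then obtain t0 where t0: "q = c t0" by (auto simp: topspace_curve_topology)
  define w where "w = dpexp p (t0 *\<^sub>R v) v"
  have qs: "q \<in> prod_sphere" "w \<in> sphere_tangent q" "w \<noteq> 0"
    unfolding t0 w_def by (fact geodesic_shift_velocity)+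
  have shift: "pexp q (t *\<^sub>R w) = c (t0 + t)" for t
    unfolding t0 w_def by (rule pexp_shift[OF p v])
  obtain \<eta> \<tau> Q where a: "0 < (\<eta>::real)" "open Q" "continuous_on Q \<tau>"
    "\<And>t. \<bar>t\<bar> < \<eta> \<Longrightarrow> pexp q (t *\<^sub>R w) \<in> Q \<and> \<tau> (pexp q (t *\<^sub>R w)) = t"
    "embedded_submanifold 1 ((\<lambda>t. pexp q (t *\<^sub>R w)) ` {-\<eta><..<\<eta>})"
    using embedded_geodesic_arc[OF qs] by metis
  define U where "U = (\<lambda>t. pexp q (t *\<^sub>R w)) ` {-\<eta><..<\<eta>}"
  have U_c: "U = c ` ((+) t0 ` {-\<eta><..<\<eta>})"
    unfolding U_def shift by (simp only: image_image)
  have openU: "openin X U"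
    unfolding U_c by (intro open_map_geodesic open_translation) simp
  have UQ: "z \<in> Q \<and> c (t0 + \<tau> z) = z" if zU: "z \<in> U" for z
  proof -
    obtain t where "t \<in> {-\<eta><..<\<eta>}" and z: "z = pexp q (t *\<^sub>R w)"
      using zU unfolding U_def by blast
    then have "\<bar>t\<bar> < \<eta>" by auto
    then show ?thesis using a(4)[of t] shift[of t] z by simp
  qed
  have "subtopology X U = top_of_set U"
    unfolding topology_eq
  proof
    fix T
    have "openin (subtopology X U) T \<longleftrightarrow> T \<subseteq> U \<and> openin X T"
      using openin_open_subtopology[OF openU] by blast
    also have "\<dots> \<longleftrightarrow> openin (top_of_set U) T"
    proof
      assume T: "T \<subseteq> U \<and> openin X T"
      have "open (Q \<inter> (\<lambda>z. t0 + \<tau> z) -` (c -` T))"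
        using T unfolding openin_curve_topology
        by (intro continuous_open_preimage[OF continuous_on_add[OF continuous_on_const a(3)] a(2)]) blast
      moreover have "T = U \<inter> (Q \<inter> (\<lambda>z. t0 + \<tau> z) -` (c -` T))"
        using T UQ by auto
      ultimately show "openin (top_of_set U) T" unfolding openin_open by blast
    next
      assume "openin (top_of_set U) T"
      then obtain O' where O': "open O'" "T = U \<inter> O'" unfolding openin_open by blast
      have "c -` T = c -` U \<inter> c -` O'" using O'(2) by blast
      moreover have "open (c -` U)" using openU unfolding openin_curve_topology by blast
      moreover have "open (c -` O')" by (rule open_vimage[OF O'(1) c_continuous])
      ultimately have "open (c -` T)" by auto
      moreover have "T \<subseteq> U" "U \<subseteq> range c" using O'(2) by (auto simp: U_c)
      ultimately show "T \<subseteq> U \<and> openin X T" unfolding openin_curve_topology by blast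
    qed
    finally show "openin (subtopology X U) T \<longleftrightarrow> openin (top_of_set U) T" .
  qed
  moreover have "q \<in> U" unfolding U_def using a(1) by (intro image_eqI[of _ _ 0]) auto
  ultimately show "\<exists>U. openin X U \<and> q \<in> U \<and> subtopology X U = top_of_set U \<and> embedded_submanifold 1 U"
    using openU a(5) unfolding U_def by blast
qed

text \<open>The tangent space at each point is a line, and it contains the velocity of the curve; so the geodesics
  tangent to it are reparametrizations of the curve itself.\<close>

lemma complete_connected_geodesic:
  "complete_connected_geodesic_submanifold prod_sphere 1 (pexp p ` span {v})"
proof -
  have "complete_connected_geodesic_submanifold prod_sphere 1 (topspace X)"
  proof (rule complete_connected_geodesic_submanifoldI[OF immersed_geodesic])
    show "connected_space X"
      using connectedin_continuous_map_image[OF continuous_map_curve_topology, of UNIV c]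
      by (simp add: connectedin_topspace[symmetric] topspace_curve_topology)
    show "topspace X \<noteq> {}" by (simp add: topspace_curve_topology)
    show "topspace X \<subseteq> prod_sphere"
      unfolding topspace_curve_topology using geodesic_shift_velocity(1) by blast
    fix q w assume q: "q \<in> topspace X" and w: "w \<in> tangent_space X q"
    obtain t0 where t0: "q = c t0" using q by (auto simp: topspace_curve_topology)
    define u where "u = dpexp p (t0 *\<^sub>R v) v"
    have u0: "u \<noteq> 0" unfolding u_def by (rule geodesic_shift_velocity(3))
    have shift: "pexp q (t *\<^sub>R u) = c (t0 + t)" for t
      unfolding t0 u_def by (rule pexp_shift[OF p v])
    have cont: "continuous_map euclideanreal X (\<lambda>t. c (t0 + s * t))" for s
      using continuous_map_compose[OF _ continuous_map_curve_topology[of c], of euclideanreal "\<lambda>t. t0 + s * t"]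
      by (simp add: o_def continuous_intros)
    have "u \<in> tangent_space X q"
      unfolding tangent_space_def
    proof (intro CollectI exI[of _ 1] conjI exI[of _ "\<lambda>t. pexp q (t *\<^sub>R u)"])
      show "smooth_on {-1<..<1} (\<lambda>t. pexp q (t *\<^sub>R u))" by (rule smooth_on_subset[OF pexp_smooth]) simp
      show "continuous_map (top_of_set {-1<..<1}) X (\<lambda>t. pexp q (t *\<^sub>R u))"
        unfolding shift using continuous_map_from_subtopology[OF cont[of 1]] by simp
      show "((\<lambda>t. pexp q (t *\<^sub>R u)) has_vector_derivative u) (at 0)"
        using pexp_line_deriv[of q u 0] by simp
    qed auto
    moreover obtain U W W' \<Phi> \<Psi> S where "slice_chart X U W W' \<Phi> \<Psi> S" "q \<in> U" "dim S = 1"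
      using immersed_submanifold_chart[OF immersed_geodesic q] by metis
    then have "subspace (tangent_space X q)" "dim (tangent_space X q) = 1"
      using slice_chart.tangent_space_subspace slice_chart.tangent_space_dim by metis+
    ultimately have "span {u} = tangent_space X q"
      using u0 span_minimal[of "{u}" "tangent_space X q"] by (intro subspace_dim_equal) auto
    then obtain s where "w = s *\<^sub>R u" using w by (auto simp: span_singleton)
    then show "continuous_map euclideanreal X (\<lambda>t. pexp q (t *\<^sub>R w))"
      using cont[of s] by (simp add: shift mult.commute)
  qed
  then show ?thesis by (simp add: topspace_curve_topology span_singleton image_image)
qed

end

section \<open>The matrix exponential of a skew-symmetric matrix\<close>

lemma matrix_power_vector:
  fixes A :: "real^'n^'n"
  shows "(((\<lambda>B. A ** B) ^^ n) (mat 1)) *v x = (((*v) A) ^^ n) x"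
  by (induction n) (simp_all flip: matrix_vector_mul_assoc)

text \<open>The entries of the \<open>n\<close>-th power are bounded by the \<open>n\<close>-th power of the operator norm.\<close>

lemma summable_mexp:
  fixes A :: "real^'n^'n"
  shows "summable (\<lambda>n. (1 / fact n) *\<^sub>R (((\<lambda>B. A ** B) ^^ n) (mat 1)))"
proof -
  define K where "K = onorm ((*v) A)"
  define T where "T n = ((\<lambda>B. A ** B) ^^ n) (mat 1)" for n
  have bl: "bounded_linear ((*v) A)" by simp
  have pow: "norm ((((*v) A) ^^ n) x) \<le> K ^ n * norm x" for n x
  proof (induction n)
    case (Suc n)
    have "norm ((((*v) A) ^^ Suc n) x) \<le> K * norm ((((*v) A) ^^ n) x)"
      unfolding K_def using onorm[OF bl] by simp
    also have "\<dots> \<le> K * (K ^ n * norm x)"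
      by (intro mult_left_mono Suc) (simp add: K_def onorm_pos_le[OF bl])
    finally show ?case by simp
  qed simp
  have entry: "\<bar>T n $ i $ j\<bar> \<le> K ^ n" for n i j
  proof -
    have "T n $ i $ j = (T n *v axis j 1) $ i"
      by (simp add: matrix_vector_mult_basis column_def)
    also have "\<bar>\<dots>\<bar> \<le> norm (T n *v axis j 1)" by (rule component_le_norm_cart)
    also have "\<dots> \<le> K ^ n" using pow[of n "axis j 1"] by (simp add: T_def matrix_power_vector)
    finally show ?thesis .
  qed
  have "norm (T n) \<le> real CARD('n) * (real CARD('n) * K ^ n)" for n
  proof -
    have "norm (T n) \<le> (\<Sum>i\<in>UNIV. norm (T n $ i))"
      unfolding norm_vec_def by (rule L2_set_le_sum) simp
    also have "\<dots> \<le> (\<Sum>i\<in>(UNIV :: 'n set). real CARD('n) * K ^ n)"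
    proof (rule sum_mono)
      fix i
      have "norm (T n $ i) \<le> (\<Sum>j\<in>UNIV. \<bar>T n $ i $ j\<bar>)" by (rule norm_le_l1_cart)
      also have "\<dots> \<le> (\<Sum>j\<in>(UNIV :: 'n set). K ^ n)" by (intro sum_mono entry)
      finally show "norm (T n $ i) \<le> real CARD('n) * K ^ n" by simp
    qed
    finally show ?thesis by simp
  qed
  then have "(1 / fact n) * norm (T n) \<le> (1 / fact n) * (real CARD('n) * (real CARD('n) * K ^ n))" for n
    by (rule mult_left_mono) simp
  then have bound: "norm ((1 / fact n) *\<^sub>R T n) \<le> (real CARD('n) * real CARD('n)) * (inverse (fact n) * K ^ n)" for n
    by (simp add: divide_inverse mult_ac)
  have "summable (\<lambda>n. (real CARD('n) * real CARD('n)) * (inverse (fact n) * K ^ n))"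
    by (rule summable_mult[OF summable_exp])
  then show ?thesis
    unfolding T_def[symmetric] by (rule summable_comparison_test'[of _ 0]) (rule bound)
qed

lemma mexp_vector_sums:
  fixes A :: "real^'n^'n"
  shows "(\<lambda>n. (1 / fact n) *\<^sub>R ((((*v) A) ^^ n) x)) sums (mexp A *v x)"
proof -
  have "bounded_linear (\<lambda>M :: real^'n^'n. M *v x)"
    unfolding linear_conv_bounded_linear[symmetric]
    by (rule linearI) (simp_all add: matrix_vector_mult_add_rdistrib scaleR_matrix_vector_assoc)
  from bounded_linear.sums[OF this summable_sums[OF summable_mexp]]
  show ?thesis
    by (simp add: mexp_def matrix_power_vector flip: scaleR_matrix_vector_assoc)
qed

text \<open>In the plane spanned by \<open>x\<close> and \<open>u = A x\<close> with \<open>A u = - \<bar>u\<bar>\<^sup>2 x\<close>, the exponential series of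
  \<open>t A\<close> at \<open>x\<close> splits into the cosine and sine series.\<close>

lemma mexp_eq_gexp:
  fixes A :: "real^'n^'n"
  assumes A: "A *v (A *v x) = - (norm (A *v x))\<^sup>2 *\<^sub>R x"
  shows "mexp (t *\<^sub>R A) *v x = gexp x (t *\<^sub>R (A *v x))"
proof -
  define u \<omega> where "u = A *v x" and "\<omega> = norm (A *v x)"
  have Au: "A *v u = - \<omega>\<^sup>2 *\<^sub>R x" using A by (simp add: u_def \<omega>_def)
  have tA: "(t *\<^sub>R A) *v z = t *\<^sub>R (A *v z)" for z by (simp add: scaleR_matrix_vector_assoc)
  have even_pow: "(((*v) (t *\<^sub>R A)) ^^ (2 * m)) x = ((- 1) ^ m * (\<omega> * t) ^ (2 * m)) *\<^sub>R x" for m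
  proof (induction m)
    case (Suc m)
    have "(((*v) (t *\<^sub>R A)) ^^ (2 * Suc m)) x = (t *\<^sub>R A) *v ((t *\<^sub>R A) *v ((((*v) (t *\<^sub>R A)) ^^ (2 * m)) x))"
      by simp
    also have "\<dots> = ((- 1) ^ m * (\<omega> * t) ^ (2 * m)) *\<^sub>R (t *\<^sub>R t *\<^sub>R (A *v u))"
      unfolding Suc.IH by (simp add: tA matrix_vector_mult_scaleR u_def)
    also have "\<dots> = ((- 1) ^ Suc m * (\<omega> * t) ^ (2 * Suc m)) *\<^sub>R x"
      unfolding Au by (simp add: power2_eq_square power_mult_distrib)
    finally show ?case .
  qed simp
  have odd_pow: "(((*v) (t *\<^sub>R A)) ^^ Suc (2 * m)) x = ((- 1) ^ m * (\<omega> * t) ^ (2 * m)) *\<^sub>R t *\<^sub>R u" for m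
    using even_pow[of m] by (simp add: tA matrix_vector_mult_scaleR u_def del: funpow.simps(2) add: funpow.simps(2))
  have term_eq: "(1 / fact n) *\<^sub>R ((((*v) (t *\<^sub>R A)) ^^ n) x)
      = (cos_coeff n *\<^sub>R (\<omega> * t) ^ n) *\<^sub>R x + ((sin_coeff n *\<^sub>R (\<omega> * t) ^ n) / \<omega>) *\<^sub>R u" for n
  proof (cases "even n")
    case True
    then obtain m where n: "n = 2 * m" by blast
    show ?thesis unfolding n even_pow by (simp add: cos_coeff_def sin_coeff_def)
  next
    case False
    then obtain m where n: "n = Suc (2 * m)" by (metis oddE Suc_eq_plus1)
    have "u = 0" if "\<omega> = 0" using that by (simp add: u_def \<omega>_def)
    then show ?thesis unfolding n odd_pow by (cases "\<omega> = 0") (auto simp: cos_coeff_def sin_coeff_def)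
  qed
  have "(\<lambda>n. (cos_coeff n *\<^sub>R (\<omega> * t) ^ n) *\<^sub>R x + ((sin_coeff n *\<^sub>R (\<omega> * t) ^ n) / \<omega>) *\<^sub>R u)
      sums (cos (\<omega> * t) *\<^sub>R x + (sin (\<omega> * t) / \<omega>) *\<^sub>R u)"
    by (intro sums_add bounded_linear.sums[OF bounded_linear_scaleR_left] sums_divide cos_converges sin_converges)
  then have "mexp (t *\<^sub>R A) *v x = cos (\<omega> * t) *\<^sub>R x + (sin (\<omega> * t) / \<omega>) *\<^sub>R u"
    using mexp_vector_sums[of "t *\<^sub>R A" x] sums_unique2 unfolding term_eq by blast
  then show ?thesis by (simp add: gexp_line u_def \<omega>_def)
qed

lemma o3_skew: "r \<in> o3 \<Longrightarrow> x \<bullet> (r *v y) = - ((r *v x) \<bullet> y)"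
proof -
  assume "r \<in> o3"
  then have "transpose r = - r" by (simp add: o3_def)
  have "x \<bullet> (r *v y) = (transpose r *v x) \<bullet> y"
    by (simp add: dot_lmul_matrix transpose_matrix_vector)
  also have "\<dots> = - ((r *v x) \<bullet> y)"
    unfolding \<open>transpose r = - r\<close> by (simp add: vec_eq_iff matrix_vector_mult_def inner_vec_def sum_negf)
  finally show ?thesis .
qed

text \<open>For skew-symmetric \<open>r\<close> the multiple of \<open>x\<close> in \<open>geodesic_generator\<close> must be \<open>- \<bar>r x\<bar>\<^sup>2\<close>, the acceleration of
  a great circle.\<close>

lemma geodesic_generator_orbit:
  assumes gen: "geodesic_generator r x" and x: "norm x = 1"
  shows "x \<bullet> (r *v x) = 0" "mexp (t *\<^sub>R r) *v x = gexp x (t *\<^sub>R (r *v x))"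
proof -
  have r: "r \<in> o3" using gen by (simp add: geodesic_generator_def)
  show "x \<bullet> (r *v x) = 0" using o3_skew[OF r, of x x] by (simp add: inner_commute)
  obtain k where k: "r *v (r *v x) = k *\<^sub>R x"
    using gen by (auto simp: geodesic_generator_def span_singleton)
  have "k = x \<bullet> (r *v (r *v x))" using x by (simp add: k dot_square_norm)
  also have "\<dots> = - (norm (r *v x))\<^sup>2" using o3_skew[OF r] by (simp add: dot_square_norm)
  finally show "mexp (t *\<^sub>R r) *v x = gexp x (t *\<^sub>R (r *v x))"
    using k by (intro mexp_eq_gexp) simp
qed

lemma geodesic_generator_exists:
  fixes x v :: "real^3"
  assumes x: "norm x = 1" "x \<bullet> v = 0"
  obtains r where "geodesic_generator r x" "r *v x = v"
proof -
  (* the infinitesimal rotation in the plane of x and v that takes x to v *)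
  define r :: "real^3^3" where "r = (\<chi> i j. v $ i * x $ j - x $ i * v $ j)"
  have r: "r *v z = (x \<bullet> z) *\<^sub>R v - (v \<bullet> z) *\<^sub>R x" for z
    by (simp add: r_def vec_eq_iff matrix_vector_mult_def inner_vec_def sum_3 algebra_simps)
  have "transpose r = - r" by (simp add: r_def transpose_def vec_eq_iff)
  moreover have rx: "r *v x = v" using x by (simp add: r dot_square_norm inner_commute)
  moreover have "r *v v = - (v \<bullet> v) *\<^sub>R x" using x by (simp add: r)
  then have "r *v (r *v x) \<in> span {x}" unfolding rx by (metis span_base span_scale singletonI)
  ultimately show ?thesis using that by (simp add: geodesic_generator_def o3_def)
qed

section \<open>Complete geodesic submanifolds of dimension one, two and three\<close>

lemma gexp_S2: "norm x = 1 \<Longrightarrow> gexp x ` {u. x \<bullet> u = 0} = S2"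
  by (simp add: gexp_hyperplane_image)

lemma gexp_span_0: "gexp x ` span {0} = {x}"
  by simp

lemma sphere_factor_S2: "sphere_factor 2 (sphere 0 1 :: (real^3) set)"
proof -
  have "sphere 0 1 \<noteq> ({} :: (real^3) set)" using vector_choose_size[of 1] by auto
  then show ?thesis
    using sphere_factor_section[OF subspace_UNIV, where 'a = "real^3"] connected_sphere[where 'a = "real^3"] by simp
qed

lemma complete_connected_exp_image:
  assumes V: "geodesic_tangent p k V" and p: "p \<in> prod_sphere"
  shows "complete_connected_geodesic_submanifold prod_sphere k (pexp p ` V)"
proof -
  have p1: "norm (fst p) = 1" "norm (snd p) = 1" using p by (auto simp: mem_Times_iff)
  show ?thesis
    using V
  proof (cases rule: geodesic_tangent.cases)
    case line
    then show ?thesis using complete_connected_geodesic[OF p] by simp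
  next
    case (graph R)
    show ?thesis unfolding graph(1,2) pexp_graph[OF graph(3,4) p1(1)]
      by (rule complete_connected_graph[OF graph(3)])
  next
    case first
    show ?thesis unfolding first pexp_Times gexp_S2[OF p1(1)] gexp_span_0
      using complete_connected_Times[OF sphere_factor_S2 sphere_factor_point[OF p1(2)]] by simp
  next
    case second
    show ?thesis unfolding second pexp_Times gexp_S2[OF p1(2)] gexp_span_0
      using complete_connected_Times[OF sphere_factor_point[OF p1(1)] sphere_factor_S2] by (simp only: add_0)
  next
    case (torus u w)
    show ?thesis unfolding torus(1,2) pexp_Times
      using complete_connected_Times[OF sphere_factor_great_circle[OF p1(1) torus(3,5)]
          sphere_factor_great_circle[OF p1(2) torus(4,6)]] by (simp add: numeral_2_eq_2)
  next
    case (first_circle w)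
    show ?thesis unfolding first_circle(1,2) pexp_Times gexp_S2[OF p1(1)]
      using complete_connected_Times[OF sphere_factor_S2 sphere_factor_great_circle[OF p1(2) first_circle(3,4)]] by simp
  next
    case (second_circle u)
    show ?thesis unfolding second_circle(1,2) pexp_Times gexp_S2[OF p1(2)]
      using complete_connected_Times[OF sphere_factor_great_circle[OF p1(1) second_circle(3,4)] sphere_factor_S2]
      by (simp add: numeral_3_eq_3)
  qed
qed

lemma connected_geodesic_subset_exp_image:
  assumes k: "k \<in> {1, 2, 3}" and N: "connected_geodesic_submanifold S2xS2 k N"
  obtains p V where "p \<in> S2xS2" "geodesic_tangent p k V" "N \<subseteq> pexp p ` V"
proof -
  obtain X where X: "topspace X = N" "N \<noteq> {}" "connected_space X" "geodesic_submanifold S2xS2 k X"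
    using N unfolding connected_geodesic_submanifold_def by blast
  obtain p where p: "p \<in> topspace X" using X(1,2) by blast
  then have "p \<in> S2xS2" using X(4) unfolding geodesic_submanifold_def by blast
  then show ?thesis
    using that tangent_space_classification[OF X(4) k p] connected_subset_exp_image[OF X(4) k X(3) p] X(1) by blast
qed

lemma complete_connected_exp_imageE:
  assumes k: "k \<in> {1, 2, 3}" and N: "complete_connected_geodesic_submanifold S2xS2 k N"
  obtains p V where "norm (fst p) = 1" "norm (snd p) = 1" "geodesic_tangent p k V" "N = pexp p ` V"
proof -
  obtain X where X: "topspace X = N" "N \<noteq> {}" "connected_space X" "geodesic_submanifold S2xS2 k X"
      "geodesically_complete S2xS2 X"
    using N unfolding complete_connected_geodesic_submanifold_def by blast
  obtain p where p: "p \<in> topspace X" using X(1,2) by blast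
  then have "p \<in> S2xS2" using X(4) unfolding geodesic_submanifold_def by blast
  then have "norm (fst p) = 1" "norm (snd p) = 1" by auto
  moreover have "N = pexp p ` tangent_space X p"
    using connected_subset_exp_image[OF X(4) k X(3) p] complete_exp_image_subset[OF X(4) k X(5) p] X(1) by blast
  ultimately show ?thesis
    using that tangent_space_classification[OF X(4) k p] by blast
qed

lemma orbit_eq:
  fixes x :: "real^3"
  assumes "geodesic_generator r x" "norm x = 1"
  shows "{mexp (t *\<^sub>R r) *v x |t. True} = gexp x ` span {r *v x}"
  using geodesic_generator_orbit(2)[OF assms] by (auto simp: span_singleton)

lemma orbit_pair_eq:
  fixes x y :: "real^3"
  assumes "geodesic_generator r\<^sub>1 x" "norm x = 1" "geodesic_generator r\<^sub>2 y" "norm y = 1"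
  shows "{(mexp (t *\<^sub>R r\<^sub>1) *v x, mexp (t *\<^sub>R r\<^sub>2) *v y) |t. True} = pexp (x, y) ` span {(r\<^sub>1 *v x, r\<^sub>2 *v y)}"
  unfolding geodesic_generator_orbit(2)[OF assms(1,2)] geodesic_generator_orbit(2)[OF assms(3,4)]
  by (simp add: span_singleton image_image pexp_def full_SetCompr_eq)

lemma torus_eq:
  fixes x y :: "real^3"
  assumes "geodesic_generator r\<^sub>1 x" "norm x = 1" "geodesic_generator r\<^sub>2 y" "norm y = 1"
  shows "{(mexp (t\<^sub>1 *\<^sub>R r\<^sub>1) *v x, mexp (t\<^sub>2 *\<^sub>R r\<^sub>2) *v y) |t\<^sub>1 t\<^sub>2. True}
    = (gexp x ` span {r\<^sub>1 *v x}) \<times> (gexp y ` span {r\<^sub>2 *v y})"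
  unfolding orbit_eq[OF assms(1,2), symmetric] orbit_eq[OF assms(3,4), symmetric] by auto

lemma sphere_times_circle_eq:
  fixes y :: "real^3"
  assumes "geodesic_generator r y" "norm y = 1"
  shows "{(x, mexp (t *\<^sub>R r) *v y) |x t. x \<in> S2} = S2 \<times> (gexp y ` span {r *v y})"
    and "{(mexp (t *\<^sub>R r) *v y, x) |x t. x \<in> S2} = (gexp y ` span {r *v y}) \<times> S2"
  unfolding orbit_eq[OF assms, symmetric] by auto

lemma complete_connected_1_iff:
  "complete_connected_geodesic_submanifold S2xS2 1 N \<longleftrightarrow>
        (\<exists>r\<^sub>1 r\<^sub>2. \<exists>x\<in>S2. \<exists>y\<in>S2.
           geodesic_generator r\<^sub>1 x \<and> geodesic_generator r\<^sub>2 y \<and>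
           \<not> (r\<^sub>1 *v x = 0 \<and> r\<^sub>2 *v y = 0) \<and>
           N = {(mexp (t *\<^sub>R r\<^sub>1) *v x, mexp (t *\<^sub>R r\<^sub>2) *v y) |t. True})" (is "?C \<longleftrightarrow> ?M")
proof
  assume C: ?C
  have "(1 :: nat) \<in> {1, 2, 3}" by simp
  from complete_connected_exp_imageE[OF this C] obtain p V where p1: "norm (fst p) = 1" "norm (snd p) = 1"
    and V: "geodesic_tangent p 1 V" "N = pexp p ` V" by metis
  then have pS: "fst p \<in> S2" "snd p \<in> S2" by auto
  from V(1) show ?M
  proof (cases (no_simp) rule: geodesic_tangent.cases)
    case (line v)
    obtain r\<^sub>1 where r1: "geodesic_generator r\<^sub>1 (fst p)" "r\<^sub>1 *v fst p = fst v"
      using geodesic_generator_exists[OF p1(1)] line(3) by (auto simp: sphere_tangent_def)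
    obtain r\<^sub>2 where r2: "geodesic_generator r\<^sub>2 (snd p)" "r\<^sub>2 *v snd p = snd v"
      using geodesic_generator_exists[OF p1(2)] line(3) by (auto simp: sphere_tangent_def)
    have "N = {(mexp (t *\<^sub>R r\<^sub>1) *v fst p, mexp (t *\<^sub>R r\<^sub>2) *v snd p) |t. True}"
      unfolding orbit_pair_eq[OF r1(1) p1(1) r2(1) p1(2)] V(2) line(2) r1(2) r2(2) by simp
    moreover have "\<not> (r\<^sub>1 *v fst p = 0 \<and> r\<^sub>2 *v snd p = 0)"
      using line(4) r1(2) r2(2) by (simp add: prod_eq_iff)
    ultimately show ?M using r1(1) r2(1) pS by blast
  qed simp_all
next
  assume ?M
  then obtain r\<^sub>1 r\<^sub>2 x y where g: "geodesic_generator r\<^sub>1 x" "norm x = 1" "geodesic_generator r\<^sub>2 y" "norm y = 1"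
    and ne: "\<not> (r\<^sub>1 *v x = 0 \<and> r\<^sub>2 *v y = 0)"
    and N: "N = {(mexp (t *\<^sub>R r\<^sub>1) *v x, mexp (t *\<^sub>R r\<^sub>2) *v y) |t. True}" by auto
  have "(r\<^sub>1 *v x, r\<^sub>2 *v y) \<in> sphere_tangent (x, y)"
    using geodesic_generator_orbit(1)[OF g(1,2)] geodesic_generator_orbit(1)[OF g(3,4)]
    by (simp add: sphere_tangent_def)
  then show ?C
    unfolding N orbit_pair_eq[OF g] using g(2,4) ne
    by (intro complete_connected_geodesic) (auto simp: zero_prod_def)
qed

lemma complete_connected_2_iff:
  "complete_connected_geodesic_submanifold S2xS2 2 N \<longleftrightarrow>
        (\<exists>R\<in>O3. N = {(x, R *v x) |x. x \<in> S2}) \<or>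
        (\<exists>y\<in>S2. N = {(x, y) |x. x \<in> S2}) \<or>
        (\<exists>x\<in>S2. N = {(x, y) |y. y \<in> S2}) \<or>
        (\<exists>r\<^sub>1 r\<^sub>2. \<exists>x\<in>S2. \<exists>y\<in>S2.
           geodesic_generator r\<^sub>1 x \<and> geodesic_generator r\<^sub>2 y \<and>
           r\<^sub>1 *v x \<noteq> 0 \<and> r\<^sub>2 *v y \<noteq> 0 \<and>
           N = {(mexp (t\<^sub>1 *\<^sub>R r\<^sub>1) *v x, mexp (t\<^sub>2 *\<^sub>R r\<^sub>2) *v y) |t\<^sub>1 t\<^sub>2. True})"
    (is "?C \<longleftrightarrow> ?G \<or> ?A \<or> ?B \<or> ?T")
proof
  assume C: ?C
  have "(2 :: nat) \<in> {1, 2, 3}" by simp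
  from complete_connected_exp_imageE[OF this C] obtain p V where p1: "norm (fst p) = 1" "norm (snd p) = 1"
    and V: "geodesic_tangent p 2 V" "N = pexp p ` V" by metis
  then have pS: "fst p \<in> S2" "snd p \<in> S2" by auto
  from V(1) show "?G \<or> ?A \<or> ?B \<or> ?T"
  proof (cases (no_simp) rule: geodesic_tangent.cases)
    case (graph R)
    have "N = {(x, R *v x) |x. x \<in> S2}"
      unfolding V(2) graph(2) by (rule pexp_graph[OF graph(3,4) p1(1)])
    then show ?thesis using graph(3) by blast
  next
    case first
    have "N = {(x, snd p) |x. x \<in> S2}"
      unfolding V(2) first(2) pexp_Times gexp_S2[OF p1(1)] gexp_span_0 by auto
    then show ?thesis using pS(2) by blast
  next
    case second
    have "N = {(fst p, y) |y. y \<in> S2}"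
      unfolding V(2) second(2) pexp_Times gexp_S2[OF p1(2)] gexp_span_0 by auto
    then show ?thesis using pS(1) by blast
  next
    case (torus u w)
    obtain r\<^sub>1 where r1: "geodesic_generator r\<^sub>1 (fst p)" "r\<^sub>1 *v fst p = u"
      using geodesic_generator_exists[OF p1(1) torus(3)] by blast
    obtain r\<^sub>2 where r2: "geodesic_generator r\<^sub>2 (snd p)" "r\<^sub>2 *v snd p = w"
      using geodesic_generator_exists[OF p1(2) torus(4)] by blast
    have "N = {(mexp (t\<^sub>1 *\<^sub>R r\<^sub>1) *v fst p, mexp (t\<^sub>2 *\<^sub>R r\<^sub>2) *v snd p) |t\<^sub>1 t\<^sub>2. True}"
      unfolding torus_eq[OF r1(1) p1(1) r2(1) p1(2)] V(2) torus(2) pexp_Times r1(2) r2(2) by (rule refl)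
    moreover have "r\<^sub>1 *v fst p \<noteq> 0" "r\<^sub>2 *v snd p \<noteq> 0" using torus r1 r2 by auto
    ultimately have ?T using r1(1) r2(1) pS by blast
    then show ?thesis by blast
  qed simp_all
next
  assume "?G \<or> ?A \<or> ?B \<or> ?T"
  then show ?C
  proof (elim disjE)
    assume ?G
    then show ?C using complete_connected_graph by blast
  next
    assume ?A
    then obtain y where "norm y = 1" "N = {(x, y) |x. x \<in> S2}" by auto
    moreover have "{(x, y) |x. x \<in> S2} = S2 \<times> {y}" by auto
    ultimately show ?C using complete_connected_Times[OF sphere_factor_S2 sphere_factor_point] by simp
  next
    assume ?B
    then obtain x where "norm x = 1" "N = {(x, y) |y. y \<in> S2}" by auto
    moreover have "{(x, y) |y. y \<in> S2} = {x} \<times> S2" by auto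
    ultimately show ?C using complete_connected_Times[OF sphere_factor_point sphere_factor_S2] by (simp only: add_0)
  next
    assume ?T
    then obtain r\<^sub>1 r\<^sub>2 x y where g: "geodesic_generator r\<^sub>1 x" "norm x = 1" "geodesic_generator r\<^sub>2 y" "norm y = 1"
      and ne: "r\<^sub>1 *v x \<noteq> 0" "r\<^sub>2 *v y \<noteq> 0"
      and N: "N = {(mexp (t\<^sub>1 *\<^sub>R r\<^sub>1) *v x, mexp (t\<^sub>2 *\<^sub>R r\<^sub>2) *v y) |t\<^sub>1 t\<^sub>2. True}" by auto
    show ?C
      unfolding N torus_eq[OF g]
      using complete_connected_Times[OF
          sphere_factor_great_circle[OF g(2) geodesic_generator_orbit(1)[OF g(1,2)] ne(1)]
          sphere_factor_great_circle[OF g(4) geodesic_generator_orbit(1)[OF g(3,4)] ne(2)]]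
      by (simp only: one_add_one)
  qed
qed

lemma complete_connected_3_iff:
  "complete_connected_geodesic_submanifold S2xS2 3 N \<longleftrightarrow>
        (\<exists>r. \<exists>y\<in>S2. geodesic_generator r y \<and> r *v y \<noteq> 0 \<and>
           N = {(x, mexp (t *\<^sub>R r) *v y) |x t. x \<in> S2}) \<or>
        (\<exists>r. \<exists>x\<in>S2. geodesic_generator r x \<and> r *v x \<noteq> 0 \<and>
           N = {(mexp (t *\<^sub>R r) *v x, y) |y t. y \<in> S2})" (is "?C \<longleftrightarrow> ?A \<or> ?B")
proof
  assume C: ?C
  have "(3 :: nat) \<in> {1, 2, 3}" by simp
  from complete_connected_exp_imageE[OF this C] obtain p V where p1: "norm (fst p) = 1" "norm (snd p) = 1"
    and V: "geodesic_tangent p 3 V" "N = pexp p ` V" by metis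
  then have pS: "fst p \<in> S2" "snd p \<in> S2" by auto
  from V(1) show "?A \<or> ?B"
  proof (cases (no_simp) rule: geodesic_tangent.cases)
    case (first_circle w)
    obtain r where r: "geodesic_generator r (snd p)" "r *v snd p = w"
      using geodesic_generator_exists[OF p1(2) first_circle(3)] by blast
    have "N = {(x, mexp (t *\<^sub>R r) *v snd p) |x t. x \<in> S2}"
      unfolding sphere_times_circle_eq(1)[OF r(1) p1(2)] V(2) first_circle(2) pexp_Times gexp_S2[OF p1(1)] r(2)
      by (rule refl)
    moreover have "r *v snd p \<noteq> 0" using r(2) first_circle(4) by simp
    ultimately have ?A using r(1) pS(2) by blast
    then show ?thesis by blast
  next
    case (second_circle u)
    obtain r where r: "geodesic_generator r (fst p)" "r *v fst p = u"
      using geodesic_generator_exists[OF p1(1) second_circle(3)] by blast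
    have "N = {(mexp (t *\<^sub>R r) *v fst p, y) |y t. y \<in> S2}"
      unfolding sphere_times_circle_eq(2)[OF r(1) p1(1)] V(2) second_circle(2) pexp_Times gexp_S2[OF p1(2)] r(2)
      by (rule refl)
    moreover have "r *v fst p \<noteq> 0" using r(2) second_circle(4) by simp
    ultimately have ?B using r(1) pS(1) by blast
    then show ?thesis by blast
  qed simp_all
next
  assume "?A \<or> ?B"
  then show ?C
  proof
    assume ?A
    then obtain r y where g: "geodesic_generator r y" "norm y = 1" "r *v y \<noteq> 0"
      and N: "N = {(x, mexp (t *\<^sub>R r) *v y) |x t. x \<in> S2}" by auto
    have "sphere_factor 1 (gexp y ` span {r *v y})"
      by (rule sphere_factor_great_circle[OF g(2) geodesic_generator_orbit(1)[OF g(1,2)] g(3)])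
    then show ?C unfolding N sphere_times_circle_eq(1)[OF g(1,2)]
      using complete_connected_Times[OF sphere_factor_S2, of 1] by simp
  next
    assume ?B
    then obtain r x where g: "geodesic_generator r x" "norm x = 1" "r *v x \<noteq> 0"
      and N: "N = {(mexp (t *\<^sub>R r) *v x, y) |y t. y \<in> S2}" by auto
    have "sphere_factor 1 (gexp x ` span {r *v x})"
      by (rule sphere_factor_great_circle[OF g(2) geodesic_generator_orbit(1)[OF g(1,2)] g(3)])
    then show ?C unfolding N sphere_times_circle_eq(2)[OF g(1,2)]
      using complete_connected_Times[OF _ sphere_factor_S2, of 1] by (simp add: numeral_3_eq_3)
  qed
qed

section \<open>Diffeomorphism types\<close>

text \<open>Linear maps suffice, because a great circle spans a plane; only the slices need a translation as well.\<close>

lemma diffeomorphic_linear: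
  assumes "bounded_linear f" "bounded_linear g" "\<And>x. x \<in> A \<Longrightarrow> f x \<in> B \<and> g (f x) = x"
    "\<And>y. y \<in> B \<Longrightarrow> g y \<in> A \<and> f (g y) = y"
  shows "diffeomorphic A B"
  unfolding diffeomorphic_def
proof (intro exI conjI)
  show "homeomorphism A B f g"
    by (rule homeomorphismI[OF linear_continuous_on[OF assms(1)] linear_continuous_on[OF assms(2)]])
      (use assms(3,4) in auto)
  show "smooth_map_on A f" "smooth_map_on B g"
    unfolding smooth_map_on_def using smooth_on_linear[OF assms(1) open_UNIV] smooth_on_linear[OF assms(2) open_UNIV]
    by (metis UNIV_I open_UNIV)+
qed

lemma great_circle_coordinates:
  fixes x u :: "real^3"
  assumes x: "norm x = 1" "x \<bullet> u = 0" "u \<noteq> 0"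
  shows "\<exists>(f :: real^3 \<Rightarrow> real^2) g. bounded_linear f \<and> bounded_linear g \<and>
    (\<forall>z\<in>gexp x ` span {u}. f z \<in> S1 \<and> g (f z) = z) \<and>
    (\<forall>w\<in>S1. g w \<in> gexp x ` span {u} \<and> f (g w) = w)"
proof -
  define e where "e = (1 / norm u) *\<^sub>R u"
  have e: "x \<bullet> e = 0" "e \<bullet> x = 0" "e \<bullet> e = 1" and xx: "x \<bullet> x = 1"
    using x by (auto simp: e_def inner_commute dot_square_norm power2_eq_square)
  define f :: "real^3 \<Rightarrow> real^2" where "f z = (\<chi> i. if i = 1 then x \<bullet> z else e \<bullet> z)" for z
  define g :: "real^2 \<Rightarrow> real^3" where "g w = (w $ 1) *\<^sub>R x + (w $ 2) *\<^sub>R e" for w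
  have lin: "linear f" "linear g"
    unfolding f_def g_def
    by (rule linearI; simp add: vec_eq_iff inner_add_right algebra_simps)+
  have fg: "f (g w) = w" for w
    using exhaust_2 by (auto simp: vec_eq_iff f_def g_def inner_add_right e xx)
  have g_norm: "g w \<bullet> g w = w \<bullet> w" for w
  proof -
    have "g w \<bullet> g w = w $ 1 * w $ 1 + w $ 2 * w $ 2"
      by (simp add: g_def inner_add_left inner_add_right e xx)
    then show ?thesis by (simp add: inner_vec_def sum_2)
  qed
  have g_circle: "g w \<in> gexp x ` span {u}" if "norm w = 1" for w
  proof -
    have "norm (g w) = 1" using g_norm[of w] that by (simp add: norm_eq_sqrt_inner)
    moreover have "g w \<in> span {x, u}" by (auto simp: in_span_pair g_def e_def)
    ultimately show ?thesis unfolding great_circle_eq[OF x] by simp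
  qed
  have gf: "f z \<in> S1 \<and> g (f z) = z" if z: "z \<in> gexp x ` span {u}" for z
  proof -
    obtain a b where ab: "z = a *\<^sub>R x + b *\<^sub>R u" and n: "norm z = 1"
      using z unfolding great_circle_eq[OF x] by (auto simp: in_span_pair)
    have "u = norm u *\<^sub>R e" using x(3) by (simp add: e_def)
    then have "z = a *\<^sub>R x + (b * norm u) *\<^sub>R e" using ab by (metis scaleR_scaleR)
    then have eq: "g (f z) = z"
      by (simp add: f_def g_def inner_add_right e xx)
    then have "norm (f z) = 1" using g_norm[of "f z"] n by (simp add: norm_eq_sqrt_inner)
    then show ?thesis using eq by simp
  qed
  show ?thesis
    using lin fg gf g_circle by (intro exI[of _ f] exI[of _ g]) (auto simp: linear_conv_bounded_linear)
qed

lemma diffeomorphic_graph: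
  assumes "R \<in> O3"
  shows "diffeomorphic {(x, R *v x) |x. x \<in> S2} S2"
  by (rule diffeomorphic_linear[of fst "\<lambda>x. (x, R *v x)"])
    (auto intro!: bounded_linear_fst bounded_linear_Pair bounded_linear_ident)

lemma smooth_map_on_affine:
  "bounded_linear L \<Longrightarrow> smooth_map_on A (\<lambda>x. L x + b)"
  unfolding smooth_map_on_def
  using smooth_on_add[OF open_UNIV smooth_on_linear[OF _ open_UNIV] smooth_on_const[OF open_UNIV]] by blast

lemma diffeomorphic_slice:
  "diffeomorphic {(x, y) |x. x \<in> A} A" "diffeomorphic {(x, y) |y. y \<in> B} B"
proof -
  have bl: "bounded_linear (\<lambda>x. (x, 0))" "bounded_linear (\<lambda>y. (0, y))"
    by (auto intro!: bounded_linear_Pair bounded_linear_ident bounded_linear_zero)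
  have "homeomorphism {(x, y) |x. x \<in> A} A fst (\<lambda>x. (x, y))"
    by (rule homeomorphismI) (auto intro!: continuous_intros)
  moreover have "smooth_map_on {(x, y) |x. x \<in> A} fst" "smooth_map_on A (\<lambda>x. (x, y))"
    using smooth_map_on_affine[OF bounded_linear_fst, of _ 0] smooth_map_on_affine[OF bl(1), of A "(0, y)"] by auto
  ultimately show "diffeomorphic {(x, y) |x. x \<in> A} A" unfolding diffeomorphic_def by blast
  have "homeomorphism {(x, y) |y. y \<in> B} B snd (\<lambda>y. (x, y))"
    by (rule homeomorphismI) (auto intro!: continuous_intros)
  moreover have "smooth_map_on {(x, y) |y. y \<in> B} snd" "smooth_map_on B (\<lambda>y. (x, y))"
    using smooth_map_on_affine[OF bounded_linear_snd, of _ 0] smooth_map_on_affine[OF bl(2), of B "(x, 0)"] by auto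
  ultimately show "diffeomorphic {(x, y) |y. y \<in> B} B" unfolding diffeomorphic_def by blast
qed

lemma diffeomorphic_torus:
  fixes x y :: "real^3"
  assumes x: "norm x = 1" "x \<bullet> u = 0" "u \<noteq> 0" and y: "norm y = 1" "y \<bullet> w = 0" "w \<noteq> 0"
  shows "diffeomorphic ((gexp x ` span {u}) \<times> (gexp y ` span {w})) (S1 \<times> S1)"
proof -
  obtain f1 :: "real^3 \<Rightarrow> real^2" and g1 where 1: "bounded_linear f1" "bounded_linear g1"
    "\<forall>z\<in>gexp x ` span {u}. f1 z \<in> S1 \<and> g1 (f1 z) = z"
    "\<forall>s\<in>S1. g1 s \<in> gexp x ` span {u} \<and> f1 (g1 s) = s"
    using great_circle_coordinates[OF x] by blast
  obtain f2 :: "real^3 \<Rightarrow> real^2" and g2 where 2: "bounded_linear f2" "bounded_linear g2"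
    "\<forall>z\<in>gexp y ` span {w}. f2 z \<in> S1 \<and> g2 (f2 z) = z"
    "\<forall>s\<in>S1. g2 s \<in> gexp y ` span {w} \<and> f2 (g2 s) = s"
    using great_circle_coordinates[OF y] by blast
  show ?thesis
  proof (rule diffeomorphic_linear)
    show "bounded_linear (\<lambda>z. (f1 (fst z), f2 (snd z)))" "bounded_linear (\<lambda>z. (g1 (fst z), g2 (snd z)))"
      using bounded_linear_compose[OF 1(1) bounded_linear_fst] bounded_linear_compose[OF 2(1) bounded_linear_snd]
        bounded_linear_compose[OF 1(2) bounded_linear_fst] bounded_linear_compose[OF 2(2) bounded_linear_snd]
      by (auto intro: bounded_linear_Pair)
  qed (use bspec[OF 1(3)] bspec[OF 1(4)] bspec[OF 2(3)] bspec[OF 2(4)] in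
      \<open>auto simp: mem_Times_iff simp del: mem_sphere_0\<close>)
qed

lemma diffeomorphic_sphere_times_circle:
  fixes y :: "real^3"
  assumes y: "norm y = 1" "y \<bullet> w = 0" "w \<noteq> 0"
  shows "diffeomorphic (S2 \<times> (gexp y ` span {w})) (S2 \<times> S1)"
    and "diffeomorphic ((gexp y ` span {w}) \<times> S2) (S2 \<times> S1)"
proof -
  obtain f :: "real^3 \<Rightarrow> real^2" and g where 2: "bounded_linear f" "bounded_linear g"
    "\<forall>z\<in>gexp y ` span {w}. f z \<in> S1 \<and> g (f z) = z"
    "\<forall>s\<in>S1. g s \<in> gexp y ` span {w} \<and> f (g s) = s"
    using great_circle_coordinates[OF y] by blast
  have bl: "bounded_linear (\<lambda>z. f (snd z))" "bounded_linear (\<lambda>z. f (fst z))" "bounded_linear (\<lambda>z. g (snd z))"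
    using bounded_linear_compose[OF 2(1) bounded_linear_fst] bounded_linear_compose[OF 2(1) bounded_linear_snd]
      bounded_linear_compose[OF 2(2) bounded_linear_snd] by auto
  show "diffeomorphic (S2 \<times> (gexp y ` span {w})) (S2 \<times> S1)"
  proof (rule diffeomorphic_linear)
    show "bounded_linear (\<lambda>z. (fst z, f (snd z)))" "bounded_linear (\<lambda>z. (fst z, g (snd z)))"
      using bl by (auto intro: bounded_linear_Pair bounded_linear_fst)
  qed (use bspec[OF 2(3)] bspec[OF 2(4)] in
      \<open>auto simp: mem_Times_iff simp del: mem_sphere_0\<close>)
  show "diffeomorphic ((gexp y ` span {w}) \<times> S2) (S2 \<times> S1)"
  proof (rule diffeomorphic_linear)
    show "bounded_linear (\<lambda>z. (snd z, f (fst z)))" "bounded_linear (\<lambda>z. (g (snd z), fst z))"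
      using bl by (auto intro: bounded_linear_Pair bounded_linear_fst bounded_linear_snd)
  qed (use bspec[OF 2(3)] bspec[OF 2(4)] in
      \<open>auto simp: mem_Times_iff simp del: mem_sphere_0\<close>)
qed

section \<open>Geodesic submanifolds of the product of two spheres\<close>

theorem theorem2:
  shows
    "(\<forall>N. complete_connected_geodesic_submanifold S2xS2 1 N \<longleftrightarrow>
        (\<exists>r\<^sub>1 r\<^sub>2. \<exists>x\<in>S2. \<exists>y\<in>S2.
           geodesic_generator r\<^sub>1 x \<and> geodesic_generator r\<^sub>2 y \<and>
           \<not> (r\<^sub>1 *v x = 0 \<and> r\<^sub>2 *v y = 0) \<and>
           N = {(mexp (t *\<^sub>R r\<^sub>1) *v x, mexp (t *\<^sub>R r\<^sub>2) *v y) |t. True})) \<and>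
     (\<forall>N. complete_connected_geodesic_submanifold S2xS2 2 N \<longleftrightarrow>
        (\<exists>R\<in>O3. N = {(x, R *v x) |x. x \<in> S2}) \<or>
        (\<exists>y\<in>S2. N = {(x, y) |x. x \<in> S2}) \<or>
        (\<exists>x\<in>S2. N = {(x, y) |y. y \<in> S2}) \<or>
        (\<exists>r\<^sub>1 r\<^sub>2. \<exists>x\<in>S2. \<exists>y\<in>S2.
           geodesic_generator r\<^sub>1 x \<and> geodesic_generator r\<^sub>2 y \<and>
           r\<^sub>1 *v x \<noteq> 0 \<and> r\<^sub>2 *v y \<noteq> 0 \<and>
           N = {(mexp (t\<^sub>1 *\<^sub>R r\<^sub>1) *v x, mexp (t\<^sub>2 *\<^sub>R r\<^sub>2) *v y) |t\<^sub>1 t\<^sub>2. True})) \<and>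
     (\<forall>N. complete_connected_geodesic_submanifold S2xS2 3 N \<longleftrightarrow>
        (\<exists>r. \<exists>y\<in>S2. geodesic_generator r y \<and> r *v y \<noteq> 0 \<and>
           N = {(x, mexp (t *\<^sub>R r) *v y) |x t. x \<in> S2}) \<or>
        (\<exists>r. \<exists>x\<in>S2. geodesic_generator r x \<and> r *v x \<noteq> 0 \<and>
           N = {(mexp (t *\<^sub>R r) *v x, y) |y t. y \<in> S2})) \<and>
     (\<forall>k\<in>{1, 2, 3}. \<forall>N. connected_geodesic_submanifold S2xS2 k N \<longrightarrow>
        (\<exists>L. complete_connected_geodesic_submanifold S2xS2 k L \<and> N \<subseteq> L)) \<and>
     (\<forall>R\<in>O3. diffeomorphic {(x, R *v x) |x. x \<in> S2} S2) \<and>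
     (\<forall>y\<in>S2. diffeomorphic {(x, y) |x. x \<in> S2} S2) \<and>
     (\<forall>x\<in>S2. diffeomorphic {(x, y) |y. y \<in> S2} S2) \<and>
     (\<forall>r\<^sub>1 r\<^sub>2. \<forall>x\<in>S2. \<forall>y\<in>S2.
        geodesic_generator r\<^sub>1 x \<and> geodesic_generator r\<^sub>2 y \<and> r\<^sub>1 *v x \<noteq> 0 \<and> r\<^sub>2 *v y \<noteq> 0 \<longrightarrow>
        diffeomorphic
          {(mexp (t\<^sub>1 *\<^sub>R r\<^sub>1) *v x, mexp (t\<^sub>2 *\<^sub>R r\<^sub>2) *v y) |t\<^sub>1 t\<^sub>2. True} (S1 \<times> S1)) \<and>
     (\<forall>r. \<forall>y\<in>S2. geodesic_generator r y \<and> r *v y \<noteq> 0 \<longrightarrow>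
        diffeomorphic {(x, mexp (t *\<^sub>R r) *v y) |x t. x \<in> S2} (S2 \<times> S1)) \<and>
     (\<forall>r. \<forall>x\<in>S2. geodesic_generator r x \<and> r *v x \<noteq> 0 \<longrightarrow>
        diffeomorphic {(mexp (t *\<^sub>R r) *v x, y) |y t. y \<in> S2} (S2 \<times> S1))"
proof (intro conjI allI ballI impI)
  show "diffeomorphic {(x, R *v x) |x. x \<in> S2} S2" if "R \<in> O3" for R
    by (rule diffeomorphic_graph[OF that])
  show "diffeomorphic {(x, y) |x. x \<in> S2} S2" for y :: "real^3"
    by (rule diffeomorphic_slice)
  show "diffeomorphic {(x, y) |y. y \<in> S2} S2" for x :: "real^3"
    by (rule diffeomorphic_slice)
  show "\<exists>L. complete_connected_geodesic_submanifold S2xS2 k L \<and> N \<subseteq> L"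
    if "k \<in> {1, 2, 3}" "connected_geodesic_submanifold S2xS2 k N" for k N
    using connected_geodesic_subset_exp_image[OF that] complete_connected_exp_image by metis
  show "diffeomorphic {(mexp (t\<^sub>1 *\<^sub>R r\<^sub>1) *v x, mexp (t\<^sub>2 *\<^sub>R r\<^sub>2) *v y) |t\<^sub>1 t\<^sub>2. True} (S1 \<times> S1)"
    if "x \<in> S2" "y \<in> S2"
      "geodesic_generator r\<^sub>1 x \<and> geodesic_generator r\<^sub>2 y \<and> r\<^sub>1 *v x \<noteq> 0 \<and> r\<^sub>2 *v y \<noteq> 0" for r\<^sub>1 r\<^sub>2 x y
  proof -
    have n: "norm x = 1" "norm y = 1" using that(1,2) by auto
    have g: "geodesic_generator r\<^sub>1 x" "geodesic_generator r\<^sub>2 y" "r\<^sub>1 *v x \<noteq> 0" "r\<^sub>2 *v y \<noteq> 0"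
      using that(3) by auto
    show ?thesis
      unfolding torus_eq[OF g(1) n(1) g(2) n(2)]
      by (rule diffeomorphic_torus[OF n(1) geodesic_generator_orbit(1)[OF g(1) n(1)] g(3)
            n(2) geodesic_generator_orbit(1)[OF g(2) n(2)] g(4)])
  qed
  show "diffeomorphic {(x, mexp (t *\<^sub>R r) *v y) |x t. x \<in> S2} (S2 \<times> S1)"
    if "y \<in> S2" "geodesic_generator r y \<and> r *v y \<noteq> 0" for r y
  proof -
    have n: "norm y = 1" using that(1) by auto
    have g: "geodesic_generator r y" "r *v y \<noteq> 0" using that(2) by auto
    show ?thesis
      unfolding sphere_times_circle_eq(1)[OF g(1) n]
      by (rule diffeomorphic_sphere_times_circle(1)[OF n geodesic_generator_orbit(1)[OF g(1) n] g(2)])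
  qed
  show "diffeomorphic {(mexp (t *\<^sub>R r) *v x, y) |y t. y \<in> S2} (S2 \<times> S1)"
    if "x \<in> S2" "geodesic_generator r x \<and> r *v x \<noteq> 0" for r x
  proof -
    have n: "norm x = 1" using that(1) by auto
    have g: "geodesic_generator r x" "r *v x \<noteq> 0" using that(2) by auto
    show ?thesis
      unfolding sphere_times_circle_eq(2)[OF g(1) n]
      by (rule diffeomorphic_sphere_times_circle(2)[OF n geodesic_generator_orbit(1)[OF g(1) n] g(2)])
  qed
qed (fact complete_connected_1_iff complete_connected_2_iff complete_connected_3_iff)+

end
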